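(* Two rooted, weighted $\mathbb{R}$-trees are mass-structurally equivalent if and only if they have the same image under $\Theta$, where $\Theta(\mathcal{T},d,r,p)$ denotes the law of the random hierarchy on $\mathbb{N}$ derived by sampling from $(\mathcal{T},d,r,p)$.
   Context: A real tree ($\mathbb{R}$-tree) is a complete, separable, bounded metric space $(\mathcal{T},d)$ such that (i) for all $x,y\in\mathcal{T}$ there is a unique non-self-intersecting path in $\mathcal{T}$ from $x$ to $y$, called the segment $[[x,y]]_{\mathcal{T}}$, and (ii) each segment is isometric to a closed real interval. Compactness is not required. A rooted, weighted $\mathbb{R}$-tree is a quadruple $(\mathcal{T},d,r,p)$ with $(\mathcal{T},d)$ an $\mathbb{R}$-tree, $r\in\mathcal{T}$ a distinguished vertex (the root), and $p$ a probability distribution on $\mathcal{T}$ with respect to the Borel $\sigma$-algebra generated by $d$. The fringe subtree rooted at $x$ is $F_x(\mathcal{T}):=\{y\in\mathcal{T}: x\in[[r,y]]_{\mathcal{T}}\}$. A point $x$ is a branch point if there exist three non-trivial segments with endpoint $x$ whose pairwise intersections all equal $\{x\}$; it is a leaf if it is an endpoint of every segment to which it belongs. The subtree spanned by (the closed support of) $p$ is $\mathrm{Span}(p):=\bigcup_{x\in\mathrm{support}(p)}[[r,x]]_{\mathcal{T}}$. The special points of $(\mathcal{T},d,r,p)$ are: (a) the locations of atoms of $p$; (b) the branch points of $\mathrm{Span}(p)$; (c) the isolated leaves of $\mathrm{Span}(p)$, meaning leaves of $\mathrm{Span}(p)$ that are not limit points of the branch points of $\mathrm{Span}(p)$. Let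 $\mathscr{S}_i$ be the set of special points of $(\mathcal{T}_i,d_i,r_i,p_i)$, $i=1,2$. A mass-structural isomorphism between these trees is a bijection $\phi:\mathscr{S}_1\to\mathscr{S}_2$ such that: (i) for every $x\in\mathscr{S}_1$, $p_1([[r_1,x]]_{\mathcal{T}_1})=p_2([[r_2,\phi(x)]]_{\mathcal{T}_2})$, $p_1\{x\}=p_2\{\phi(x)\}$ and $p_1(F_x(\mathcal{T}_1))=p_2(F_{\phi(x)}(\mathcal{T}_2))$; (ii) for $x,y\in\mathscr{S}_1$, $x\in[[r_1,y]]_{\mathcal{T}_1}$ if and only if $\phi(x)\in[[r_2,\phi(y)]]_{\mathcal{T}_2}$. Two rooted, weighted $\mathbb{R}$-trees are mass-structurally equivalent if there exists a mass-structural isomorphism from one to the other. A hierarchy on a finite set $S$ is a collection $\mathcal{H}$ of subsets of $S$ such that $A\cap B$ equals $A$ or $B$ or $\varnothing$ for all $A,B\in\mathcal{H}$, and $S\in\mathcal{H}$, $\varnothing\in\mathcal{H}$, $\{s\}\in\mathcal{H}$ for all $s\in S$. With $[n]:=\{1,\dots,n\}$, a hierarchy on $\mathbb{N}$ is a sequence $(\mathcal{H}_n)_{n\ge1}$ with each $\mathcal{H}_n$ a hierarchy on $[n]$ and $\mathcal{H}_n=\{A\cap[n]:A\in\mathcal{H}_{n+1}\}$ for all $n\ge1$. Given a rooted, weighted $\mathbb{R}$-tree $(\mathcal{T},d,r,p)$, let $(x_i)_{i\ge1}$ be an i.i.d. random sequence with law $p$ and set $$\mathcal{H}_n:=\big\{\{i\in[n]:x_i\in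 F_x(\mathcal{T})\}:x\in\mathcal{T}\big\}\cup\{\{i\}:i\in[n]\}\cup\{\varnothing\},\qquad n\ge1.$$ The random hierarchy $(\mathcal{H}_n)_{n\ge1}$ on $\mathbb{N}$ is said to be derived by sampling from $(\mathcal{T},d,r,p)$; $\Theta(\mathcal{T},d,r,p)$ denotes its law.
   Formalization: Special points at the root follow the rooted convention: the root is never a leaf of Span(p), and it is a branch point as soon as two non-trivial segments of Span(p) meet only at the root; with the literal definitions the claim fails (one point versus [0,1] rooted at 0 with unit mass at 1). *)

theory Defs
  imports "HOL-Probability.Probability"
begin

text \<open>
  The underlying space of a tree is a whole type of class \<open>polish_space\<close> (complete and
  second countable), with metric \<open>dist\<close> and Borel sigma-algebra \<open>borel\<close>.
  Paths are identified with their images. The library notion \<open>arc\<close> requires distinct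
  end points, so the trivial path from a point to itself is added by hand.
\<close>

definition is_segment :: "'a::topological_space \<Rightarrow> 'a \<Rightarrow> 'a set \<Rightarrow> bool" where
  "is_segment x y S \<longleftrightarrow>
     (x = y \<and> S = {x}) \<or>
     (\<exists>g. arc g \<and> pathstart g = x \<and> pathfinish g = y \<and> path_image g = S)"

definition isometric_to_interval :: "'a::metric_space set \<Rightarrow> bool" where
  "isometric_to_interval S \<longleftrightarrow>
     (\<exists>(a::real) b f. a \<le> b \<and> f ` {a..b} = S \<and>
        (\<forall>s\<in>{a..b}. \<forall>t\<in>{a..b}. dist (f s) (f t) = dist s t))"

definition real_tree :: "'a::polish_space itself \<Rightarrow> bool" where
  "real_tree (_ :: 'a itself) \<longleftrightarrow>
     bounded (UNIV :: 'a set) \<and>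
     (\<forall>x y :: 'a. \<exists>!S. is_segment x y S) \<and>
     (\<forall>(x :: 'a) y S. is_segment x y S \<longrightarrow> isometric_to_interval S)"

definition segment :: "'a::topological_space \<Rightarrow> 'a \<Rightarrow> 'a set" where
  "segment x y = (THE S. is_segment x y S)"

definition rooted_weighted_real_tree :: "'a::polish_space \<Rightarrow> 'a measure \<Rightarrow> bool" where
  "rooted_weighted_real_tree r p \<longleftrightarrow>
     real_tree TYPE('a) \<and> prob_space p \<and> sets p = sets borel"

definition fringe :: "'a::topological_space \<Rightarrow> 'a \<Rightarrow> 'a set" where
  "fringe r x = {y. x \<in> segment r y}"

text \<open>
  Branch points and leaves of a subtree \<open>A\<close>, whose segments are the segments of the
  ambient tree contained in \<open>A\<close>.
\<close>

definition branch_points :: "'a::topological_space set \<Rightarrow> 'a set" where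
  "branch_points A =
     {x. \<exists>u v w. u \<noteq> x \<and> v \<noteq> x \<and> w \<noteq> x \<and>
        segment x u \<subseteq> A \<and> segment x v \<subseteq> A \<and> segment x w \<subseteq> A \<and>
        segment x u \<inter> segment x v = {x} \<and>
        segment x u \<inter> segment x w = {x} \<and>
        segment x v \<inter> segment x w = {x}}"

definition leaves :: "'a::topological_space set \<Rightarrow> 'a set" where
  "leaves A = {x \<in> A. \<forall>u v. segment u v \<subseteq> A \<and> x \<in> segment u v \<longrightarrow> x = u \<or> x = v}"

text \<open>
  Convention at the root: as usual for rooted trees, the root is treated as if one further
  edge were attached to it from below. So the root is never a leaf, and it is a branch point
  as soon as two non-trivial segments meet only there. Points other than the root are not
  affected. Without this convention the sampled hierarchy does not determine the special
  points. The interval [0,1] rooted at 0 with a unit mass at 1 and the one-point tree give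
  the same hierarchy, so 0 must not be special in the former. A tripod rooted at one end
  with mass 1/2 at each of the other two ends and an interval rooted at its midpoint with
  mass 1/2 at each end give the same hierarchy, so the degree-two root of the latter must be
  special, to correspond to the centre of the former.
\<close>

definition rooted_branch_points :: "'a::topological_space \<Rightarrow> 'a set \<Rightarrow> 'a set" where
  "rooted_branch_points r A =
     branch_points A \<union>
     {x. x = r \<and> (\<exists>u v. u \<noteq> r \<and> v \<noteq> r \<and> segment r u \<subseteq> A \<and> segment r v \<subseteq> A \<and>
            segment r u \<inter> segment r v = {r})}"

definition rooted_leaves :: "'a::topological_space \<Rightarrow> 'a set \<Rightarrow> 'a set" where
  "rooted_leaves r A = leaves A - {r}"

definition closed_support :: "'a::topological_space measure \<Rightarrow> 'a set" where
  "closed_support p = {x. \<forall>U. open U \<and> x \<in> U \<longrightarrow> measure p U > 0}"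

definition Span :: "'a::topological_space \<Rightarrow> 'a measure \<Rightarrow> 'a set" where
  "Span r p = (\<Union>x\<in>closed_support p. segment r x)"

definition isolated_leaves :: "'a::topological_space \<Rightarrow> 'a set \<Rightarrow> 'a set" where
  "isolated_leaves r A = {x \<in> rooted_leaves r A. \<not> x islimpt rooted_branch_points r A}"

definition special_points :: "'a::topological_space \<Rightarrow> 'a measure \<Rightarrow> 'a set" where
  "special_points r p =
     {x. measure p {x} > 0} \<union> rooted_branch_points r (Span r p) \<union> isolated_leaves r (Span r p)"

definition mass_structural_isomorphism ::
  "'a::topological_space \<Rightarrow> 'a measure \<Rightarrow> 'b::topological_space \<Rightarrow> 'b measure \<Rightarrow> ('a \<Rightarrow> 'b) \<Rightarrow> bool"
  where
  "mass_structural_isomorphism r1 p1 r2 p2 \<phi> \<longleftrightarrow>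
     bij_betw \<phi> (special_points r1 p1) (special_points r2 p2) \<and>
     (\<forall>x\<in>special_points r1 p1.
        measure p1 (segment r1 x) = measure p2 (segment r2 (\<phi> x)) \<and>
        measure p1 {x} = measure p2 {\<phi> x} \<and>
        measure p1 (fringe r1 x) = measure p2 (fringe r2 (\<phi> x))) \<and>
     (\<forall>x\<in>special_points r1 p1. \<forall>y\<in>special_points r1 p1.
        x \<in> segment r1 y \<longleftrightarrow> \<phi> x \<in> segment r2 (\<phi> y))"

definition mass_structurally_equivalent ::
  "'a::topological_space \<Rightarrow> 'a measure \<Rightarrow> 'b::topological_space \<Rightarrow> 'b measure \<Rightarrow> bool" where
  "mass_structurally_equivalent r1 p1 r2 p2 \<longleftrightarrow>
     (\<exists>\<phi>. mass_structural_isomorphism r1 p1 r2 p2 \<phi>)"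

definition hierarchy :: "'i set \<Rightarrow> 'i set set \<Rightarrow> bool" where
  "hierarchy S H \<longleftrightarrow>
     finite S \<and> H \<subseteq> Pow S \<and>
     (\<forall>A\<in>H. \<forall>B\<in>H. A \<inter> B = A \<or> A \<inter> B = B \<or> A \<inter> B = {}) \<and>
     S \<in> H \<and> {} \<in> H \<and> (\<forall>s\<in>S. {s} \<in> H)"

text \<open>
  Sequences indexed by the positive integers are extensional functions on \<open>{1..}\<close>. The
  space of hierarchies on the positive integers carries the product sigma-algebra of the
  finite discrete spaces of hierarchies on \<open>{1..n}\<close>.
\<close>

definition nat_hierarchies :: "(nat \<Rightarrow> nat set set) set" where
  "nat_hierarchies =
     {H \<in> (\<Pi>\<^sub>E n\<in>{1..}. {h. hierarchy {1..n} h}).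
        \<forall>n\<ge>1. H n = {A \<inter> {1..n} | A. A \<in> H (Suc n)}}"

definition nat_hierarchy_space :: "(nat \<Rightarrow> nat set set) measure" where
  "nat_hierarchy_space =
     restrict_space (\<Pi>\<^sub>M n\<in>{1..}. count_space {h. hierarchy {1..n} h}) nat_hierarchies"

definition sampled_hierarchy ::
  "'a::topological_space \<Rightarrow> (nat \<Rightarrow> 'a) \<Rightarrow> nat \<Rightarrow> nat set set" where
  "sampled_hierarchy r X n =
     {{i \<in> {1..n}. X i \<in> fringe r x} | x. True} \<union> {{i} | i. i \<in> {1..n}} \<union> {{}}"

definition Theta :: "'a::topological_space \<Rightarrow> 'a measure \<Rightarrow> (nat \<Rightarrow> nat set set) measure" where
  "Theta r p =
     distr (\<Pi>\<^sub>M i\<in>{1..}. p) nat_hierarchy_space (\<lambda>X. \<lambda>n\<in>{1..}. sampled_hierarchy r X n)"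

end

theory Submission
  imports Defs
begin

text \<open>
  Up to the marking of singletons, the hierarchy sampled at \<open>X 1, X 2, \<dots>\<close> consists of the relations
  \<open>meet (X i) (X j) \<sqsubseteq> X k\<close> with \<open>i \<noteq> j\<close>, where \<open>\<sqsubseteq>\<close> is the ancestor order of the rooted tree. So two
  trees have the same image under \<open>Theta\<close> iff the laws of these relations agree.

  Suppose that the laws agree. By inner regularity and compactness there are generic samples \<open>X\<close> and \<open>Y\<close> of
  the two trees with literally the same relations. These relations determine the order of the
  sampled points. A special point is determined by the sets of indices of the samples above and
  below it: atoms and branch points are meets of two samples, and a non-atomic isolated leaf is the
  supremum of a chain of samples. Matching special points with equal index sets preserves the order,
  and it preserves the masses because they are limiting frequencies.

  Conversely, a mass-structural isomorphism preserves the masses of all finite intersections of the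
  sets \<open>{x. s \<sqsubseteq> x}\<close> and \<open>{x. x \<sqsubseteq> t \<and> p [[r, x]] \<le> a}\<close>, where \<open>s\<close> and \<open>t\<close> are special. Almost surely,
  the position of the sampled points relative to these sets determines the relations above.
\<close>

section \<open>The ancestor order of a rooted real tree\<close>

text \<open>The metric is not determined by the sampled hierarchy, and the two samples live on
  unrelated spaces. Equal laws are therefore turned into one pair of concrete sequences with the
  same relations; from there on the argument is combinatorial, and frequencies along the pair return
  the masses. The pairs have i \<noteq> j because every singleton is put into the hierarchy by
  definition: whether \<open>X k\<close> \<sqsubseteq> \<open>X i\<close> is visible only through
  meets of \<open>X k\<close> with further samples. In the converse direction, special points do not
  separate samples on a piece of segment that carries diffuse mass and no special point. There
  \<open>p [[r, x]]\<close> serves as a coordinate. It may be constant on pieces of a segment;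
  \<open>good\<close> excludes the null set of points where this would hide the order. Special
  points are countable and thresholds are taken rational, so the sets involved form a countable
  family. Most of the topology enters through the order and the Gromov product, which is the height
  of a meet and is continuous.\<close>

locale rooted_tree =
  fixes r :: "'a::polish_space"
  assumes real_tree: "real_tree TYPE('a)"
begin

abbreviation le :: "'a \<Rightarrow> 'a \<Rightarrow> bool" (infix "\<sqsubseteq>" 50) where
  "x \<sqsubseteq> y \<equiv> x \<in> segment r y"

abbreviation lt :: "'a \<Rightarrow> 'a \<Rightarrow> bool" (infix "\<sqsubset>" 50) where
  "x \<sqsubset> y \<equiv> x \<sqsubseteq> y \<and> x \<noteq> y"

text \<open>The Gromov product based at the root. It is the height of the meet
  (\<open>gp_eq\<close>), and as a combination of distances it is continuous and measurable at
  once.\<close>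

definition gp :: "'a \<Rightarrow> 'a \<Rightarrow> real" where
  "gp x y = (dist r x + dist r y - dist x y) / 2"

lemma is_segment_segment: "is_segment (x::'a) y (segment x y)"
  using real_tree unfolding real_tree_def segment_def by (metis (mono_tags) theI')

lemma segment_unique: "is_segment (x::'a) y S \<Longrightarrow> segment x y = S"
  using real_tree is_segment_segment[of x y] unfolding real_tree_def by blast

text \<open>Rescaling the parameter to [0,1] turns an isometric curve into an \<open>arc\<close>.
  Together with uniqueness this identifies the image of any isometric curve built by hand with the
  segment between its ends.\<close>

lemma is_segment_isometry:
  fixes f :: "real \<Rightarrow> 'a"
  assumes "a \<le> b" "\<And>s t. s \<in> {a..b} \<Longrightarrow> t \<in> {a..b} \<Longrightarrow> dist (f s) (f t) = dist s t"
  shows "is_segment (f a) (f b) (f ` {a..b})"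
proof (cases "a = b")
  case True
  then show ?thesis by (auto simp: is_segment_def)
next
  case False
  define g where "g = f \<circ> (\<lambda>t. a + (b - a) * t)"
  have im: "(\<lambda>t. a + (b - a) * t) ` {0..1} = {a..b}"
    using False assms(1) image_affinity_atLeastAtMost[of "b - a" a 0 1]
    by (simp add: add.commute)
  have inj: "inj_on f {a..b}"
    using assms(2) by (intro inj_onI) (metis dist_eq_0_iff)
  have cont: "continuous_on {a..b} f"
    by (rule lipschitz_on_continuous_on[of 1]) (auto simp: lipschitz_on_def assms(2))
  have "continuous_on {0..1} g"
    unfolding g_def
    by (intro continuous_on_compose) (auto intro!: continuous_intros simp: im cont)
  moreover have "inj_on (\<lambda>t. a + (b - a) * t) {0..1}"
    using False by (auto simp: inj_on_def)
  then have "inj_on g {0..1}"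
    unfolding g_def using inj im by (auto intro: comp_inj_on)
  ultimately have "arc g"
    by (simp add: arc_def path_def)
  moreover have "path_image g = f ` {a..b}"
    by (simp add: path_image_def g_def image_comp [symmetric] im del: o_apply)
  ultimately show ?thesis
    by (auto simp: is_segment_def g_def pathstart_def pathfinish_def intro!: exI[of _ g])
qed

text \<open>The isometry supplied by \<open>real_tree\<close> parametrises the segment as a set,
  with no information on where x and y sit in the interval. The piece between their parameters is
  itself a segment from x to y, hence by uniqueness all of it.\<close>

lemma geodesic:
  fixes x y :: 'a
  obtains f :: "real \<Rightarrow> 'a" where "f 0 = x" "f (dist x y) = y"
    "\<And>s t. s \<in> {0..dist x y} \<Longrightarrow> t \<in> {0..dist x y} \<Longrightarrow> dist (f s) (f t) = \<bar>s - t\<bar>"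
    "segment x y = f ` {0..dist x y}"
proof -
  have seg: "is_segment x y (segment x y)" by (rule is_segment_segment)
  then have xy: "x \<in> segment x y" "y \<in> segment x y"
    by (auto simp: is_segment_def)
  obtain a b and f :: "real \<Rightarrow> 'a" where f: "a \<le> b" "f ` {a..b} = segment x y"
    "\<And>s t. s \<in> {a..b} \<Longrightarrow> t \<in> {a..b} \<Longrightarrow> dist (f s) (f t) = dist s t"
    using real_tree seg unfolding real_tree_def isometric_to_interval_def by metis
  obtain s t where st: "s \<in> {a..b}" "t \<in> {a..b}" "x = f s" "y = f t"
    using xy f(2) by (metis imageE)
  have D: "dist x y = \<bar>s - t\<bar>" using st f(3) by (simp add: dist_real_def)
  \<comment> \<open>Runs from the parameter s of x towards the parameter t of y, backwards if
    \<open>t < s\<close>.\<close>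
  define F where "F = (\<lambda>u. if s \<le> t then f (s + u) else f (s - u))"
  have iso: "dist (F u) (F v) = dist u v" if "u \<in> {0..dist x y}" "v \<in> {0..dist x y}" for u v
    using that st f(3) unfolding F_def D by (auto simp: dist_real_def)
  have ends: "F 0 = x" "F (dist x y) = y"
    using st D by (auto simp: F_def abs_if)
  have "is_segment x y (F ` {0..dist x y})"
    using is_segment_isometry[of 0 "dist x y" F] iso ends by simp
  then show thesis
    using that[of F] ends iso segment_unique by (simp add: dist_real_def)
qed

text \<open>Membership becomes the equality case of the triangle inequality, so the order can be
  handled by linear arithmetic on distances. The hard direction glues geodesics from x to z and from
  z to y: equality makes the glued curve isometric, and uniqueness identifies its image with the
  segment.\<close>

lemma segment_iff: "z \<in> segment x y \<longleftrightarrow> dist x z + dist z y = dist x (y::'a)"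
proof
  assume z: "z \<in> segment x y"
  obtain f where f: "f 0 = x" "f (dist x y) = y"
    "\<And>s t. s \<in> {0..dist x y} \<Longrightarrow> t \<in> {0..dist x y} \<Longrightarrow> dist (f s) (f t) = \<bar>s - t\<bar>"
    "segment x y = f ` {0..dist x y}" by (rule geodesic[of x y]) blast
  then obtain s where s: "s \<in> {0..dist x y}" "z = f s" using z by auto
  then show "dist x z + dist z y = dist x y"
    using f(3)[of 0 s] f(3)[of s "dist x y"] f(1,2) by auto
next
  assume eq: "dist x z + dist z y = dist x y"
  obtain f where f: "f 0 = x" "f (dist x z) = z"
    "\<And>s t. s \<in> {0..dist x z} \<Longrightarrow> t \<in> {0..dist x z} \<Longrightarrow> dist (f s) (f t) = \<bar>s - t\<bar>"
    by (rule geodesic[of x z]) blast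
  obtain g where g: "g 0 = z" "g (dist z y) = y"
    "\<And>s t. s \<in> {0..dist z y} \<Longrightarrow> t \<in> {0..dist z y} \<Longrightarrow> dist (g s) (g t) = \<bar>s - t\<bar>"
    by (rule geodesic[of z y]) blast
  define h where "h = (\<lambda>u. if u \<le> dist x z then f u else g (u - dist x z))"
  \<comment> \<open>The triangle inequality bounds this distance from above through z and from below
    through x and y; \<open>eq\<close> makes the bounds agree.\<close>
  have cross: "dist (f s) (g u) = dist x z + u - s"
    if "s \<in> {0..dist x z}" "u \<in> {0..dist z y}" for s u
  proof -
    have "dist x (f s) = s" "dist (f s) z = dist x z - s"
      using f(3)[of 0 s] f(3)[of s "dist x z"] f(1,2) that by auto
    moreover have "dist z (g u) = u" "dist (g u) y = dist z y - u"
      using g(3)[of 0 u] g(3)[of u "dist z y"] g(1,2) that by auto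
    ultimately show ?thesis
      using dist_triangle[of "f s" "g u" z] dist_triangle[of x y "f s"]
        dist_triangle[of "f s" y "g u"] eq by linarith
  qed
  have "dist (h s) (h t) = dist s t" if "s \<in> {0..dist x y}" "t \<in> {0..dist x y}" for s t
  proof -
    have *: "dist (h s) (h t) = t - s" if "s \<le> t" "0 \<le> s" "t \<le> dist x y" for s t
      using that f(3)[of s t] g(3)[of "s - dist x z" "t - dist x z"] cross[of s "t - dist x z"] eq
      by (auto simp: h_def)
    show ?thesis
      using *[of s t] *[of t s] that by (cases "s \<le> t") (auto simp: dist_real_def dist_commute)
  qed
  then have "is_segment (h 0) (h (dist x y)) (h ` {0..dist x y})"
    by (intro is_segment_isometry) auto
  moreover have "h 0 = x" using f by (simp add: h_def)
  moreover have "h (dist x y) = y"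
  proof (cases "z = y")
    case True
    then show ?thesis using f by (simp add: h_def)
  next
    case False
    then have "0 < dist z y" by simp
    then have "\<not> dist x y \<le> dist x z" "dist x y - dist x z = dist z y" using eq by linarith+
    then show ?thesis using g by (simp add: h_def)
  qed
  moreover have "h (dist x z) = z" using f by (simp add: h_def)
  ultimately show "z \<in> segment x y"
    using segment_unique[of x y "h ` {0..dist x y}"] eq
    by (metis atLeastAtMost_iff image_eqI le_add_same_cancel1 zero_le_dist)
qed

lemma segment_commute: "segment x y = segment y (x::'a)"
  by (auto simp: segment_iff dist_commute add.commute)

lemma le_iff: "x \<sqsubseteq> y \<longleftrightarrow> dist r x + dist x y = dist r y"
  by (rule segment_iff)

lemma le_refl [simp]: "x \<sqsubseteq> x" and root_le [simp]: "r \<sqsubseteq> x"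
  by (auto simp: le_iff)

lemma le_root_iff [simp]: "x \<sqsubseteq> r \<longleftrightarrow> x = r"
  by (auto simp: le_iff dist_commute)

lemma le_trans: "x \<sqsubseteq> y \<Longrightarrow> y \<sqsubseteq> z \<Longrightarrow> x \<sqsubseteq> z"
  using dist_triangle[of r z x] dist_triangle[of x z y] unfolding le_iff by linarith

lemma le_antisym: "x \<sqsubseteq> y \<Longrightarrow> y \<sqsubseteq> x \<Longrightarrow> x = y"
  using zero_less_dist_iff[of x y] unfolding le_iff dist_commute[of y x] by linarith

lemma le_height: "x \<sqsubseteq> y \<Longrightarrow> dist r x \<le> dist r y"
  using zero_le_dist[of x y] unfolding le_iff by linarith

lemma lt_height: "x \<sqsubset> y \<Longrightarrow> dist r x < dist r y"
  using zero_less_dist_iff[of x y] unfolding le_iff by linarith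

text \<open>All points below z lie on one geodesic from the root, parametrised by the height
  \<open>dist r\<close>.\<close>

lemma le_of_height: "x \<sqsubseteq> z \<Longrightarrow> y \<sqsubseteq> z \<Longrightarrow> dist r x \<le> dist r y \<Longrightarrow> x \<sqsubseteq> y"
proof -
  assume x: "x \<sqsubseteq> z" and y: "y \<sqsubseteq> z" and h: "dist r x \<le> dist r y"
  obtain f where f: "f 0 = r" "f (dist r z) = z"
    "\<And>s t. s \<in> {0..dist r z} \<Longrightarrow> t \<in> {0..dist r z} \<Longrightarrow> dist (f s) (f t) = \<bar>s - t\<bar>"
    "segment r z = f ` {0..dist r z}" by (rule geodesic[of r z]) blast
  obtain s t where "s \<in> {0..dist r z}" "t \<in> {0..dist r z}" "x = f s" "y = f t"
    using x y f(4) by auto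
  then show "x \<sqsubseteq> y"
    using f(3)[of 0 s] f(3)[of 0 t] f(3)[of s t] f(1) h by (auto simp: le_iff)
qed

lemma le_of_height_less: "x \<sqsubseteq> z \<Longrightarrow> y \<sqsubseteq> z \<Longrightarrow> dist r x < dist r y \<Longrightarrow> x \<sqsubset> y"
  using le_of_height[of x z y] by auto

lemma le_linear: "x \<sqsubseteq> z \<Longrightarrow> y \<sqsubseteq> z \<Longrightarrow> x \<sqsubseteq> y \<or> y \<sqsubseteq> x"
  using le_of_height by (meson linear)

lemma point_at_height:
  assumes "0 \<le> t" "t \<le> dist r x"
  obtains z where "z \<sqsubseteq> x" "dist r z = t"
proof -
  obtain f where f: "f 0 = r" "f (dist r x) = x"
    "\<And>s t. s \<in> {0..dist r x} \<Longrightarrow> t \<in> {0..dist r x} \<Longrightarrow> dist (f s) (f t) = \<bar>s - t\<bar>"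
    "segment r x = f ` {0..dist r x}" by (rule geodesic[of r x]) blast
  then show thesis using that[of "f t"] assms f(3)[of 0 t] by auto
qed

lemma segment_subset: "z \<in> segment x y \<Longrightarrow> segment x z \<subseteq> segment x (y::'a)"
proof
  fix w assume "z \<in> segment x y" "w \<in> segment x z"
  then show "w \<in> segment x y"
    using dist_triangle[of w y z] dist_triangle[of x y w] unfolding segment_iff by linarith
qed

section \<open>Meets and their heights\<close>

lemma closed_segment_tree: "closed (segment x (y::'a))"
proof -
  have "segment x y = {z. dist x z + dist z y = dist x y}" by (auto simp: segment_iff)
  then show ?thesis by (auto intro!: closed_Collect_eq continuous_intros)
qed

text \<open>m is the last point of [[r, x]] on the closed set [[r, y]]. Beyond m the two paths
  separate, so joining [[x, m]] and [[m, y]] gives an arc. Uniqueness is used here among all arcs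
  and not only among isometric ones: the arc must be the segment from x to y, and m lies on
  it.\<close>

lemma meet_exists:
  fixes x y :: 'a
  shows "\<exists>m. m \<sqsubseteq> x \<and> m \<sqsubseteq> y \<and> dist x y = dist x m + dist m y"
proof -
  obtain f where f: "f 0 = r" "f (dist r x) = x"
    "\<And>s t. s \<in> {0..dist r x} \<Longrightarrow> t \<in> {0..dist r x} \<Longrightarrow> dist (f s) (f t) = \<bar>s - t\<bar>"
    "segment r x = f ` {0..dist r x}" by (rule geodesic[of r x]) blast
  have cont: "continuous_on {0..dist r x} f"
    by (rule lipschitz_on_continuous_on[of 1]) (auto simp: lipschitz_on_def f(3) dist_real_def)
  define A where "A = {0..dist r x} \<inter> f -` segment r y"
  have "closed A"
    unfolding A_def by (intro continuous_closed_preimage cont closed_segment_tree) auto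
  then have "compact A"
    using bounded_subset[of "{0..dist r x}" A] by (auto simp: compact_eq_bounded_closed A_def)
  moreover have "0 \<in> A" using f(1) by (simp add: A_def)
  then have "A \<noteq> {}" by blast
  ultimately obtain t0 where t0: "t0 \<in> A" "\<And>t. t \<in> A \<Longrightarrow> t \<le> t0"
    by (meson compact_attains_sup)
  define m where "m = f t0"
  have hm: "dist r m = t0" using t0(1) f(3)[of 0 t0] f(1) by (auto simp: A_def m_def)
  have m: "m \<sqsubseteq> x" "m \<sqsubseteq> y" using t0(1) f(4) by (auto simp: A_def m_def)
  \<comment> \<open>A common point of both pieces lies below x and y, hence by maximality of
    \<open>t0\<close> not higher than m.\<close>
  have cap: "segment x m \<inter> segment m y \<subseteq> {m}"
  proof
    fix z assume "z \<in> segment x m \<inter> segment m y"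
    then have z: "dist x z + dist z m = dist x m" "dist m z + dist z y = dist m y"
      by (auto simp: segment_iff)
    have "z \<sqsubseteq> x" and dz: "dist r z = dist r m + dist m z"
      using z(1) m(1) dist_triangle[of r x z] dist_triangle[of r z m]
      unfolding le_iff by (simp_all add: dist_commute)
    moreover have "z \<sqsubseteq> y"
      using z(2) m(2) dist_triangle[of r y z] dist_triangle[of r z m] unfolding le_iff by linarith
    moreover obtain u where u: "u \<in> {0..dist r x}" "z = f u" using \<open>z \<sqsubseteq> x\<close> f(4) by auto
    moreover have "dist r z = u" using u f(3)[of 0 u] f(1) by auto
    ultimately have "dist r z \<le> t0" by (intro t0(2)) (auto simp: A_def)
    then show "z \<in> {m}" using dz hm by (simp add: order_antisym)
  qed
  have "m \<in> segment x y"
  proof (cases "x = m \<or> m = y")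
    case True
    then show ?thesis by (auto simp: segment_iff)
  next
    case False
    obtain g1 where g1: "arc g1" "pathstart g1 = x" "pathfinish g1 = m" "path_image g1 = segment x m"
      using is_segment_segment[of x m] False unfolding is_segment_def by auto
    obtain g2 where g2: "arc g2" "pathstart g2 = m" "pathfinish g2 = y" "path_image g2 = segment m y"
      using is_segment_segment[of m y] False unfolding is_segment_def by auto
    have "arc (g1 +++ g2)"
      using g1 g2 cap by (intro arc_join) auto
    then have "is_segment x y (path_image (g1 +++ g2))"
      unfolding is_segment_def using g1 g2 by (metis pathstart_join pathfinish_join)
    moreover have "m \<in> path_image (g1 +++ g2)"
      using g1 g2 by (metis path_image_join pathfinish_in_path_image UnI1)
    ultimately show ?thesis using segment_unique by blast
  qed
  then show ?thesis using m by (auto simp: segment_iff)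
qed

definition meet :: "'a \<Rightarrow> 'a \<Rightarrow> 'a" where
  "meet x y = (SOME m. m \<sqsubseteq> x \<and> m \<sqsubseteq> y \<and> dist x y = dist x m + dist m y)"

lemma meet_le1 [simp]: "meet x y \<sqsubseteq> x" and meet_le2 [simp]: "meet x y \<sqsubseteq> y"
  and dist_meet: "dist x y = dist x (meet x y) + dist (meet x y) y"
  using someI_ex[OF meet_exists[of x y]] unfolding meet_def by auto

lemma gp_eq: "gp x y = dist r (meet x y)"
  using dist_meet[of x y] meet_le1[of x y] meet_le2[of x y]
  unfolding le_iff gp_def by (simp add: dist_commute)

lemma meet_greatest: assumes "z \<sqsubseteq> x" "z \<sqsubseteq> y" shows "z \<sqsubseteq> meet x y"
proof (rule ccontr)
  assume "\<not> z \<sqsubseteq> meet x y"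
  then have "dist r (meet x y) < dist r z"
    using le_of_height[OF assms(1) meet_le1[of x y]] by (meson not_le)
  then show False
    using assms dist_triangle[of x y z] gp_eq[of x y] unfolding le_iff gp_def
    by (simp add: dist_commute)
qed

lemma le_meet_iff [simp]: "z \<sqsubseteq> meet x y \<longleftrightarrow> z \<sqsubseteq> x \<and> z \<sqsubseteq> y"
  using meet_greatest le_trans meet_le1 meet_le2 by blast

lemma meet_eqI: "z \<sqsubseteq> x \<Longrightarrow> z \<sqsubseteq> y \<Longrightarrow> (\<And>w. w \<sqsubseteq> x \<Longrightarrow> w \<sqsubseteq> y \<Longrightarrow> w \<sqsubseteq> z) \<Longrightarrow> meet x y = z"
  by (rule le_antisym) auto

lemma meet_absorb1: "x \<sqsubseteq> y \<Longrightarrow> meet x y = x" and meet_absorb2: "y \<sqsubseteq> x \<Longrightarrow> meet x y = y"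
  by (auto intro!: meet_eqI)

text \<open>Both \<open>meet x y\<close> and \<open>meet x z\<close> lie below x, so their order is
  that of their heights. This turns the relations observed in a sample into inequalities between
  continuous functions.\<close>

lemma meet_le_iff_gp: "meet x y \<sqsubseteq> z \<longleftrightarrow> gp x y \<le> gp x z"
proof
  assume "meet x y \<sqsubseteq> z"
  then show "gp x y \<le> gp x z" by (auto simp: gp_eq intro: le_height)
next
  assume "gp x y \<le> gp x z"
  then have "meet x y \<sqsubseteq> meet x z" by (intro le_of_height[OF meet_le1 meet_le1]) (auto simp: gp_eq)
  then show "meet x y \<sqsubseteq> z" by simp
qed

lemma gp_eq_height: "x \<sqsubseteq> y \<Longrightarrow> gp x y = dist r x"
  by (simp add: gp_eq meet_absorb1)

lemma less_gpD: "z \<sqsubseteq> x \<Longrightarrow> dist r z < gp x y \<Longrightarrow> z \<sqsubset> meet x y"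
  using le_of_height_less[OF _ meet_le1[of x y], of z] by (simp add: gp_eq)

lemma continuous_gp [continuous_intros]:
  "continuous_on A f \<Longrightarrow> continuous_on A g \<Longrightarrow> continuous_on A (\<lambda>x. gp (f x) (g x))"
  unfolding gp_def by (intro continuous_intros) auto

lemma open_gp: "open {y. c < gp x y}"
  by (intro open_Collect_less continuous_intros)

lemma closed_fringe: "closed (fringe r x)"
proof -
  have "fringe r x = {y. dist r x + dist x y = dist r y}" by (auto simp: fringe_def le_iff)
  then show ?thesis by (auto intro!: closed_Collect_eq continuous_intros)
qed

text \<open>Completeness and boundedness of the tree enter here.\<close>

lemma chain_sup:
  assumes "C \<noteq> {}" and chain: "\<And>x y. x \<in> C \<Longrightarrow> y \<in> C \<Longrightarrow> x \<sqsubseteq> y \<or> y \<sqsubseteq> x"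
  obtains y where "\<And>c. c \<in> C \<Longrightarrow> c \<sqsubseteq> y" "y \<in> closure C"
    "\<And>z. z \<sqsubset> y \<Longrightarrow> \<exists>c\<in>C. z \<sqsubset> c"
proof -
  define \<eta> where "\<eta> = (SUP c\<in>C. dist r c)"
  obtain B where B: "\<And>x. dist r x \<le> B"
    using real_tree bounded_any_center[of UNIV r] unfolding real_tree_def by auto
  have bdd: "bdd_above (dist r ` C)" using B by (auto intro!: bdd_aboveI)
  have up: "dist r c \<le> \<eta>" if "c \<in> C" for c
    unfolding \<eta>_def using that bdd by (rule cSUP_upper)
  have "\<exists>c\<in>C. \<eta> - inverse (real (Suc n)) < dist r c" for n
    using less_cSUP_iff[OF assms(1) bdd, of "\<eta> - inverse (real (Suc n))"] by (simp add: \<eta>_def)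
  then obtain u where u: "\<And>n. u n \<in> C" "\<And>n. \<eta> - inverse (real (Suc n)) < dist r (u n)"
    by metis
  \<comment> \<open>On a chain the distance is the difference of heights, so points whose heights
    converge to the supremum form a Cauchy sequence.\<close>
  have dC: "dist c d = \<bar>dist r c - dist r d\<bar>" if "c \<in> C" "d \<in> C" for c d
    using chain[OF that] zero_le_dist[of c d] unfolding le_iff dist_commute[of d c] by linarith
  have du: "dist (u n) c < inverse (real (Suc n))"
    if "c \<in> C" "dist r (u n) \<le> dist r c" for n c
    using dC[OF u(1) that(1), of n] u(2)[of n] up[OF that(1)] that(2) by linarith
  have "Cauchy u"
  proof (rule metric_CauchyI)
    fix e :: real assume "0 < e"
    then obtain M where M: "inverse (real (Suc M)) < e" using reals_Archimedean by blast
    have "dist (u m) (u n) < e" if "m \<ge> M" "n \<ge> M" for m n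
    proof -
      have "inverse (real (Suc m)) \<le> inverse (real (Suc M))" "inverse (real (Suc n)) \<le> inverse (real (Suc M))"
        using that by (auto intro!: le_imp_inverse_le)
      then show ?thesis
        using du[OF u(1)[of n], of m] du[OF u(1)[of m], of n] M dist_commute[of "u m" "u n"]
        by linarith
    qed
    then show "\<exists>M. \<forall>m\<ge>M. \<forall>n\<ge>M. dist (u m) (u n) < e" by blast
  qed
  then obtain y where y: "u \<longlonglongrightarrow> y" by (auto simp: Cauchy_convergent_iff convergent_def)
  have "(\<lambda>n. dist r (u n)) \<longlonglongrightarrow> \<eta>"
  proof (rule tendsto_sandwich)
    show "(\<lambda>n. \<eta> - inverse (real (Suc n))) \<longlonglongrightarrow> \<eta>"
      using tendsto_diff[OF tendsto_const LIMSEQ_inverse_real_of_nat, of \<eta>] by simp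
    show "\<forall>\<^sub>F n in sequentially. \<eta> - inverse (real (Suc n)) \<le> dist r (u n)"
      by (intro always_eventually allI less_imp_le u(2))
    show "\<forall>\<^sub>F n in sequentially. dist r (u n) \<le> \<eta>"
      by (intro always_eventually allI up u(1))
  qed simp
  moreover have "(\<lambda>n. dist r (u n)) \<longlonglongrightarrow> dist r y" using y by (intro tendsto_intros)
  ultimately have hy: "dist r y = \<eta>" using LIMSEQ_unique by blast
  have upper: "c \<sqsubseteq> y" if c: "c \<in> C" for c
  proof -
    have "(\<lambda>n. dist c (u n)) \<longlonglongrightarrow> dist c y" using y by (intro tendsto_intros)
    moreover have "(\<lambda>n. dist c (u n)) \<longlonglongrightarrow> \<bar>dist r c - dist r y\<bar>"
      unfolding dC[OF c u(1)] using y by (intro tendsto_intros)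
    ultimately have "dist c y = \<bar>dist r c - dist r y\<bar>" using LIMSEQ_unique by blast
    then show ?thesis using up[OF c] hy by (auto simp: le_iff)
  qed
  show thesis
  proof (rule that)
    show "y \<in> closure C" using y u(1) by (auto simp: closure_sequential)
    fix z assume z: "z \<sqsubset> y"
    then have "dist r z < \<eta>" using lt_height hy by metis
    then obtain c where "c \<in> C" "dist r z < dist r c"
      using less_cSUP_iff[OF assms(1) bdd, of "dist r z"] by (auto simp: \<eta>_def)
    then show "\<exists>c\<in>C. z \<sqsubset> c" using le_of_height_less[of z y c] z upper by blast
  qed (use upper in auto)
qed

end

section \<open>Special points\<close>

locale weighted_tree = rooted_tree r for r :: "'a::polish_space" +
  fixes p :: "'a measure"
  assumes prob: "prob_space p" and sets_p: "sets p = sets borel"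
begin

sublocale prob_space p by (rule prob)

abbreviation supp where "supp \<equiv> closed_support p"
abbreviation Sp where "Sp \<equiv> Span r p"
abbreviation S where "S \<equiv> special_points r p"

lemma space_p [simp]: "space p = UNIV"
  using sets_eq_imp_space_eq[OF sets_p] by simp

lemma segment_in_sets [measurable, simp]: "segment x (y::'a) \<in> sets p"
  using closed_segment_tree by (simp add: sets_p)

lemma fringe_in_sets [measurable, simp]: "fringe r x \<in> sets p"
  using closed_fringe by (simp add: sets_p)

lemma singleton_in_sets [measurable, simp]: "{x} \<in> sets p"
  by (simp add: sets_p)

section \<open>Support and span\<close>

lemma mem_Span_iff: "x \<in> Sp \<longleftrightarrow> (\<exists>s\<in>supp. x \<sqsubseteq> s)"
  by (auto simp: Span_def)

lemma supp_subset_Span: "supp \<subseteq> Sp"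
  unfolding subset_iff mem_Span_iff by (metis le_refl)

lemma Span_down: "y \<in> Sp \<Longrightarrow> x \<sqsubseteq> y \<Longrightarrow> x \<in> Sp"
  unfolding mem_Span_iff using le_trans by blast

lemma supp_compl: "- supp = \<Union>{U. open U \<and> measure p U = 0}"
proof -
  have "measure p U = 0" if "\<not> measure p U > 0" for U
    using that by (simp add: zero_less_measure_iff)
  then show ?thesis by (auto simp: closed_support_def)
qed

lemma closed_supp: "closed supp"
  unfolding closed_def supp_compl by blast

text \<open>The complement of the support is a union of null open sets, and by Lindelof's theorem
  countably many of them cover it.\<close>

lemma AE_supp: "AE x in p. x \<in> supp"
proof -
  obtain \<U> where \<U>: "\<U> \<subseteq> {U. open U \<and> measure p U = 0}" "countable \<U>" "\<Union>\<U> = - supp"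
    using Lindelof[of "{U. open U \<and> measure p U = 0}"] supp_compl by (metis (mono_tags, lifting) mem_Collect_eq)
  have "AE x in p. \<forall>U\<in>\<U>. x \<notin> U"
  proof (subst AE_ball_countable[OF \<U>(2)], intro ballI)
    fix U assume "U \<in> \<U>"
    then have "U \<in> null_sets p" using \<U>(1) by (auto intro!: null_setsI simp: sets_p emeasure_eq_measure)
    then show "AE x in p. x \<notin> U" by (rule AE_not_in)
  qed
  then show ?thesis
    by eventually_elim (use \<U>(3) in blast)
qed

lemma open_supp_pos: "open U \<Longrightarrow> x \<in> U \<Longrightarrow> x \<in> supp \<Longrightarrow> measure p U > 0"
  by (auto simp: closed_support_def)

lemma supp_above:
  assumes "x \<in> Sp" "c < dist r x"
  obtains s where "s \<in> supp" "x \<sqsubseteq> s" "c < gp x s"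
  using assms by (auto simp: mem_Span_iff gp_eq_height)

lemma atom_in_Span: "measure p {x} > 0 \<Longrightarrow> x \<in> Sp"
proof -
  assume pos: "measure p {x} > 0"
  have "measure p {x} \<le> measure p U" if "open U" "x \<in> U" for U
    using that by (intro finite_measure_mono) (auto simp: sets_p)
  then have "x \<in> supp" using pos by (auto simp: closed_support_def intro: less_le_trans)
  then show ?thesis using supp_subset_Span by blast
qed

section \<open>Branch points and isolated leaves in terms of the order\<close>

lemma segment_subset_Span: assumes "x \<sqsubseteq> u" "u \<in> Sp" shows "segment x u \<subseteq> Sp"
proof
  fix z assume "z \<in> segment x u"
  then have "z \<in> segment u x" by (simp add: segment_commute)
  moreover have "x \<in> segment u r" using assms by (simp add: segment_commute)
  ultimately have "z \<sqsubseteq> u" using segment_subset[of x u r] segment_commute[of u r] by blast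
  then show "z \<in> Sp" using Span_down assms(2) by blast
qed

lemma between_iff: assumes "x \<sqsubseteq> u" shows "z \<in> segment x u \<longleftrightarrow> x \<sqsubseteq> z \<and> z \<sqsubseteq> u"
proof
  assume z: "z \<in> segment x u"
  then show "x \<sqsubseteq> z \<and> z \<sqsubseteq> u"
    using assms dist_triangle[of r u z] dist_triangle[of r z x] unfolding segment_iff by linarith
next
  assume "x \<sqsubseteq> z \<and> z \<sqsubseteq> u"
  then show "z \<in> segment x u" using assms unfolding segment_iff by linarith
qed

lemma meet_in_segment: "meet x y \<in> segment x (y::'a)"
  using dist_meet[of x y] by (simp add: segment_iff)

lemma meet_segments:
  assumes "x \<sqsubseteq> u" "x \<sqsubseteq> v"
  shows "segment x u \<inter> segment x v = {x} \<longleftrightarrow> meet u v = x"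
proof
  assume "segment x u \<inter> segment x v = {x}"
  moreover have "meet u v \<in> segment x u \<inter> segment x v"
    using assms between_iff[OF assms(1)] between_iff[OF assms(2)] by simp
  ultimately show "meet u v = x" by blast
next
  assume m: "meet u v = x"
  have "z = x" if "z \<in> segment x u" "z \<in> segment x v" for z
  proof -
    have "z \<sqsubseteq> meet u v" "x \<sqsubseteq> z" using that between_iff[OF assms(1)] between_iff[OF assms(2)] by simp_all
    then show ?thesis using m le_antisym by simp
  qed
  then show "segment x u \<inter> segment x v = {x}"
    using assms between_iff[OF assms(1)] between_iff[OF assms(2)] by auto
qed

text \<open>The convention at the root makes one description fit all points: away from the root the
  third segment is the one towards the root, and of three segments that meet only in x at most one
  descends, so two of them ascend.\<close>

lemma branch_iff:
  "x \<in> rooted_branch_points r Sp \<longleftrightarrow> (\<exists>u\<in>Sp. \<exists>v\<in>Sp. x \<sqsubset> u \<and> x \<sqsubset> v \<and> meet u v = x)"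
proof
  assume "\<exists>u\<in>Sp. \<exists>v\<in>Sp. x \<sqsubset> u \<and> x \<sqsubset> v \<and> meet u v = x"
  then obtain u v where uv: "u \<in> Sp" "v \<in> Sp" "x \<sqsubset> u" "x \<sqsubset> v" "meet u v = x" by blast
  then have sub: "segment x u \<subseteq> Sp" "segment x v \<subseteq> Sp" "segment x u \<inter> segment x v = {x}"
    using segment_subset_Span meet_segments by auto
  show "x \<in> rooted_branch_points r Sp"
  proof (cases "x = r")
    case True
    have "u \<noteq> x" "v \<noteq> x" using uv by auto
    then have "\<exists>u v. u \<noteq> r \<and> v \<noteq> r \<and> segment r u \<subseteq> Sp \<and> segment r v \<subseteq> Sp \<and>
        segment r u \<inter> segment r v = {r}"
      using sub unfolding True by blast
    then show ?thesis unfolding rooted_branch_points_def using True by simp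
  next
    case False
    have xr: "segment x r \<subseteq> Sp"
      using Span_down[OF uv(1)] Span_down[of x] uv(3) segment_commute[of x r] by blast
    have "segment x w \<inter> segment x r = {x}" if "x \<sqsubset> w" for w
      using that le_antisym segment_commute[of x r] between_iff[of x w] by auto
    then have "segment x u \<inter> segment x r = {x}" "segment x v \<inter> segment x r = {x}"
      using uv by blast+
    moreover have "u \<noteq> x" "v \<noteq> x" "r \<noteq> x" using uv False by auto
    ultimately have "x \<in> branch_points Sp"
      unfolding branch_points_def using sub xr by blast
    then show ?thesis by (simp add: rooted_branch_points_def)
  qed
next
  have key: "\<exists>u\<in>Sp. \<exists>v\<in>Sp. x \<sqsubset> u \<and> x \<sqsubset> v \<and> meet u v = x"
    if "x \<sqsubseteq> u" "x \<sqsubseteq> v" "u \<noteq> x" "v \<noteq> x" "segment x u \<subseteq> Sp" "segment x v \<subseteq> Sp"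
      "segment x u \<inter> segment x v = {x}" for u v
  proof -
    have "u \<in> segment x u" "v \<in> segment x v" by (auto simp: segment_iff)
    then have "u \<in> Sp" "v \<in> Sp" using that by auto
    moreover have "meet u v = x" using meet_segments[of x u v] that by simp
    ultimately show ?thesis using that by metis
  qed
  \<comment> \<open>Two segments that both start downwards share a piece: the meets of x with u and
    with v are strictly below x and comparable, and the higher one lies on both segments.\<close>
  have down: "\<not> (segment x u \<inter> segment x v = {x})" if "\<not> x \<sqsubseteq> u" "\<not> x \<sqsubseteq> v" for u v
  proof -
    have *: "meet x u \<noteq> x \<and> (\<forall>z. meet x u \<sqsubseteq> z \<longrightarrow> z \<sqsubseteq> x \<longrightarrow> z \<in> segment x u)" if "\<not> x \<sqsubseteq> u" for u
    proof (intro conjI allI impI)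
      show "meet x u \<noteq> x" using that meet_le2 by metis
      fix z assume "meet x u \<sqsubseteq> z" "z \<sqsubseteq> x"
      then have "z \<in> segment x (meet x u)"
        using between_iff[OF meet_le1[of x u]] segment_commute by blast
      then show "z \<in> segment x u" using segment_subset[OF meet_in_segment] by blast
    qed
    have "meet x u \<sqsubseteq> meet x v \<or> meet x v \<sqsubseteq> meet x u"
      by (rule le_linear[OF meet_le1 meet_le1])
    then show ?thesis
    proof
      assume "meet x u \<sqsubseteq> meet x v"
      then have "meet x v \<in> segment x u" using *[OF that(1)] meet_le1 by blast
      then show ?thesis using *[OF that(2)] meet_in_segment by blast
    next
      assume "meet x v \<sqsubseteq> meet x u"
      then have "meet x u \<in> segment x v" using *[OF that(2)] meet_le1 by blast
      then show ?thesis using *[OF that(1)] meet_in_segment by blast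
    qed
  qed
  assume "x \<in> rooted_branch_points r Sp"
  then consider "x \<in> branch_points Sp" | u v where "x = r" "u \<noteq> r" "v \<noteq> r" "segment r u \<subseteq> Sp"
     "segment r v \<subseteq> Sp" "segment r u \<inter> segment r v = {r}"
    by (auto simp: rooted_branch_points_def)
  then show "\<exists>u\<in>Sp. \<exists>v\<in>Sp. x \<sqsubset> u \<and> x \<sqsubset> v \<and> meet u v = x"
  proof cases
    case 1
    then obtain u v w where *: "u \<noteq> x" "v \<noteq> x" "w \<noteq> x"
      "segment x u \<subseteq> Sp" "segment x v \<subseteq> Sp" "segment x w \<subseteq> Sp"
      "segment x u \<inter> segment x v = {x}" "segment x u \<inter> segment x w = {x}"
      "segment x v \<inter> segment x w = {x}"
      unfolding branch_points_def by blast
    consider "x \<sqsubseteq> u \<and> x \<sqsubseteq> v" | "x \<sqsubseteq> u \<and> x \<sqsubseteq> w" | "x \<sqsubseteq> v \<and> x \<sqsubseteq> w"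
      using down * by blast
    then show ?thesis using key * by cases blast+
  next
    case 2
    then show ?thesis using key[of u v] by simp
  qed
qed

text \<open>A segment from u to v descends to the meet and ascends again, so each of its points lies
  below u or below v. Hence a leaf other than the root is the same as a maximal point of the
  span.\<close>

lemma leaf_iff:
  "x \<in> rooted_leaves r Sp \<longleftrightarrow> x \<in> Sp \<and> x \<noteq> r \<and> (\<forall>y\<in>Sp. x \<sqsubseteq> y \<longrightarrow> y = x)"
proof
  assume "x \<in> rooted_leaves r Sp"
  then have x: "x \<in> Sp" "x \<noteq> r" "\<And>u v. segment u v \<subseteq> Sp \<Longrightarrow> x \<in> segment u v \<Longrightarrow> x = u \<or> x = v"
    by (auto simp: rooted_leaves_def leaves_def)
  have "y = x" if "y \<in> Sp" "x \<sqsubseteq> y" for y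
    using x(2) x(3)[of r y] that Span_down[OF that(1)] by blast
  then show "x \<in> Sp \<and> x \<noteq> r \<and> (\<forall>y\<in>Sp. x \<sqsubseteq> y \<longrightarrow> y = x)" using x by blast
next
  assume x: "x \<in> Sp \<and> x \<noteq> r \<and> (\<forall>y\<in>Sp. x \<sqsubseteq> y \<longrightarrow> y = x)"
  have "x = u \<or> x = v" if sub: "segment u v \<subseteq> Sp" and xs: "x \<in> segment u v" for u v
  proof -
    have uv: "u \<in> Sp" "v \<in> Sp" using sub by (auto simp: segment_iff subset_iff)
    have "x \<sqsubseteq> u \<or> x \<sqsubseteq> v"
    proof (rule ccontr)
      assume n: "\<not> ?thesis"
      have "meet x u \<sqsubset> x" "meet x v \<sqsubset> x" using n meet_le2 by (metis meet_le1)+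
      then have h: "gp x u < dist r x" "gp x v < dist r x" using lt_height by (auto simp: gp_eq)
      have "meet x u \<sqsubseteq> meet x v \<or> meet x v \<sqsubseteq> meet x u"
        by (rule le_linear[of _ x]) simp_all
      \<comment> \<open>The ultrametric inequality of the Gromov product: the lower of the two meets
        lies below both u and v.\<close>
      then have "min (gp x u) (gp x v) \<le> gp u v"
      proof
        assume "meet x u \<sqsubseteq> meet x v"
        then have "meet x u \<sqsubseteq> meet u v" by simp
        then show ?thesis using le_height by (fastforce simp: gp_eq)
      next
        assume "meet x v \<sqsubseteq> meet x u"
        then have "meet x v \<sqsubseteq> meet u v" by simp
        then show ?thesis using le_height by (fastforce simp: gp_eq)
      qed
      then show False using h xs unfolding segment_iff gp_def by (simp add: dist_commute min_def split: if_splits)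
    qed
    then show ?thesis using x uv by blast
  qed
  then show "x \<in> rooted_leaves r Sp" using x by (auto simp: rooted_leaves_def leaves_def)
qed

text \<open>A point y of the span that leaves the path to x above z produces the branch point
  \<open>meet x y\<close> between z and x; conversely, a branch point closer to x than z would lie
  above z. So the topological condition of not being a limit of branch points becomes a condition on
  the order.\<close>

lemma isolated_leaf_iff:
  "x \<in> isolated_leaves r Sp \<longleftrightarrow> x \<in> Sp \<and> (\<exists>z. z \<sqsubset> x \<and> (\<forall>y\<in>Sp. z \<sqsubseteq> y \<longrightarrow> y \<sqsubseteq> x))"
proof
  assume "x \<in> isolated_leaves r Sp"
  then have x: "x \<in> Sp" "x \<noteq> r" "\<And>y. y \<in> Sp \<Longrightarrow> x \<sqsubseteq> y \<Longrightarrow> y = x"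
    and iso: "\<not> x islimpt rooted_branch_points r Sp"
    by (auto simp: isolated_leaves_def leaf_iff)
  obtain e where e: "e > 0" "\<And>y. y \<in> rooted_branch_points r Sp \<Longrightarrow> y \<noteq> x \<Longrightarrow> e \<le> dist y x"
    using iso unfolding islimpt_approachable by (metis not_le)
  have rx: "dist r x > 0" using x(2) by simp
  \<comment> \<open>Half the isolation radius below x; the maximum with 0 yields the root if x is
    too low for that.\<close>
  define t where "t = max 0 (dist r x - e / 2)"
  obtain z where z: "z \<sqsubseteq> x" "dist r z = t"
    using point_at_height[of t x] e(1) by (auto simp: t_def)
  have "y \<sqsubseteq> x" if y: "y \<in> Sp" "z \<sqsubseteq> y" for y
  proof (rule ccontr)
    assume n: "\<not> y \<sqsubseteq> x"
    let ?m = "meet x y"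
    have "?m \<noteq> x" using x(3)[OF y(1)] n meet_le2[of x y] by (metis le_refl)
    moreover have "?m \<noteq> y" using n meet_le1[of x y] by metis
    ultimately have "?m \<in> rooted_branch_points r Sp"
      unfolding branch_iff using x(1) y(1) by (metis meet_le1 meet_le2)
    then have "e \<le> dist ?m x" using e(2) \<open>?m \<noteq> x\<close> by blast
    moreover have "z \<sqsubseteq> ?m" using z(1) y(2) by simp
    then have "dist r z \<le> dist r ?m" by (rule le_height)
    moreover have "dist r ?m + dist ?m x = dist r x" using meet_le1[of x y] by (simp add: le_iff)
    ultimately show False using z(2) e(1) by (simp add: t_def max_def split: if_splits)
  qed
  moreover have "z \<noteq> x" using z(2) rx e(1) by (auto simp: t_def max_def split: if_splits)
  ultimately show "x \<in> Sp \<and> (\<exists>z. z \<sqsubset> x \<and> (\<forall>y\<in>Sp. z \<sqsubseteq> y \<longrightarrow> y \<sqsubseteq> x))"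
    using x(1) z(1) by blast
next
  assume "x \<in> Sp \<and> (\<exists>z. z \<sqsubset> x \<and> (\<forall>y\<in>Sp. z \<sqsubseteq> y \<longrightarrow> y \<sqsubseteq> x))"
  then obtain z where x: "x \<in> Sp" and z: "z \<sqsubset> x" and zx: "\<And>y. y \<in> Sp \<Longrightarrow> z \<sqsubseteq> y \<Longrightarrow> y \<sqsubseteq> x" by blast
  have leaf: "x \<in> rooted_leaves r Sp"
    unfolding leaf_iff using x z zx le_trans le_antisym by (metis le_root_iff)
  have "dist z x \<le> dist y x" if y: "y \<in> rooted_branch_points r Sp" "y \<noteq> x" for y
  proof (rule ccontr)
    assume n: "\<not> ?thesis"
    obtain u v where uv: "u \<in> Sp" "v \<in> Sp" "y \<sqsubset> u" "y \<sqsubset> v" "meet u v = y"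
      using y(1) unfolding branch_iff by blast
    have "dist r z < dist r (meet x y)"
      using n z dist_meet[of x y] meet_le1[of x y] zero_le_dist[of "meet x y" y]
        dist_commute[of x "meet x y"] dist_commute[of x y] unfolding le_iff by linarith
    then have "z \<sqsubseteq> meet x y" using z le_of_height[OF _ meet_le1] by (meson less_imp_le)
    then have "z \<sqsubseteq> y" by simp
    then have "u \<sqsubseteq> x" "v \<sqsubseteq> x" using zx uv le_trans by blast+
    then have "u \<sqsubseteq> v \<or> v \<sqsubseteq> u" by (rule le_linear)
    then show False using uv meet_absorb1 meet_absorb2 by metis
  qed
  moreover have "dist z x > 0" using z by simp
  ultimately have "\<not> x islimpt rooted_branch_points r Sp"
    unfolding islimpt_approachable by (metis not_le)
  then show "x \<in> isolated_leaves r Sp" using leaf by (simp add: isolated_leaves_def)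
qed

lemma special_iff:
  "x \<in> S \<longleftrightarrow> measure p {x} > 0 \<or> (\<exists>u\<in>Sp. \<exists>v\<in>Sp. x \<sqsubset> u \<and> x \<sqsubset> v \<and> meet u v = x) \<or>
     x \<in> Sp \<and> (\<exists>z. z \<sqsubset> x \<and> (\<forall>y\<in>Sp. z \<sqsubseteq> y \<longrightarrow> y \<sqsubseteq> x))"
  unfolding special_points_def by (auto simp only: Un_iff mem_Collect_eq branch_iff isolated_leaf_iff)

text \<open>The leaf case excludes atoms, so that a generic sample never hits x there.\<close>

lemma special_cases [consumes 1, case_names atom branch leaf]:
  assumes "x \<in> S"
  obtains "measure p {x} > 0"
    | u v where "u \<in> Sp" "v \<in> Sp" "x \<sqsubset> u" "x \<sqsubset> v" "meet u v = x"
    | z where "x \<in> Sp" "measure p {x} = 0" "z \<sqsubset> x" "\<And>y. y \<in> Sp \<Longrightarrow> z \<sqsubseteq> y \<Longrightarrow> y \<sqsubseteq> x"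
  using assms unfolding special_iff by (metis zero_less_measure_iff)

lemma special_in_Span: "x \<in> S \<Longrightarrow> x \<in> Sp"
  by (erule special_cases) (use atom_in_Span Span_down in blast)+

lemma atom_special: "measure p {x} > 0 \<Longrightarrow> x \<in> S"
  by (simp add: special_iff)

section \<open>Existence and countability of special points\<close>

lemma meet_special:
  assumes "x \<in> Sp" "y \<in> Sp" "\<not> x \<sqsubseteq> y" "\<not> y \<sqsubseteq> x"
  shows "meet x y \<in> S"
proof -
  have "meet x y \<noteq> x" "meet x y \<noteq> y" using assms meet_le1 meet_le2 by metis+
  then have "\<exists>u\<in>Sp. \<exists>v\<in>Sp. meet x y \<sqsubset> u \<and> meet x y \<sqsubset> v \<and> meet u v = meet x y"
    using assms(1,2) by (metis meet_le1 meet_le2)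
  then show ?thesis unfolding special_iff by blast
qed

text \<open>Without a special point above x the span above x is a chain, since two incomparable
  points would have a special meet. Its supremum y lies in the closed support, and if y differed
  from x it would be an isolated leaf with x as the witness z.\<close>

lemma special_above:
  assumes x: "x \<in> Sp"
  obtains s where "s \<in> S" "x \<sqsubseteq> s" | "\<And>w. w \<in> Sp \<Longrightarrow> x \<sqsubseteq> w \<Longrightarrow> w = x"
proof (cases "\<exists>s\<in>S. x \<sqsubseteq> s")
  case True
  then show ?thesis using that by blast
next
  case False
  have chain: "u \<sqsubseteq> v \<or> v \<sqsubseteq> u" if "u \<in> Sp" "v \<in> Sp" "x \<sqsubseteq> u" "x \<sqsubseteq> v" for u v
    using meet_special[of u v] that False by force
  define C where "C = supp \<inter> fringe r x"
  have memC: "c \<in> C \<longleftrightarrow> c \<in> supp \<and> x \<sqsubseteq> c" for c by (auto simp: C_def fringe_def)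
  have "C \<noteq> {}" using x memC by (auto simp: mem_Span_iff)
  then obtain y where y: "\<And>c. c \<in> C \<Longrightarrow> c \<sqsubseteq> y" "y \<in> closure C"
    by (rule chain_sup[of C]) (use chain memC supp_subset_Span in blast)+
  have "closed C" unfolding C_def by (intro closed_Int closed_supp closed_fringe)
  then have "y \<in> C" using y(2) by simp
  then have "y \<in> Sp" "x \<sqsubseteq> y" using memC supp_subset_Span by auto
  moreover have above: "w \<sqsubseteq> y" if "w \<in> Sp" "x \<sqsubseteq> w" for w
    using that y(1) memC le_trans unfolding mem_Span_iff by blast
  ultimately have "x \<noteq> y \<Longrightarrow> y \<in> S" unfolding special_iff by blast
  then have "x = y" using False \<open>x \<sqsubseteq> y\<close> by blast
  then show ?thesis using that(2) above le_antisym by blast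
qed

text \<open>By hypothesis d leaves x in the direction of u, and e in that of v. So u and v may be
  replaced by nearby points of a dense set or of a sample without moving the meet.\<close>

lemma meet_of_branches:
  assumes uv: "meet u v = x" and ue: "x \<sqsubset> meet u d" "x \<sqsubset> meet v e"
  shows "meet d e = x"
proof (rule meet_eqI)
  fix w assume w: "w \<sqsubseteq> d" "w \<sqsubseteq> e"
  have "w \<sqsubseteq> meet u d \<or> meet u d \<sqsubseteq> w" "w \<sqsubseteq> meet v e \<or> meet v e \<sqsubseteq> w"
    by (rule le_linear[OF w(1) meet_le2], rule le_linear[OF w(2) meet_le2])
  moreover have False if "meet u d \<sqsubseteq> w" "meet v e \<sqsubseteq> w"
  proof -
    have "meet u d \<sqsubseteq> meet v e \<or> meet v e \<sqsubseteq> meet u d" using that by (rule le_linear)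
    then have "meet u d \<sqsubseteq> meet u v \<or> meet v e \<sqsubseteq> meet u v" by auto
    then show False using uv ue le_antisym by auto
  qed
  ultimately have "w \<sqsubseteq> meet u v \<or> meet u d \<sqsubseteq> meet u v \<or> meet v e \<sqsubseteq> meet u v"
    using le_trans by (metis le_meet_iff meet_le1)
  then show "w \<sqsubseteq> x" using uv ue le_antisym by auto
qed (use ue in auto)

text \<open>A branch point is a meet of two points of a countable dense set. An isolated leaf x is
  assigned a dense point that leaves [[r, x]] above the witness z of x, and this assignment is
  injective.\<close>

lemma countable_special: "countable S"
proof -
  obtain D :: "'a set" where D: "countable D" "\<And>X. open X \<Longrightarrow> X \<noteq> {} \<Longrightarrow> \<exists>d\<in>D. d \<in> X"
    using countable_dense_exists by blast
  have "rooted_branch_points r Sp \<subseteq> (\<lambda>(d, e). meet d e) ` (D \<times> D)"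
  proof
    fix x assume "x \<in> rooted_branch_points r Sp"
    then obtain u v where uv: "x \<sqsubset> u" "x \<sqsubset> v" "meet u v = x" unfolding branch_iff by blast
    have "\<exists>d\<in>D. dist r x < gp w d" if "x \<sqsubset> w" for w
      using D(2)[OF open_gp[of "dist r x" w]] lt_height[OF that] gp_eq_height[OF le_refl[of w]]
      by (metis (mono_tags, lifting) empty_iff mem_Collect_eq)
    then obtain d e where de: "d \<in> D" "e \<in> D" "dist r x < gp u d" "dist r x < gp v e"
      using uv by metis
    then have ue: "x \<sqsubset> meet u d" "x \<sqsubset> meet v e" using less_gpD uv by blast+
    then have "meet d e = x" using meet_of_branches uv(3) by blast
    then show "x \<in> (\<lambda>(d, e). meet d e) ` (D \<times> D)" using de by force
  qed
  then have "countable (rooted_branch_points r Sp)" by (rule countable_subset) (intro countable_image countable_SIGMA D(1))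
  moreover have "countable (isolated_leaves r Sp)"
  proof -
    have "\<exists>z d. z \<sqsubset> x \<and> (\<forall>y\<in>Sp. z \<sqsubseteq> y \<longrightarrow> y \<sqsubseteq> x) \<and> d \<in> D \<and> z \<sqsubset> meet x d"
      if x: "x \<in> isolated_leaves r Sp" for x
    proof -
      obtain z where z: "z \<sqsubset> x" "\<forall>y\<in>Sp. z \<sqsubseteq> y \<longrightarrow> y \<sqsubseteq> x" using x unfolding isolated_leaf_iff by blast
      then obtain d where "d \<in> D" "dist r z < gp x d"
        using D(2)[OF open_gp[of "dist r z" x]] lt_height[OF z(1)] gp_eq_height[OF le_refl[of x]]
        by (metis (mono_tags, lifting) empty_iff mem_Collect_eq)
      then show ?thesis using z less_gpD by blast
    qed
    then obtain z d where zd: "\<And>x. x \<in> isolated_leaves r Sp \<Longrightarrow> z x \<sqsubset> x \<and>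
      (\<forall>y\<in>Sp. z x \<sqsubseteq> y \<longrightarrow> y \<sqsubseteq> x) \<and> d x \<in> D \<and> z x \<sqsubset> meet x (d x)" by metis
    have "inj_on d (isolated_leaves r Sp)"
    proof (rule inj_onI)
      fix x x' assume x: "x \<in> isolated_leaves r Sp" "x' \<in> isolated_leaves r Sp" "d x = d x'"
      have Sp: "x \<in> Sp" "x' \<in> Sp" using x by (auto simp: isolated_leaf_iff)
      \<comment> \<open>If the lower of the two meets is the one at x, then \<open>z x\<close>
        \<sqsubseteq> x' gives x' \<sqsubseteq> x, and this in turn gives \<open>z x'\<close>
        \<sqsubseteq> x.\<close>
      have *: "x' \<sqsubseteq> x \<and> x \<sqsubseteq> x'" if "meet x (d x) \<sqsubseteq> meet x' (d x')"
        "x \<in> isolated_leaves r Sp" "x' \<in> isolated_leaves r Sp" "x \<in> Sp" "x' \<in> Sp" for x x'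
      proof -
        have "z x \<sqsubseteq> x'" using zd[OF that(2)] that(1) le_trans by (metis le_meet_iff)
        then have "x' \<sqsubseteq> x" using zd[OF that(2)] that by blast
        moreover then have "z x' \<sqsubseteq> x" using zd[OF that(3)] le_trans by blast
        then have "x \<sqsubseteq> x'" using zd[OF that(3)] that by blast
        ultimately show ?thesis by blast
      qed
      have "meet x (d x) \<sqsubseteq> meet x' (d x') \<or> meet x' (d x') \<sqsubseteq> meet x (d x)"
        using x(3) by (intro le_linear[of _ "d x"]) auto
      then show "x = x'" using *[of x x'] *[of x' x] x Sp le_antisym by blast
    qed
    moreover have "d ` isolated_leaves r Sp \<subseteq> D" using zd by blast
    ultimately show ?thesis using D(1) by (meson countable_image_inj_on countable_subset)
  qed
  moreover have "countable {x. measure p {x} > 0}"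
    by (rule countable_subset[OF _ countable_support]) auto
  ultimately show ?thesis unfolding special_points_def by blast
qed

end

section \<open>Hierarchies and triples\<close>

declare One_nat_def [simp del]

text \<open>A block with two or more indices is cut out by the lowest meet of two of its members,
  and all smaller blocks are present anyway; hence pairs i \<noteq> j suffice.\<close>

definition hierarchy_of_triples :: "nat \<Rightarrow> (nat \<times> nat \<times> nat) set \<Rightarrow> nat set set" where
  "hierarchy_of_triples n A =
     {{k \<in> {1..n}. (i, j, k) \<in> A} | i j. i \<in> {1..n} \<and> j \<in> {1..n} \<and> i \<noteq> j} \<union>
     {{i} | i. i \<in> {1..n}} \<union> {{}}"

text \<open>The smallest block that contains i and j is cut out by the meet of the two samples. For
  i = j it would be the singleton {i}, which tells nothing about the tree.\<close>

definition triples_of_hierarchy :: "nat \<Rightarrow> nat set set \<Rightarrow> (nat \<times> nat \<times> nat) set" where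
  "triples_of_hierarchy n H =
     {(i, j, k) \<in> {1..n} \<times> {1..n} \<times> {1..n}. i \<noteq> j \<and> (\<forall>B\<in>H. i \<in> B \<and> j \<in> B \<longrightarrow> k \<in> B)}"

context rooted_tree
begin

definition triples :: "nat \<Rightarrow> (nat \<Rightarrow> 'a) \<Rightarrow> (nat \<times> nat \<times> nat) set" where
  "triples n X =
     {(i, j, k) \<in> {1..n} \<times> {1..n} \<times> {1..n}. i \<noteq> j \<and> meet (X i) (X j) \<sqsubseteq> X k}"

lemma triples_subset: "triples n X \<subseteq> {1..n} \<times> {1..n} \<times> {1..n}"
  by (auto simp: triples_def)

lemma triples_restrict: "m \<le> n \<Longrightarrow> triples m X = triples n X \<inter> {1..m} \<times> {1..m} \<times> {1..m}"
  by (auto simp: triples_def)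

lemma sampled_hierarchy_altdef:
  "sampled_hierarchy r X n =
     {{i \<in> {1..n}. x \<sqsubseteq> X i} | x. True} \<union> {{i} | i. i \<in> {1..n}} \<union> {{}}"
  by (simp add: sampled_hierarchy_def fringe_def)

text \<open>The pair a, b in the block with the lowest meet is the right one: for any other k in the
  block \<open>gp (X a) (X b)\<close> \<le> \<open>gp (X a) (X k)\<close>, so this meet lies below
  \<open>X k\<close>.\<close>

lemma block_eq_triple_block:
  fixes X :: "nat \<Rightarrow> 'a"
  assumes "i \<in> {1..n}" "j \<in> {1..n}" "i \<noteq> j" "x \<sqsubseteq> X i" "x \<sqsubseteq> X j"
  shows "\<exists>i\<in>{1..n}. \<exists>j\<in>{1..n}. i \<noteq> j \<and> {k \<in> {1..n}. x \<sqsubseteq> X k} = {k \<in> {1..n}. meet (X i) (X j) \<sqsubseteq> X k}"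
proof -
  let ?A = "{(i, j). i \<in> {1..n} \<and> j \<in> {1..n} \<and> i \<noteq> j \<and> x \<sqsubseteq> X i \<and> x \<sqsubseteq> X j}"
  have "finite ?A" by (rule finite_subset[of _ "{1..n} \<times> {1..n}"]) auto
  moreover have "?A \<noteq> {}" using assms by auto
  ultimately obtain q where q: "q \<in> ?A" "\<And>q'. q' \<in> ?A \<Longrightarrow> gp (X (fst q)) (X (snd q)) \<le> gp (X (fst q')) (X (snd q'))"
    using arg_min_if_finite[of ?A "\<lambda>q. gp (X (fst q)) (X (snd q))"]
    by (metis (no_types, lifting) not_le)
  obtain a b where ab: "q = (a, b)" by (cases q)
  have "meet (X a) (X b) \<sqsubseteq> X k" if "k \<in> {1..n}" "x \<sqsubseteq> X k" for k
  proof (cases "k = a")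
    case False
    then have "gp (X a) (X b) \<le> gp (X a) (X k)"
      using q(1) q(2)[of "(a, k)"] that ab by auto
    then show ?thesis by (simp add: meet_le_iff_gp)
  qed simp
  moreover have "x \<sqsubseteq> X k" if "meet (X a) (X b) \<sqsubseteq> X k" for k
    using q(1) ab that le_trans[of x "meet (X a) (X b)" "X k"] by simp
  ultimately have "{k \<in> {1..n}. x \<sqsubseteq> X k} = {k \<in> {1..n}. meet (X a) (X b) \<sqsubseteq> X k}" by blast
  then show ?thesis using q(1) ab by blast
qed

lemma sampled_hierarchy_eq: "sampled_hierarchy r X n = hierarchy_of_triples n (triples n X)"
proof -
  have *: "{k \<in> {1..n}. (i, j, k) \<in> triples n X} = {k \<in> {1..n}. meet (X i) (X j) \<sqsubseteq> X k}"
    if "i \<in> {1..n}" "j \<in> {1..n}" "i \<noteq> j" for i j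
    using that by (auto simp: triples_def)
  have block: "B \<in> hierarchy_of_triples n (triples n X)" if B: "B = {k \<in> {1..n}. x \<sqsubseteq> X k}" for B x
  proof (cases "\<exists>i\<in>B. \<exists>j\<in>B. i \<noteq> j")
    case True
    then obtain i j where "i \<in> {1..n}" "j \<in> {1..n}" "i \<noteq> j" "x \<sqsubseteq> X i" "x \<sqsubseteq> X j"
      unfolding B by blast
    from block_eq_triple_block[OF this] show ?thesis
      unfolding hierarchy_of_triples_def that using * by blast
  next
    case False
    then have "B = {} \<or> (\<exists>i. B = {i})" by blast
    moreover have "B \<subseteq> {1..n}" using that by blast
    ultimately show ?thesis unfolding hierarchy_of_triples_def by blast
  qed
  have triple: "{k \<in> {1..n}. (i, j, k) \<in> triples n X} \<in> sampled_hierarchy r X n"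
    if "i \<in> {1..n}" "j \<in> {1..n}" "i \<noteq> j" for i j
    unfolding sampled_hierarchy_altdef *[OF that] by blast
  show ?thesis
  proof (intro equalityI subsetI)
    fix B assume "B \<in> sampled_hierarchy r X n"
    then consider x where "B = {k \<in> {1..n}. x \<sqsubseteq> X k}" | "B \<in> {{i} | i. i \<in> {1..n}} \<union> {{}}"
      unfolding sampled_hierarchy_altdef by blast
    then show "B \<in> hierarchy_of_triples n (triples n X)"
    proof cases
      case 1
      then show ?thesis by (rule block)
    next
      case 2
      then show ?thesis unfolding hierarchy_of_triples_def by blast
    qed
  next
    fix B assume "B \<in> hierarchy_of_triples n (triples n X)"
    then consider i j where "B = {k \<in> {1..n}. (i, j, k) \<in> triples n X}" "i \<in> {1..n}" "j \<in> {1..n}" "i \<noteq> j"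
      | "B \<in> {{i} | i. i \<in> {1..n}} \<union> {{}}"
      unfolding hierarchy_of_triples_def by blast
    then show "B \<in> sampled_hierarchy r X n"
    proof cases
      case 1
      then show ?thesis using triple by simp
    next
      case 2
      then show ?thesis unfolding sampled_hierarchy_altdef by blast
    qed
  qed
qed

lemma triples_of_sampled_hierarchy: "triples_of_hierarchy n (sampled_hierarchy r X n) = triples n X"
proof -
  have "(\<forall>B\<in>sampled_hierarchy r X n. i \<in> B \<and> j \<in> B \<longrightarrow> k \<in> B) \<longleftrightarrow> meet (X i) (X j) \<sqsubseteq> X k"
    if "i \<in> {1..n}" "j \<in> {1..n}" "k \<in> {1..n}" "i \<noteq> j" for i j k
  proof
    assume "\<forall>B\<in>sampled_hierarchy r X n. i \<in> B \<and> j \<in> B \<longrightarrow> k \<in> B"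
    moreover have "{l \<in> {1..n}. meet (X i) (X j) \<sqsubseteq> X l} \<in> sampled_hierarchy r X n"
      unfolding sampled_hierarchy_altdef by blast
    ultimately have "k \<in> {l \<in> {1..n}. meet (X i) (X j) \<sqsubseteq> X l}" using that by force
    then show "meet (X i) (X j) \<sqsubseteq> X k" by blast
  next
    assume R: "meet (X i) (X j) \<sqsubseteq> X k"
    have "x \<sqsubseteq> X k" if "x \<sqsubseteq> X i" "x \<sqsubseteq> X j" for x
      using R that le_trans[of x "meet (X i) (X j)" "X k"] by simp
    then show "\<forall>B\<in>sampled_hierarchy r X n. i \<in> B \<and> j \<in> B \<longrightarrow> k \<in> B"
      unfolding sampled_hierarchy_altdef using that by auto
  qed
  then show ?thesis by (auto simp: triples_of_hierarchy_def triples_def)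
qed

text \<open>Two blocks with a common index i come from two points below \<open>X i\<close>; these
  are comparable, so the blocks are nested.\<close>

lemma hierarchy_sampled_hierarchy: "hierarchy {1..n} (sampled_hierarchy r X n)"
proof -
  have "A \<inter> B = A \<or> A \<inter> B = B \<or> A \<inter> B = {}"
    if AB: "A \<in> sampled_hierarchy r X n" "B \<in> sampled_hierarchy r X n" for A B
  proof -
    have "A \<inter> B = A \<or> A \<inter> B = B \<or> A \<inter> B = {}"
      if xy: "A = {i \<in> {1..n}. x \<sqsubseteq> X i}" "B = {i \<in> {1..n}. y \<sqsubseteq> X i}" for x y
    proof (cases "A \<inter> B = {}")
      case False
      then obtain i where "x \<sqsubseteq> X i" "y \<sqsubseteq> X i" unfolding xy by blast
      then have "x \<sqsubseteq> y \<or> y \<sqsubseteq> x" by (rule le_linear)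
      then have "B \<subseteq> A \<or> A \<subseteq> B" unfolding that using le_trans by blast
      then show ?thesis by blast
    qed simp
    then show ?thesis using AB unfolding sampled_hierarchy_altdef by blast
  qed
  moreover have "{1..n} \<in> sampled_hierarchy r X n"
  proof -
    have "{1..n} = {i \<in> {1..n}. r \<sqsubseteq> X i}" by auto
    then show ?thesis unfolding sampled_hierarchy_altdef by blast
  qed
  moreover have "sampled_hierarchy r X n \<subseteq> Pow {1..n}"
    unfolding sampled_hierarchy_altdef by blast
  moreover have "{} \<in> sampled_hierarchy r X n" "\<forall>s\<in>{1..n}. {s} \<in> sampled_hierarchy r X n"
    unfolding sampled_hierarchy_altdef by blast+
  ultimately show ?thesis unfolding hierarchy_def by blast
qed

lemma sampled_hierarchy_Suc:
  "sampled_hierarchy r X n = {A \<inter> {1..n} | A. A \<in> sampled_hierarchy r X (Suc n)}"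
proof (intro set_eqI iffI)
  fix B assume "B \<in> sampled_hierarchy r X n"
  then consider x where "B = {i \<in> {1..n}. x \<sqsubseteq> X i}" | i where "B = {i}" "i \<in> {1..n}" | "B = {}"
    unfolding sampled_hierarchy_altdef by blast
  then show "B \<in> {A \<inter> {1..n} | A. A \<in> sampled_hierarchy r X (Suc n)}"
  proof cases
    case 1
    then have "B = {i \<in> {1..Suc n}. x \<sqsubseteq> X i} \<inter> {1..n}" by auto
    then show ?thesis unfolding sampled_hierarchy_altdef by blast
  next
    case 2
    then have "B = {i} \<inter> {1..n}" "i \<in> {1..Suc n}" by auto
    then show ?thesis unfolding sampled_hierarchy_altdef by blast
  next
    case 3
    then have "B = {} \<inter> {1..n}" by auto
    then show ?thesis unfolding sampled_hierarchy_altdef by blast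
  qed
next
  fix B assume "B \<in> {A \<inter> {1..n} | A. A \<in> sampled_hierarchy r X (Suc n)}"
  then obtain A where A: "A \<in> sampled_hierarchy r X (Suc n)" "B = A \<inter> {1..n}" by blast
  consider x where "A = {i \<in> {1..Suc n}. x \<sqsubseteq> X i}" | i where "A = {i}" | "A = {}"
    using A(1) unfolding sampled_hierarchy_altdef by blast
  then show "B \<in> sampled_hierarchy r X n"
  proof cases
    case 1
    then have "B = {i \<in> {1..n}. x \<sqsubseteq> X i}" using A by auto
    then show ?thesis unfolding sampled_hierarchy_altdef by blast
  next
    case 2
    then have "B = {} \<or> B = {i} \<and> i \<in> {1..n}" using A by auto
    then show ?thesis unfolding sampled_hierarchy_altdef by blast
  next
    case 3
    then show ?thesis using A unfolding sampled_hierarchy_altdef by blast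
  qed
qed

lemma sampled_in_nat_hierarchies: "(\<lambda>n\<in>{1..}. sampled_hierarchy r X n) \<in> nat_hierarchies"
  unfolding nat_hierarchies_def
proof (intro CollectI conjI allI impI)
  show "(\<lambda>n\<in>{1..}. sampled_hierarchy r X n) \<in> (\<Pi>\<^sub>E n\<in>{1..}. {h. hierarchy {1..n} h})"
    by (intro restrict_PiE_iff[THEN iffD2] ballI CollectI hierarchy_sampled_hierarchy)
  fix n :: nat assume "1 \<le> n"
  then have n: "n \<in> {1..}" "Suc n \<in> {1..}" by auto
  show "(\<lambda>n\<in>{1..}. sampled_hierarchy r X n) n =
      {A \<inter> {1..n} | A. A \<in> (\<lambda>n\<in>{1..}. sampled_hierarchy r X n) (Suc n)}"
    unfolding restrict_apply'[OF n(1)] restrict_apply'[OF n(2)] by (rule sampled_hierarchy_Suc)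
qed

end

section \<open>Measurability, and reduction of the law to the triples\<close>

context weighted_tree
begin

text \<open>The product over all of nat has UNIV as its space; the hierarchies read the positive
  coordinates.\<close>

abbreviation P :: "(nat \<Rightarrow> 'a) measure" where "P \<equiv> Pi\<^sub>M UNIV (\<lambda>_. p)"

lemma prob_P: "prob_space P"
  by (intro prob_space_PiM prob)

lemma space_P [simp]: "space P = UNIV"
  by (simp add: space_PiM)

lemma measurable_gp [measurable]:
  assumes [measurable]: "f \<in> borel_measurable M" "g \<in> borel_measurable M"
  shows "(\<lambda>x. gp (f x) (g x)) \<in> borel_measurable M"
  unfolding gp_def by measurable

lemma measurable_component_borel [measurable]: "(\<lambda>X. X i) \<in> borel_measurable P"
  using measurable_component_singleton[of i UNIV "\<lambda>_. p"] by (simp add: measurable_cong_sets[OF refl sets_p])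

text \<open>By \<open>meet_le_iff_gp\<close> each triple is an inequality between Gromov products,
  so everything reduces to the measurability of \<open>dist\<close>.\<close>

lemma measurable_triples [measurable]: "triples n \<in> measurable P (count_space UNIV)"
proof -
  have eq: "triples n X = A \<longleftrightarrow> A \<subseteq> {1..n} \<times> {1..n} \<times> {1..n} \<and> (\<forall>i\<in>{1..n}. \<forall>j\<in>{1..n}. \<forall>k\<in>{1..n}.
      (i, j, k) \<in> A \<longleftrightarrow> i \<noteq> j \<and> gp (X i) (X j) \<le> gp (X i) (X k))" for X A
    unfolding meet_le_iff_gp[symmetric] triples_def by auto
  have gpm: "(\<lambda>X. gp (X i) (X j)) \<in> borel_measurable P" for i j
    by (intro measurable_gp measurable_component_borel)
  have m: "Measurable.pred P (\<lambda>X. gp (X i) (X j) \<le> gp (X i) (X k))" for i j k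
    using borel_measurable_le[OF gpm gpm] by (simp add: pred_def)
  have "Measurable.pred P (\<lambda>X. (i, j, k) \<in> A \<longleftrightarrow> i \<noteq> j \<and> gp (X i) (X j) \<le> gp (X i) (X k))" for i j k A
    using m[of i j k] by (cases "(i, j, k) \<in> A"; cases "i = j") simp_all
  then have all: "Measurable.pred P (\<lambda>X. \<forall>i\<in>{1..n}. \<forall>j\<in>{1..n}. \<forall>k\<in>{1..n}.
      (i, j, k) \<in> A \<longleftrightarrow> i \<noteq> j \<and> gp (X i) (X j) \<le> gp (X i) (X k))" for A
    by (intro pred_intros_finite(3) finite_atLeastAtMost)
  have "Measurable.pred P (\<lambda>X. triples n X = A)" for A
  proof (cases "A \<subseteq> {1..n} \<times> {1..n} \<times> {1..n}")
    case True
    then show ?thesis unfolding eq using all[of A] by (simp only: simp_thms)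
  next
    case False
    then have "(\<lambda>X. triples n X = A) = (\<lambda>X. False)" using triples_subset by blast
    then show ?thesis by simp
  qed
  then have "triples n \<in> measurable P (count_space (Pow ({1..n} \<times> {1..n} \<times> {1..n})))"
    using triples_subset
    by (subst measurable_count_space_eq2) (auto simp: pred_def vimage_def Int_def)
  from measurable_compose[OF this, of "\<lambda>A. A" "count_space UNIV"] show ?thesis by simp
qed

lemma measurable_sampled:
  "(\<lambda>X. sampled_hierarchy r X n) \<in> measurable P (count_space {h. hierarchy {1..n} h})"
proof -
  have fin: "finite {h. hierarchy {1..n} h}"
    by (rule finite_subset[of _ "Pow (Pow {1..n})"]) (auto simp: hierarchy_def)
  have "{X. sampled_hierarchy r X n = h} = (\<lambda>X. hierarchy_of_triples n (triples n X)) -` {h} \<inter> space P" for h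
    by (auto simp: sampled_hierarchy_eq)
  moreover have "(\<lambda>X. hierarchy_of_triples n (triples n X)) \<in> measurable P (count_space UNIV)"
    by (rule measurable_compose[OF measurable_triples]) simp
  ultimately have "{X. sampled_hierarchy r X n = h} \<in> sets P" for h
    by (metis measurable_sets sets_count_space UNIV_I Pow_UNIV)
  then show ?thesis
    using fin hierarchy_sampled_hierarchy
    by (subst measurable_count_space_eq2) (auto simp: vimage_def)
qed

lemma measurable_sampled_sequence:
  "(\<lambda>X. \<lambda>n\<in>{1..}. sampled_hierarchy r X n) \<in>
     measurable P (\<Pi>\<^sub>M n\<in>{1..}. count_space {h. hierarchy {1..n} h})"
  by (intro measurable_restrict measurable_sampled)

lemma measurable_sampled_space:
  "(\<lambda>X. \<lambda>n\<in>{1..}. sampled_hierarchy r X n) \<in> measurable P nat_hierarchy_space"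
  unfolding nat_hierarchy_space_def
  by (intro measurable_restrict_space2 measurable_sampled_sequence) (use sampled_in_nat_hierarchies in auto)

lemma Theta_eq: "Theta r p = distr P nat_hierarchy_space (\<lambda>X. \<lambda>n\<in>{1..}. sampled_hierarchy r X n)"
proof -
  have cong: "(\<lambda>n\<in>{1..}. sampled_hierarchy r X n) = (\<lambda>n\<in>{1..}. sampled_hierarchy r Y n)"
    if "\<And>i. i \<in> {1..} \<Longrightarrow> X i = Y i" for X Y :: "nat \<Rightarrow> 'a"
  proof (rule restrict_ext)
    fix n show "sampled_hierarchy r X n = sampled_hierarchy r Y n"
      using that unfolding sampled_hierarchy_eq triples_def by (intro arg_cong[of _ _ "hierarchy_of_triples n"]) auto
  qed
  have ext: "(\<lambda>X. \<lambda>n\<in>{1..}. sampled_hierarchy r X n) \<in> measurable (\<Pi>\<^sub>M i\<in>{1..}. p) nat_hierarchy_space"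
  proof -
    \<comment> \<open>Extension by the value r at 0, the one index outside {1..}; any value would
      do.\<close>
    let ?g = "\<lambda>X i. if i \<in> {1..} then X i else r"
    have "?g \<in> measurable (\<Pi>\<^sub>M i\<in>{1..}. p) P"
    proof (intro measurable_PiM_single')
      fix i show "(\<lambda>X. ?g X i) \<in> measurable (\<Pi>\<^sub>M i\<in>{1..}. p) p"
        by (cases "i \<in> {1..}") auto
    qed auto
    from measurable_compose[OF this measurable_sampled_space]
    have "(\<lambda>X. \<lambda>n\<in>{1..}. sampled_hierarchy r (?g X) n) \<in> measurable (\<Pi>\<^sub>M i\<in>{1..}. p) nat_hierarchy_space" .
    moreover have "(\<lambda>n\<in>{1..}. sampled_hierarchy r (?g X) n) = (\<lambda>n\<in>{1..}. sampled_hierarchy r X n)" for X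
      by (rule cong) simp
    ultimately show ?thesis by simp
  qed
  have restr: "(\<lambda>n\<in>{1..}. sampled_hierarchy r (restrict X {1..}) n) = (\<lambda>n\<in>{1..}. sampled_hierarchy r X n)"
    for X :: "nat \<Rightarrow> 'a"
    by (rule cong) simp
  have "distr P (\<Pi>\<^sub>M i\<in>{1..}. p) (\<lambda>X. restrict X {1..}) = (\<Pi>\<^sub>M i\<in>{1..}. p)"
    using distr_PiM_reindex[of UNIV "\<lambda>_. p" id "{1..}"] prob
    by (simp del: One_nat_def)
  then have "Theta r p = distr (distr P (\<Pi>\<^sub>M i\<in>{1..}. p) (\<lambda>X. restrict X {1..})) nat_hierarchy_space
      (\<lambda>X. \<lambda>n\<in>{1..}. sampled_hierarchy r X n)"
    by (simp add: Theta_def)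
  also have "\<dots> = distr P nat_hierarchy_space (\<lambda>X. \<lambda>n\<in>{1..}. sampled_hierarchy r X n)"
    by (subst distr_distr[OF ext]) (auto simp: comp_def restr intro!: measurable_restrict)
  finally show ?thesis .
qed

text \<open>The triples of lower levels are restrictions of those of level m, so the preimage of a
  cylinder over several levels is an event about the triples of a single level.\<close>

lemma vimage_sampled_prod_emb:
  assumes J: "J \<subseteq> {1..}" "\<And>j. j \<in> J \<Longrightarrow> j \<le> m"
  shows "(\<lambda>X. \<lambda>n\<in>{1..}. sampled_hierarchy r X n) -`
      prod_emb {1..} (\<lambda>n. count_space {h. hierarchy {1..n} h}) J (Pi\<^sub>E J A) \<inter> space P =
    {X. \<forall>j\<in>J. hierarchy_of_triples j (triples m X \<inter> {1..j} \<times> {1..j} \<times> {1..j}) \<in> A j}"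
proof -
  have "(\<lambda>n\<in>{1..}. sampled_hierarchy r X n) \<in> (\<Pi>\<^sub>E n\<in>{1..}. {h. hierarchy {1..n} h})" for X
    by (intro restrict_PiE_iff[THEN iffD2] ballI CollectI hierarchy_sampled_hierarchy)
  moreover have "restrict (\<lambda>n\<in>{1..}. sampled_hierarchy r X n) J \<in> Pi\<^sub>E J A \<longleftrightarrow>
      (\<forall>j\<in>J. hierarchy_of_triples j (triples m X \<inter> {1..j} \<times> {1..j} \<times> {1..j}) \<in> A j)" for X
  proof -
    have "(\<lambda>n\<in>{1..}. sampled_hierarchy r X n) j =
        hierarchy_of_triples j (triples m X \<inter> {1..j} \<times> {1..j} \<times> {1..j})" if "j \<in> J" for j
      using J(1) triples_restrict[OF J(2)[OF that], of X] that by (auto simp: sampled_hierarchy_eq)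
    then show ?thesis unfolding restrict_PiE_iff by (intro ball_cong refl) (simp only:)
  qed
  ultimately show ?thesis by (auto simp: prod_emb_def)
qed

lemma distr_triples_Theta:
  assumes "n \<ge> 1"
  shows "distr P (count_space UNIV) (triples n) =
     distr (Theta r p) (count_space UNIV) (\<lambda>H. triples_of_hierarchy n (H n))"
proof -
  have "(\<lambda>H. H n) \<in> measurable nat_hierarchy_space (count_space {h. hierarchy {1..n} h})"
    unfolding nat_hierarchy_space_def
    using assms by (intro measurable_restrict_space1) auto
  then have m: "(\<lambda>H. triples_of_hierarchy n (H n)) \<in> measurable nat_hierarchy_space (count_space UNIV)"
    by (rule measurable_compose) simp
  show ?thesis
    unfolding Theta_eq
    by (subst distr_distr[OF m measurable_sampled_space])
       (use assms in \<open>simp add: comp_def triples_of_sampled_hierarchy\<close>)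
qed

end

locale two_weighted_trees = T1: weighted_tree r1 p1 + T2: weighted_tree r2 p2
  for r1 :: "'a::polish_space" and p1 :: "'a measure"
  and r2 :: "'b::polish_space" and p2 :: "'b measure"
begin

definition same_triples :: bool where
  "same_triples \<longleftrightarrow> (\<forall>n. distr T1.P (count_space UNIV) (T1.triples n) =
                             distr T2.P (count_space UNIV) (T2.triples n))"

lemma same_triplesD:
  assumes "same_triples"
  shows "emeasure T1.P {X. Q (T1.triples n X)} = emeasure T2.P {X. Q (T2.triples n X)}"
proof -
  have "emeasure (distr T1.P (count_space UNIV) (T1.triples n)) {A. Q A} =
        emeasure (distr T2.P (count_space UNIV) (T2.triples n)) {A. Q A}"
    using assms by (simp add: same_triples_def)
  then show ?thesis by (simp add: emeasure_distr vimage_def)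
qed

lemma Theta_eq_iff: "Theta r1 p1 = Theta r2 p2 \<longleftrightarrow> same_triples"
proof
  assume eq: "Theta r1 p1 = Theta r2 p2"
  have "distr T1.P (count_space UNIV) (T1.triples n) = distr T2.P (count_space UNIV) (T2.triples n)" for n
  proof (cases "n \<ge> 1")
    case True
    then show ?thesis using eq by (simp add: T1.distr_triples_Theta T2.distr_triples_Theta)
  next
    case False
    then have *: "T1.triples n = (\<lambda>_. {})" "T2.triples n = (\<lambda>_. {})"
      by (auto simp: T1.triples_def T2.triples_def)
    show ?thesis unfolding * using T1.prob_P T2.prob_P
      by (intro measure_eqI) (auto simp: emeasure_distr dest!: prob_space.emeasure_space_1)
  qed
  then show same_triples by (simp add: same_triples_def)
next
  assume same: same_triples
  let ?N = "\<Pi>\<^sub>M n\<in>{1..}. count_space {h. hierarchy {1..n} h}"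
  let ?f1 = "\<lambda>X. \<lambda>n\<in>{1..}. sampled_hierarchy r1 X n"
  let ?f2 = "\<lambda>X. \<lambda>n\<in>{1..}. sampled_hierarchy r2 X n"
  \<comment> \<open>The laws are compared on the full product first, where cylinders generate;
    \<open>nat_hierarchy_space\<close> is its trace on a set that contains all sampled
    sequences.\<close>
  have N: "distr T1.P ?N ?f1 = distr T2.P ?N ?f2"
  proof (rule measure_eqI_PiM_infinite)
    show "sets (distr T1.P ?N ?f1) = sets ?N" "sets (distr T2.P ?N ?f2) = sets ?N" by auto
    show "finite_measure (distr T1.P ?N ?f1)"
      by (intro prob_space.finite_measure prob_space.prob_space_distr T1.prob_P T1.measurable_sampled_sequence)
    fix A and J :: "nat set"
    assume J: "finite J" "J \<subseteq> {1..}" and A: "\<And>i. i \<in> J \<Longrightarrow> A i \<in> sets (count_space {h. hierarchy {1..i} h})"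
    let ?B = "prod_emb {1..} (\<lambda>n. count_space {h. hierarchy {1..n} h}) J (Pi\<^sub>E J A)"
    define m where "m = Max (insert 0 J)"
    have m: "j \<le> m" if "j \<in> J" for j using that J by (simp add: m_def)
    have B: "?B \<in> sets ?N" using J A by (intro sets_PiM_I) auto
    have "emeasure (distr T1.P ?N ?f1) ?B = emeasure T1.P {X. \<forall>j\<in>J. hierarchy_of_triples j
        (T1.triples m X \<inter> {1..j} \<times> {1..j} \<times> {1..j}) \<in> A j}"
      using emeasure_distr[OF T1.measurable_sampled_sequence B] T1.vimage_sampled_prod_emb[OF J(2) m, of A]
      by (rule trans[OF _ arg_cong])
    also have "\<dots> = emeasure T2.P {X. \<forall>j\<in>J. hierarchy_of_triples j
        (T2.triples m X \<inter> {1..j} \<times> {1..j} \<times> {1..j}) \<in> A j}"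
      by (rule same_triplesD[OF same])
    also have "\<dots> = emeasure (distr T2.P ?N ?f2) ?B"
      using emeasure_distr[OF T2.measurable_sampled_sequence B] T2.vimage_sampled_prod_emb[OF J(2) m, of A]
      by (rule trans[OF _ arg_cong, symmetric])
    finally show "emeasure (distr T1.P ?N ?f1) ?B = emeasure (distr T2.P ?N ?f2) ?B" .
  qed
  show "Theta r1 p1 = Theta r2 p2"
  proof (rule measure_eqI)
    show "sets (Theta r1 p1) = sets (Theta r2 p2)" by (simp add: Theta_def)
    fix A assume "A \<in> sets (Theta r1 p1)"
    then have A: "A \<in> sets nat_hierarchy_space" by (simp add: Theta_def)
    then obtain B where B: "B \<in> sets ?N" "A = B \<inter> nat_hierarchies"
      unfolding nat_hierarchy_space_def sets_restrict_space by (auto simp: Int_commute)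
    have "?f1 -` A = ?f1 -` B" "?f2 -` A = ?f2 -` B"
      unfolding B(2) using T1.sampled_in_nat_hierarchies T2.sampled_in_nat_hierarchies by auto
    moreover have "emeasure T1.P (?f1 -` B \<inter> space T1.P) = emeasure T2.P (?f2 -` B \<inter> space T2.P)"
      using arg_cong[OF N, of "\<lambda>M. emeasure M B"]
      unfolding emeasure_distr[OF T1.measurable_sampled_sequence B(1)]
        emeasure_distr[OF T2.measurable_sampled_sequence B(1)] .
    ultimately show "emeasure (Theta r1 p1) A = emeasure (Theta r2 p2) A"
      unfolding T1.Theta_eq T2.Theta_eq emeasure_distr[OF T1.measurable_sampled_space A]
        emeasure_distr[OF T2.measurable_sampled_space A]
      by (simp only:)
  qed
qed

end

section \<open>Realising samples simultaneously\<close>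

lemma compact_approx:
  fixes M :: "'x::polish_space measure"
  assumes "finite_measure M" "sets M = sets borel" "B \<in> sets M" "0 < e"
  obtains K where "compact K" "K \<subseteq> B" "measure M (B - K) < e"
proof -
  interpret finite_measure M by fact
  have "emeasure M B = (SUP K\<in>{K. K \<subseteq> B \<and> compact K}. emeasure M K)"
    using assms by (intro inner_regular) (auto simp: emeasure_eq_measure)
  then have "\<exists>K. K \<subseteq> B \<and> compact K \<and> measure M B - e < measure M K"
  \<comment> \<open>The null case is apart because \<open>ennreal\<close> truncates the negative
    number \<open>measure M B - e\<close> to 0, which leaves no strict inequality.\<close>
  proof (cases "measure M B = 0")
    case True
    then show ?thesis using assms(4) by (intro exI[of _ "{}"]) auto
  next
    case False
    then have "ennreal (measure M B - e) < ennreal (measure M B)"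
      using assms(4) measure_nonneg[of M B] by (intro ennreal_lessI) linarith+
    then have "ennreal (measure M B - e) < (SUP K\<in>{K. K \<subseteq> B \<and> compact K}. emeasure M K)"
      using \<open>emeasure M B = _\<close> by (simp only: emeasure_eq_measure)
    then obtain K where K: "K \<subseteq> B" "compact K" "ennreal (measure M B - e) < ennreal (measure M K)"
      unfolding less_SUP_iff by (auto simp: emeasure_eq_measure)
    then have "measure M B - e < measure M K"
      using ennreal_leI[of "measure M K" "measure M B - e"] by (meson not_le)
    then show ?thesis using K by blast
  qed
  then obtain K where K: "K \<subseteq> B" "compact K" "measure M B - e < measure M K" by blast
  then have "K \<in> sets M" using assms(2) by (auto intro: borel_compact)
  then have "measure M (B - K) = measure M B - measure M K"
    using K(1) assms(3) by (intro finite_measure_Diff)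
  then show thesis using that K by simp
qed

text \<open>A form of Lusin's theorem for countably many finitely valued functions.\<close>

lemma compact_locally_constant:
  fixes M :: "'x::polish_space measure" and f :: "nat \<Rightarrow> 'x \<Rightarrow> 'c"
  assumes "prob_space M" and sets: "sets M = sets borel"
    and meas: "\<And>n. f n \<in> measurable M (count_space UNIV)" and fin: "\<And>n. finite (range (f n))"
    and AE: "AE x in M. Q x"
  obtains K where "compact K" "\<And>x. x \<in> K \<Longrightarrow> Q x" "measure M K > 1 / 2"
    "\<And>n c. closed (K \<inter> f n -` {c})"
proof -
  interpret prob_space M by fact
  have sp: "space M = UNIV" using sets_eq_imp_space_eq[OF sets] by simp
  obtain N where N: "{x \<in> space M. \<not> Q x} \<subseteq> N" "emeasure M N = 0" "N \<in> sets M"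
    using AE by (rule AE_E)
  have N1: "UNIV - N \<in> sets M" using N(3) sets.compl_sets[of N M] sp by simp
  obtain K0 where K0: "compact K0" "K0 \<subseteq> UNIV - N" "measure M (UNIV - N - K0) < 1 / 8"
    by (rule compact_approx[OF finite_measure_axioms sets N1, of "1/8"]) auto
  have fs: "f n -` {c} \<in> sets M" for n c
    using measurable_sets[OF meas, of "{c}" n] sp by simp
  \<comment> \<open>Summed over the values of \<open>f n\<close> the error is at most (1/2)^(n+3),
    and over all n at most 1/4. With the 1/8 spent on \<open>K0\<close> this is 3/8, so more than
    half of the mass remains; sets larger than one half are forced to meet later on.\<close>
  define e where "e n = (1/2) ^ (n + 3) / (real (card (range (f n))) + 1)" for n
  have "\<exists>L. compact L \<and> L \<subseteq> f n -` {c} \<and> measure M (f n -` {c} - L) < e n" for n c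
    by (rule compact_approx[OF finite_measure_axioms sets fs, of "e n" n c]) (auto simp: e_def)
  then obtain L where L: "\<And>n c. compact (L n c)" "\<And>n c. L n c \<subseteq> f n -` {c}"
    "\<And>n c. measure M (f n -` {c} - L n c) < e n" by metis
  define K where "K = K0 \<inter> (\<Inter>n. \<Union>c\<in>range (f n). L n c)"
  have clL: "closed (\<Union>c\<in>range (f n). L n c)" for n
    using fin L(1) by (intro closed_UN) (auto intro: compact_imp_closed)
  have "compact K" unfolding K_def by (intro compact_Int_closed K0(1) closed_INT ballI clL)
  moreover have "Q x" if "x \<in> K" for x
    using that K0(2) N(1) sp by (auto simp: K_def)
  \<comment> \<open>The sets \<open>L n c\<close> lie in disjoint fibres, so on K the fibre over c
    is cut out by the compact set \<open>L n c\<close>.\<close>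
  moreover have "closed (K \<inter> f n -` {c})" for n c
  proof -
    have "K \<inter> f n -` {c} = K \<inter> L n c"
    proof (intro equalityI subsetI)
      fix x assume x: "x \<in> K \<inter> f n -` {c}"
      then obtain c' where c': "x \<in> L n c'" unfolding K_def by blast
      then have "f n x = c'" using L(2)[of n c'] by blast
      then show "x \<in> K \<inter> L n c" using x c' by auto
    qed (use L(2)[of n c] in blast)
    then show ?thesis
      using closed_Int[OF compact_imp_closed[OF \<open>compact K\<close>] compact_imp_closed[OF L(1)[of n c]]] by simp
  qed
  moreover have "measure M K > 1 / 2"
  proof -
    have setsL: "L n c \<in> sets M" for n c using L(1) sets by (auto intro: borel_compact)
    define D where "D n = (\<Union>c\<in>range (f n). f n -` {c} - L n c)" for n
    have D: "D n \<in> sets M" for n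
      unfolding D_def using fin by (intro sets.finite_UN sets.Diff fs setsL) auto
    have mD: "measure M (D n) \<le> (1/2) ^ (n + 3)" for n
    proof -
      have "measure M (D n) \<le> (\<Sum>c\<in>range (f n). measure M (f n -` {c} - L n c))"
        unfolding D_def using fin fs setsL by (intro finite_measure_subadditive_finite) auto
      also have "\<dots> \<le> (\<Sum>c\<in>range (f n). e n)" using L(3) by (intro sum_mono less_imp_le)
      also have "\<dots> \<le> (1/2) ^ (n + 3)" by (simp add: e_def pos_divide_le_eq algebra_simps)
      finally show ?thesis .
    qed
    have sums: "(\<lambda>n. (1/2) ^ (n + 3) :: real) sums (1/4)"
      using sums_mult2[OF geometric_sums[of "1/2::real"], of "(1/2)^3"] by (simp add: power_add power3_eq_cube)
    have summ: "summable (\<lambda>n. measure M (D n))"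
      by (rule summable_comparison_test'[OF sums_summable[OF sums], of 0]) (use mD in auto)
    have "measure M (\<Union>n. D n) \<le> (\<Sum>n. measure M (D n))"
      using D summ by (intro finite_measure_subadditive_countably) auto
    also have "\<dots> \<le> 1 / 4"
      using suminf_le[OF mD summ sums_summable[OF sums]] sums_unique[OF sums] by simp
    finally have mDU: "measure M (\<Union>n. D n) \<le> 1 / 4" .
    have "UNIV - K \<subseteq> N \<union> (UNIV - N - K0) \<union> (\<Union>n. D n)"
    proof
      fix x assume "x \<in> UNIV - K"
      then consider "x \<notin> K0" | n where "x \<notin> (\<Union>c\<in>range (f n). L n c)" unfolding K_def by blast
      then show "x \<in> N \<union> (UNIV - N - K0) \<union> (\<Union>n. D n)"
      proof cases
        case 2
        then have "x \<in> f n -` {f n x} - L n (f n x)" by auto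
        then have "x \<in> D n" unfolding D_def by blast
        then show ?thesis by blast
      qed blast
    qed
    then have "measure M (UNIV - K) \<le> measure M (N \<union> (UNIV - N - K0) \<union> (\<Union>n. D n))"
      using N K0 D sets N1 by (intro finite_measure_mono sets.Un sets.countable_UN sets.Diff) (auto intro: borel_compact)
    also have "\<dots> \<le> measure M (N \<union> (UNIV - N - K0)) + measure M (\<Union>n. D n)"
      using N K0 D sets N1 by (intro measure_Un_le sets.Un sets.countable_UN sets.Diff) (auto intro: borel_compact)
    also have "\<dots> \<le> measure M N + measure M (UNIV - N - K0) + measure M (\<Union>n. D n)"
      using N K0 sets N1 by (intro add_right_mono measure_Un_le sets.Diff) (auto intro: borel_compact)
    also have "\<dots> < 1 / 2" using N(2) K0(3) mDU by (simp add: emeasure_eq_measure)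
    finally show ?thesis
      using prob_compl[of K] \<open>compact K\<close> sets sp by (auto dest: borel_compact)
  qed
  ultimately show thesis using that by blast
qed

text \<open>
  The pairs of points with the same first observations, taken in compact sets on which all
  observations are locally constant, form a decreasing sequence of nonempty compact sets.
\<close>

lemma realise_same_observations:
  fixes M1 :: "'x::polish_space measure" and M2 :: "'y::polish_space measure"
    and f :: "nat \<Rightarrow> 'x \<Rightarrow> 'c" and g :: "nat \<Rightarrow> 'y \<Rightarrow> 'c"
  assumes M1: "prob_space M1" "sets M1 = sets borel"
    "\<And>n. f n \<in> measurable M1 (count_space UNIV)" "\<And>n. finite (range (f n))" "AE x in M1. Q1 x"
    and M2: "prob_space M2" "sets M2 = sets borel"
    "\<And>n. g n \<in> measurable M2 (count_space UNIV)" "\<And>n. finite (range (g n))" "AE y in M2. Q2 y"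
    and law: "\<And>n. distr M1 (count_space UNIV) (f n) = distr M2 (count_space UNIV) (g n)"
    and refine: "\<And>m n x y. m \<le> n \<Longrightarrow> f n x = g n y \<Longrightarrow> f m x = g m y"
  obtains x y where "Q1 x" "Q2 y" "\<And>n. f n x = g n y"
proof -
  interpret M1: prob_space M1 by fact
  interpret M2: prob_space M2 by fact
  have sp: "space M1 = UNIV" "space M2 = UNIV"
    using sets_eq_imp_space_eq[OF M1(2)] sets_eq_imp_space_eq[OF M2(2)] by auto
  obtain K where K: "compact K" "\<And>x. x \<in> K \<Longrightarrow> Q1 x" "measure M1 K > 1 / 2"
    "\<And>n c. closed (K \<inter> f n -` {c})" by (rule compact_locally_constant[where f = f, OF M1]) blast
  obtain L where L: "compact L" "\<And>x. x \<in> L \<Longrightarrow> Q2 x" "measure M2 L > 1 / 2"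
    "\<And>n c. closed (L \<inter> g n -` {c})" by (rule compact_locally_constant[where f = g, OF M2]) blast
  define D where "D n = {(x, y). x \<in> K \<and> y \<in> L \<and> f n x = g n y}" for n
  have cl: "closed (D n)" for n
  proof -
    have "D n = (\<Union>c\<in>range (f n). (K \<inter> f n -` {c}) \<times> (L \<inter> g n -` {c}))"
      by (auto simp: D_def)
    then show ?thesis by (simp only:) (intro closed_UN M1(4) ballI closed_Times K(4) L(4))
  qed
  \<comment> \<open>If \<open>D n\<close> were empty, K would miss the set of points whose
    observation occurs on L. By equality of the laws this set has at least the mass of L, so two
    disjoint sets would have mass above 1/2 each.\<close>
  have ne: "D n \<noteq> {}" for n
  proof
    assume "D n = {}"
    then have disj: "K \<inter> f n -` (g n ` L) = {}" by (auto simp: D_def)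
    have ms: "f n -` C \<in> sets M1" "g n -` C \<in> sets M2" for C
      using measurable_sets[OF M1(3), of C n] measurable_sets[OF M2(3), of C n] sp by auto
    have "emeasure (distr M1 (count_space UNIV) (f n)) (g n ` L) = emeasure (distr M2 (count_space UNIV) (g n)) (g n ` L)"
      by (simp add: law)
    then have "measure M1 (f n -` (g n ` L)) = measure M2 (g n -` (g n ` L))"
      using M1(3) M2(3) sp by (simp add: emeasure_distr M1.emeasure_eq_measure M2.emeasure_eq_measure)
    moreover have "measure M2 L \<le> measure M2 (g n -` (g n ` L))"
      using ms by (intro M2.finite_measure_mono) auto
    moreover have "measure M1 (K \<union> f n -` (g n ` L)) = measure M1 K + measure M1 (f n -` (g n ` L))"
      using ms disj K(1) M1(2) by (intro M1.finite_measure_Union) (auto intro: borel_compact)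
    ultimately show False using K(3) L(3) M1.prob_le_1[of "K \<union> f n -` (g n ` L)"] by linarith
  qed
  have mono: "D n \<subseteq> D m" if "m \<le> n" for m n
    using refine[OF that] by (auto simp: D_def)
  have "(K \<times> L) \<inter> \<Inter>(range D) \<noteq> {}"
  proof (rule compact_imp_fip)
    show "compact (K \<times> L)" using K(1) L(1) by (rule compact_Times)
    show "closed T" if "T \<in> range D" for T using that cl by auto
    fix F assume "finite F" "F \<subseteq> range D"
    then obtain I where I: "finite I" "F = D ` I" by (meson finite_subset_image)
    have "D (Max (insert 0 I)) \<subseteq> D i" if "i \<in> I" for i
      using I(1) that by (intro mono) simp
    then have "D (Max (insert 0 I)) \<subseteq> \<Inter>F" unfolding I(2) by blast
    moreover have "D (Max (insert 0 I)) \<subseteq> K \<times> L" by (auto simp: D_def)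
    ultimately show "(K \<times> L) \<inter> \<Inter>F \<noteq> {}" using ne[of "Max (insert 0 I)"] by blast
  qed
  then obtain x y where xy: "x \<in> K" "y \<in> L" "\<And>n. (x, y) \<in> D n" by auto
  have "f n x = g n y" for n using xy(3)[of n] by (simp add: D_def)
  then show thesis by (rule that[OF K(2)[OF xy(1)] L(2)[OF xy(2)]])
qed

section \<open>Almost sure properties of i.i.d. sequences\<close>

lemma indep_vars_coordinates:
  assumes "prob_space p"
  shows "prob_space.indep_vars (\<Pi>\<^sub>M i\<in>(UNIV :: nat set). p) (\<lambda>_. p) (\<lambda>i X. X i) UNIV"
proof -
  interpret prob_space "\<Pi>\<^sub>M i\<in>(UNIV :: nat set). p" using assms by (intro prob_space_PiM)
  have "(\<Pi>\<^sub>M i\<in>(UNIV :: nat set). distr (\<Pi>\<^sub>M i\<in>(UNIV :: nat set). p) p (\<lambda>X. X i)) = (\<Pi>\<^sub>M i\<in>UNIV. p)"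
    using assms by (intro PiM_cong refl distr_PiM_component) auto
  moreover have "distr (\<Pi>\<^sub>M i\<in>(UNIV :: nat set). p) (\<Pi>\<^sub>M i\<in>UNIV. p) (\<lambda>X. \<lambda>i\<in>UNIV. X i) = (\<Pi>\<^sub>M i\<in>UNIV. p)"
    by (simp add: restrict_UNIV)
  ultimately show ?thesis
    by (subst indep_vars_iff_distr_eq_PiM') auto
qed

text \<open>Hoeffding's inequality bounds the probability of a deviation e after n samples by
  \<open>2 * exp (-2 * e\<^sup>2) ^ n\<close>. This is summable in n, so Borel-Cantelli gives
  convergence through the countably many e of the form 1/(j+1).\<close>

lemma AE_frequency:
  fixes p :: "'x measure"
  assumes "prob_space p" and A: "A \<in> sets p"
  shows "AE X in (\<Pi>\<^sub>M i\<in>(UNIV :: nat set). p).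
    (\<lambda>n. real (card {k \<in> {1..n}. X k \<in> A}) / real n) \<longlonglongrightarrow> measure p A"
proof -
  let ?P = "\<Pi>\<^sub>M i\<in>(UNIV :: nat set). p"
  interpret p: prob_space p by fact
  interpret prob_space ?P using assms by (intro prob_space_PiM)
  have ind[measurable]: "(\<lambda>X. indicator A (X k) :: real) \<in> borel_measurable ?P" for k
    using A by measurable
  have E: "expectation (\<lambda>X. indicator A (X k) :: real) = measure p A" for k
  proof -
    have "measure p A = measure (distr ?P p (\<lambda>X. X k)) A"
      using assms by (subst distr_PiM_component) auto
    also have "\<dots> = measure ?P ((\<lambda>X. X k) -` A \<inter> space ?P)"
      using A by (intro measure_distr) auto
    also have "\<dots> = expectation (indicator ((\<lambda>X. X k) -` A \<inter> space ?P))"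
      by simp
    also have "\<dots> = expectation (\<lambda>X. indicator A (X k))"
      by (intro Bochner_Integration.integral_cong) (auto simp: indicator_def)
    finally show ?thesis by simp
  qed
  have sum_eq: "(\<Sum>k\<in>{1..n}. indicator A (X k) :: real) = real (card {k \<in> {1..n}. X k \<in> A})" for n and X :: "nat \<Rightarrow> 'x"
    unfolding indicator_def of_bool_def by (subst sum.inter_filter[symmetric]) simp_all
  have tail: "prob {X \<in> space ?P. \<bar>(\<Sum>k\<in>{1..n}. indicator A (X k)) - n * measure p A\<bar> \<ge> n * e}
      \<le> 2 * exp (-2 * e\<^sup>2) ^ n" if n: "n \<ge> 1" and e: "e > 0" for n e
  proof -
    interpret H: Hoeffding_ineq ?P "{1..n}" "\<lambda>k X. indicator A (X k)" "\<lambda>_. 0" "\<lambda>_. 1" "n * measure p A"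
    proof unfold_locales
      show "indep_vars (\<lambda>_. borel) (\<lambda>k X. indicator A (X k) :: real) {1..n}"
        by (rule indep_vars_compose2[where Y = "\<lambda>_. indicator A",
              OF indep_vars_subset[OF indep_vars_coordinates[OF assms(1)] subset_UNIV]]) (use A in simp)
      show "n * measure p A \<equiv> \<Sum>k\<in>{1..n}. expectation (\<lambda>X. indicator A (X k))"
        using E by (simp add: atomize_eq)
    qed (auto simp: indicator_def)
    have "prob {X \<in> space ?P. \<bar>(\<Sum>k\<in>{1..n}. indicator A (X k)) - n * measure p A\<bar> \<ge> n * e}
      \<le> 2 * exp (-2 * (n * e)\<^sup>2 / (\<Sum>k\<in>{1..n}. (1 - 0)\<^sup>2))"
      using n e by (intro H.Hoeffding_ineq_abs_ge) auto
    also have "-2 * (n * e)\<^sup>2 / (\<Sum>k\<in>{1..n}. (1 - 0)\<^sup>2) = n * (-2 * e\<^sup>2)"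
      using n by (simp add: power2_eq_square)
    finally show ?thesis by (simp only: exp_of_nat_mult)
  qed
  have "AE X in ?P. \<forall>\<^sub>F n in sequentially. X \<in> space ?P -
      {X \<in> space ?P. \<bar>(\<Sum>k\<in>{1..n}. indicator A (X k)) - n * measure p A\<bar> \<ge> n * inverse (real (Suc j))}" for j
  proof (rule borel_cantelli_AE1)
    let ?B = "\<lambda>n. {X \<in> space ?P. \<bar>(\<Sum>k\<in>{1..n}. indicator A (X k)) - n * measure p A\<bar> \<ge> n * inverse (real (Suc j))}"
    show "?B n \<in> sets ?P" for n by measurable
    show "emeasure ?P (?B n) < \<infinity>" for n by (simp add: emeasure_eq_measure)
    have "summable (\<lambda>n. 2 * exp (-2 * (inverse (real (Suc j)))\<^sup>2) ^ n)"
      by (intro summable_mult summable_geometric) auto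
    then show "summable (\<lambda>n. prob (?B n))"
      by (rule summable_comparison_test'[where N = 1]) (use tail in auto)
  qed
  then have "AE X in ?P. \<forall>j. \<forall>\<^sub>F n in sequentially. X \<in> space ?P -
      {X \<in> space ?P. \<bar>(\<Sum>k\<in>{1..n}. indicator A (X k)) - n * measure p A\<bar> \<ge> n * inverse (real (Suc j))}"
    by (intro AE_all_countable[THEN iffD2] allI)
  then show ?thesis
  proof eventually_elim
    case (elim X)
    show ?case
    proof (rule LIMSEQ_I)
      fix e :: real assume "0 < e"
      then obtain j where j: "inverse (real (Suc j)) < e" using reals_Archimedean by blast
      from elim[rule_format, of j] have "\<forall>\<^sub>F n in sequentially.
          norm (real (card {k \<in> {1..n}. X k \<in> A}) / real n - measure p A) < e"
        using eventually_ge_at_top[of 1]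
      proof eventually_elim
        case (elim n)
        then have "\<bar>real (card {k \<in> {1..n}. X k \<in> A}) - n * measure p A\<bar> < n * inverse (real (Suc j))"
          unfolding sum_eq by auto
        also have "\<dots> < n * e" using j elim by simp
        finally have "\<bar>real (card {k \<in> {1..n}. X k \<in> A}) - n * measure p A\<bar> / n < e"
          using elim by (simp add: field_simps)
        moreover have "real (card {k \<in> {1..n}. X k \<in> A}) / real n - measure p A =
            (real (card {k \<in> {1..n}. X k \<in> A}) - n * measure p A) / n"
          using elim by (simp add: field_simps)
        ultimately show ?case by (simp add: abs_divide)
      qed
      then show "\<exists>n0. \<forall>n\<ge>n0. norm (real (card {k \<in> {1..n}. X k \<in> A}) / real n - measure p A) < e"
        by (simp add: eventually_sequentially)
    qed
  qed
qed

text \<open>If x is no atom, a second sample differs from x almost surely, and Fubini's theorem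
  settles the pair. Coincidence is written as distance 0, which makes it a measurable event.\<close>

lemma AE_coincidence_atom:
  fixes p :: "'x::polish_space measure"
  assumes "prob_space p" "sets p = sets borel" "i \<noteq> j"
  shows "AE X in (\<Pi>\<^sub>M i\<in>(UNIV :: nat set). p). X i = X j \<longrightarrow> measure p {X i} > 0"
proof -
  let ?P = "\<Pi>\<^sub>M i\<in>(UNIV :: nat set). p"
  interpret p: prob_space p by fact
  interpret prob_space ?P using assms by (intro prob_space_PiM)
  interpret pp: pair_prob_space p p ..
  interpret pr: product_prob_space "\<lambda>_. p" "UNIV :: nat set" ..
  have eq: "p \<Otimes>\<^sub>M p = distr ?P (p \<Otimes>\<^sub>M p) (\<lambda>X. (X i, X j))"
  proof (rule pair_measure_eqI)
    fix A B assume AB: "A \<in> sets p" "B \<in> sets p"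
    have "emeasure (distr ?P (p \<Otimes>\<^sub>M p) (\<lambda>X. (X i, X j))) (A \<times> B) =
        emeasure ?P ((\<lambda>X. (X i, X j)) -` (A \<times> B) \<inter> space ?P)"
      using AB by (intro emeasure_distr) auto
    also have "(\<lambda>X. (X i, X j)) -` (A \<times> B) \<inter> space ?P =
        {X \<in> space ?P. \<forall>k\<in>{i, j}. X k \<in> (if k = i then A else B)}"
      using assms(3) by auto
    also have "emeasure ?P \<dots> = (\<Prod>k\<in>{i, j}. emeasure p (if k = i then A else B))"
      using AB by (intro pr.emeasure_PiM_Collect) auto
    also have "\<dots> = emeasure p A * emeasure p B" using assms(3) by simp
    finally show "emeasure p A * emeasure p B =
        emeasure (distr ?P (p \<Otimes>\<^sub>M p) (\<lambda>X. (X i, X j))) (A \<times> B)" by simp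
  qed (auto intro: p.sigma_finite_measure_axioms)
  define A where "A = {x. measure p {x} > 0}"
  have "countable A"
    by (rule countable_subset[OF _ p.countable_support]) (auto simp: A_def)
  then have A: "A \<in> sets p" by (rule sets.countable[rotated]) (simp add: assms(2))
  have s1: "(\<lambda>z. fst z) \<in> borel_measurable (p \<Otimes>\<^sub>M p)" "(\<lambda>z. snd z) \<in> borel_measurable (p \<Otimes>\<^sub>M p)"
    using measurable_fst[of p p] measurable_snd[of p p] measurable_cong_sets[OF refl assms(2)] by auto
  have d: "(\<lambda>z. dist (fst z) (snd z)) \<in> borel_measurable (p \<Otimes>\<^sub>M p)"
    by (intro borel_measurable_dist s1)
  have "{z \<in> space (p \<Otimes>\<^sub>M p). dist (fst z) (snd z) = 0 \<longrightarrow> fst z \<in> A} \<in> sets (p \<Otimes>\<^sub>M p)"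
    using d A by measurable
  moreover have "AE x in p. AE y in p. dist (fst (x, y)) (snd (x, y)) = 0 \<longrightarrow> fst (x, y) \<in> A"
  proof (rule AE_I2)
    fix x
    show "AE y in p. dist (fst (x, y)) (snd (x, y)) = 0 \<longrightarrow> fst (x, y) \<in> A"
    proof (cases "x \<in> A")
      case False
      then have "measure p {x} = 0" by (simp add: A_def zero_less_measure_iff)
      moreover have "{x} \<in> sets p" unfolding assms(2) by simp
      ultimately have "{x} \<in> null_sets p" by (intro null_setsI) (simp_all only: p.emeasure_eq_measure ennreal_0)
      then have "AE y in p. y \<notin> {x}" by (rule AE_not_in)
      then show ?thesis by eventually_elim auto
    qed (auto intro: AE_I2)
  qed
  ultimately have "AE z in p \<Otimes>\<^sub>M p. dist (fst z) (snd z) = 0 \<longrightarrow> fst z \<in> A"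
    by (rule pp.AE_pair_measure)
  then have "AE z in distr ?P (p \<Otimes>\<^sub>M p) (\<lambda>X. (X i, X j)). dist (fst z) (snd z) = 0 \<longrightarrow> fst z \<in> A"
    by (simp only: eq[symmetric])
  then have "AE X in ?P. dist (fst (X i, X j)) (snd (X i, X j)) = 0 \<longrightarrow> fst (X i, X j) \<in> A"
    by (rule AE_distrD[rotated]) auto
  then show ?thesis by (simp add: A_def)
qed

section \<open>Equal laws imply mass-structural equivalence\<close>

lemma infinite_of_frequency:
  assumes "(\<lambda>n. real (card {k. k < n \<and> Q k}) / real n) \<longlonglongrightarrow> c" "c > 0"
  shows "infinite {k. Q k}"
proof
  assume fin: "finite {k. Q k}"
  have "(\<lambda>n. real (card {k. Q k}) / real n) \<longlonglongrightarrow> 0"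
    by (rule lim_const_over_n)
  moreover have "real (card {k. k < n \<and> Q k}) / real n \<le> real (card {k. Q k}) / real n" for n
    using fin by (intro divide_right_mono) (auto intro: card_mono)
  ultimately have "c \<le> 0" using assms(1) by (intro LIMSEQ_le) auto
  then show False using assms(2) by simp
qed

section \<open>Generic samples and the index sets of special points\<close>

context weighted_tree
begin

text \<open>Density in the support lets samples replace arbitrary points of the span. The
  frequencies return the masses, avoiding the special points of mass 0 makes the approach to such a
  leaf strict, and the last condition lets an atom be recognised from two equal samples.\<close>

definition generic :: "(nat \<Rightarrow> 'a) \<Rightarrow> bool" where
  "generic X \<longleftrightarrow>
     (\<forall>k. X k \<in> supp) \<and>
     (\<forall>U s. open U \<and> s \<in> U \<and> s \<in> supp \<longrightarrow> infinite {k. X k \<in> U}) \<and>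
     (\<forall>s\<in>S. \<forall>A\<in>{fringe r s, segment r s, {s}}.
        (\<lambda>n. real (card {k. k < n \<and> X k \<in> A}) / real n) \<longlonglongrightarrow> measure p A) \<and>
     (\<forall>s\<in>S. measure p {s} = 0 \<longrightarrow> (\<forall>k. X k \<noteq> s)) \<and>
     (\<forall>i j. i \<noteq> j \<longrightarrow> X i = X j \<longrightarrow> measure p {X i} > 0)"

text \<open>Density in the support is derived from the frequencies of the sets of a countable base,
  and the conditions at special points are countably many by \<open>countable_special\<close>. The
  shift by \<open>Suc\<close> matches the sampling indices, which start at 1.\<close>

lemma AE_generic: "AE X in P. generic (\<lambda>k. X (Suc k))"
proof -
  obtain \<B> :: "'a set set" where \<B>: "countable \<B>" "topological_basis \<B>"
    using ex_countable_basis by blast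
  have freq: "AE X in P. (\<lambda>n. real (card {k. k < n \<and> X (Suc k) \<in> A}) / real n) \<longlonglongrightarrow> measure p A"
    if "A \<in> sets p" for A
  proof -
    have "{k \<in> {1..n}. X k \<in> A} = Suc ` {k. k < n \<and> X (Suc k) \<in> A}" for n and X :: "nat \<Rightarrow> 'a"
    proof (intro equalityI subsetI)
      fix k assume "k \<in> {k \<in> {1..n}. X k \<in> A}"
      then show "k \<in> Suc ` {k. k < n \<and> X (Suc k) \<in> A}" by (cases k) auto
    qed auto
    then have "card {k \<in> {1..n}. X k \<in> A} = card {k. k < n \<and> X (Suc k) \<in> A}" for n and X :: "nat \<Rightarrow> 'a"
      by (simp add: card_image)
    then show ?thesis using AE_frequency[OF prob that] by simp
  qed
  have 1: "AE X in P. \<forall>k. X (Suc k) \<in> supp"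
    by (intro AE_all_countable[THEN iffD2] allI AE_PiM_component[OF prob UNIV_I AE_supp])
  have 2: "AE X in P. \<forall>U\<in>\<B>. (\<lambda>n. real (card {k. k < n \<and> X (Suc k) \<in> U}) / real n) \<longlonglongrightarrow> measure p U"
    using \<B> by (intro AE_ball_countable[THEN iffD2] ballI freq)
      (auto simp: sets_p intro: borel_open topological_basis_open)
  have 3: "AE X in P. \<forall>s\<in>S. \<forall>A\<in>{fringe r s, segment r s, {s}}.
      (\<lambda>n. real (card {k. k < n \<and> X (Suc k) \<in> A}) / real n) \<longlonglongrightarrow> measure p A"
    by (intro AE_ball_countable[THEN iffD2] ballI freq countable_special) auto
  have 4: "AE X in P. \<forall>s\<in>S. measure p {s} = 0 \<longrightarrow> (\<forall>k. X (Suc k) \<noteq> s)"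
  proof (intro AE_ball_countable[THEN iffD2] ballI countable_special)
    fix s assume "s \<in> S"
    show "AE X in P. measure p {s} = 0 \<longrightarrow> (\<forall>k. X (Suc k) \<noteq> s)"
    proof (cases "measure p {s} = 0")
      case True
      then have "{s} \<in> null_sets p" by (intro null_setsI) (simp_all add: emeasure_eq_measure)
      then have "AE x in p. x \<notin> {s}" by (rule AE_not_in)
      then have "AE x in p. x \<noteq> s" by simp
      then have "AE X in P. \<forall>k. X (Suc k) \<noteq> s"
        by (intro AE_all_countable[THEN iffD2] allI AE_PiM_component[OF prob UNIV_I])
      then show ?thesis by simp
    qed simp
  qed
  have 5: "AE X in P. \<forall>i j. i \<noteq> j \<longrightarrow> X (Suc i) = X (Suc j) \<longrightarrow> measure p {X (Suc i)} > 0"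
  proof (intro AE_all_countable[THEN iffD2] allI)
    fix i j :: nat
    show "AE X in P. i \<noteq> j \<longrightarrow> X (Suc i) = X (Suc j) \<longrightarrow> measure p {X (Suc i)} > 0"
      using AE_coincidence_atom[OF prob sets_p, of "Suc i" "Suc j"] by (cases "i = j") auto
  qed
  from 1 2 3 4 5 show ?thesis
  proof eventually_elim
    case (elim X)
    have "infinite {k. X (Suc k) \<in> U}" if U: "open U" "s \<in> U" "s \<in> supp" for U s
    proof -
      obtain V where V: "V \<in> \<B>" "s \<in> V" "V \<subseteq> U" using topological_basisE[OF \<B>(2) U(1,2)] by blast
      then have "measure p V > 0"
        using open_supp_pos[of V s] U(3) topological_basis_open[OF \<B>(2)] by blast
      then have "infinite {k. X (Suc k) \<in> V}" using elim(2) V(1) by (intro infinite_of_frequency[of "\<lambda>k. X (Suc k) \<in> V" "measure p V"]) auto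
      moreover have "{k. X (Suc k) \<in> V} \<subseteq> {k. X (Suc k) \<in> U}" using V(3) by blast
      ultimately show ?thesis using finite_subset by blast
    qed
    then show ?case unfolding generic_def using elim by blast
  qed
qed

end

locale generic_sample = weighted_tree +
  fixes X :: "nat \<Rightarrow> 'a"
  assumes generic: "generic X"
begin

definition samples_above where "samples_above x = {i. x \<sqsubseteq> X i}"
definition samples_below where "samples_below x = {i. X i \<sqsubseteq> x}"

lemma X_supp: "X k \<in> supp" and X_Span [simp]: "X k \<in> Sp"
  using generic supp_subset_Span unfolding generic_def by blast+

lemma coincidence_atom: "i \<noteq> j \<Longrightarrow> X i = X j \<Longrightarrow> measure p {X i} > 0"
  using generic unfolding generic_def by blast

lemma special_null_not_hit: "s \<in> S \<Longrightarrow> measure p {s} = 0 \<Longrightarrow> X k \<noteq> s"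
  using generic unfolding generic_def by blast

lemma frequency:
  assumes "s \<in> S"
  shows "(\<lambda>n. real (card {k. k < n \<and> k \<in> samples_above s}) / real n) \<longlonglongrightarrow> measure p (fringe r s)"
    and "(\<lambda>n. real (card {k. k < n \<and> k \<in> samples_below s}) / real n) \<longlonglongrightarrow> measure p (segment r s)"
    and "(\<lambda>n. real (card {k. k < n \<and> k \<in> samples_above s \<inter> samples_below s}) / real n) \<longlonglongrightarrow> measure p {s}"
proof -
  have *: "(\<lambda>n. real (card {k. k < n \<and> X k \<in> A}) / real n) \<longlonglongrightarrow> measure p A"
    if "A \<in> {fringe r s, segment r s, {s}}" for A
    using generic assms that unfolding generic_def by blast
  show "(\<lambda>n. real (card {k. k < n \<and> k \<in> samples_above s}) / real n) \<longlonglongrightarrow> measure p (fringe r s)"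
    "(\<lambda>n. real (card {k. k < n \<and> k \<in> samples_below s}) / real n) \<longlonglongrightarrow> measure p (segment r s)"
    using *[of "fringe r s"] *[of "segment r s"]
    by (simp_all add: samples_above_def samples_below_def fringe_def)
  have "k \<in> samples_above s \<inter> samples_below s \<longleftrightarrow> X k \<in> {s}" for k
    using le_antisym by (auto simp: samples_above_def samples_below_def)
  then show "(\<lambda>n. real (card {k. k < n \<and> k \<in> samples_above s \<inter> samples_below s}) / real n) \<longlonglongrightarrow> measure p {s}"
    using *[of "{s}"] by (simp only: insert_iff simp_thms)
qed

text \<open>A point of the support above u belongs to the open set of points whose path from the
  root follows that to u beyond the height of z. Infinitely many samples fall into this set, so a
  prescribed index i can be avoided.\<close>

lemma hit_above:
  assumes "u \<in> Sp" "z \<sqsubset> u"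
  obtains k where "k \<noteq> i" "z \<sqsubset> meet u (X k)" "dist r z < gp u (X k)"
proof -
  obtain s where s: "s \<in> supp" "u \<sqsubseteq> s" "dist r z < gp u s"
    using supp_above[OF assms(1) lt_height[OF assms(2)]] by blast
  have "infinite {k. X k \<in> {y. dist r z < gp u y}}"
    using generic open_gp s unfolding generic_def by blast
  then obtain k where "k \<in> {k. X k \<in> {y. dist r z < gp u y}}" "k \<noteq> i"
    by (metis (mono_tags, lifting) finite.emptyI finite_insert infinite_super singletonI subsetI insertI1)
  then show thesis using that less_gpD assms(2) by blast
qed

text \<open>The triple that would state this directly has equal first indices and is not observed.
  It is recovered because \<open>X k\<close> is approached by its meets with the other
  samples.\<close>

lemma sample_le_iff:
  assumes "k \<noteq> i"
  shows "X k \<sqsubseteq> X i \<longleftrightarrow> (\<forall>l. l \<noteq> k \<longrightarrow> meet (X k) (X l) \<sqsubseteq> X i)"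
proof
  assume "X k \<sqsubseteq> X i"
  then show "\<forall>l. l \<noteq> k \<longrightarrow> meet (X k) (X l) \<sqsubseteq> X i" using le_trans meet_le1 by blast
next
  assume *: "\<forall>l. l \<noteq> k \<longrightarrow> meet (X k) (X l) \<sqsubseteq> X i"
  show "X k \<sqsubseteq> X i"
  proof (rule ccontr)
    assume "\<not> X k \<sqsubseteq> X i"
    then have "meet (X k) (X i) \<sqsubset> X k" using meet_le1 meet_le2[of "X k" "X i"] by metis
    then obtain l where "l \<noteq> k" "dist r (meet (X k) (X i)) < gp (X k) (X l)"
      using hit_above[OF X_Span] by blast
    then show False using *[rule_format, of l] by (simp add: meet_le_iff_gp gp_eq)
  qed
qed

lemma atom_hit: assumes "measure p {x} > 0" shows "infinite {k. X k = x}"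
proof -
  have "infinite {k. k \<in> samples_above x \<inter> samples_below x}"
    using infinite_of_frequency[OF frequency(3)[OF atom_special[OF assms]]] assms by simp
  moreover have "{k. k \<in> samples_above x \<inter> samples_below x} \<subseteq> {k. X k = x}"
    using le_antisym by (auto simp: samples_above_def samples_below_def)
  ultimately show ?thesis using finite_subset by blast
qed

lemma atom_hit_other:
  assumes "measure p {x} > 0"
  obtains k where "k \<noteq> i" "X k = x"
proof -
  have "infinite ({k. X k = x} - {i})" using atom_hit[OF assms] by simp
  then have "{k. X k = x} - {i} \<noteq> {}" by (rule infinite_imp_nonempty)
  then show thesis using that by blast
qed

lemma branch_hit:
  assumes "u \<in> Sp" "v \<in> Sp" "x \<sqsubset> u" "x \<sqsubset> v" "meet u v = x"
  obtains i j where "i \<noteq> j" "meet (X i) (X j) = x" "x \<sqsubset> X i" "x \<sqsubset> X j"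
proof -
  obtain i where i: "x \<sqsubset> meet u (X i)" using hit_above assms by metis
  obtain j where j: "j \<noteq> i" "x \<sqsubset> meet v (X j)" using hit_above assms by metis
  have m: "meet (X i) (X j) = x" using meet_of_branches assms(5) i j(2) by blast
  have "x \<noteq> X i" "x \<noteq> X j" using i j(2) le_antisym meet_le2 by (metis le_meet_iff)+
  moreover have "x \<sqsubseteq> X i" "x \<sqsubseteq> X j" using m meet_le1 meet_le2 by blast+
  ultimately show thesis using that[of i j] j(1) m by auto
qed

text \<open>An atom carries a sample; of the two samples that meet in a branch point x at most one
  lies above x'; above an isolated leaf there is no x' at all.\<close>

lemma samples_strictly_above:
  assumes "x \<in> S" "x' \<in> Sp" "x \<sqsubset> x'"
  obtains i where "x \<sqsubseteq> X i" "\<not> x' \<sqsubseteq> X i"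
  using assms(1)
proof (cases rule: special_cases)
  case atom
  then obtain i where "X i = x" by (rule atom_hit_other)
  then show thesis using that[of i] assms(3) le_antisym by auto
next
  case (branch u v)
  then obtain i j where "meet (X i) (X j) = x" by (rule branch_hit)
  then have ij: "x \<sqsubseteq> X i" "x \<sqsubseteq> X j" "\<not> (x' \<sqsubseteq> X i \<and> x' \<sqsubseteq> X j)"
    using assms(3) le_antisym le_meet_iff[of x' "X i" "X j"] by auto
  then show thesis using that by blast
next
  case (leaf z)
  then have "x' \<sqsubseteq> x" using assms le_trans by blast
  then show thesis using assms(3) le_antisym by blast
qed

text \<open>An atom carries a sample itself and a branch point lies below two, so an isolated leaf
  is left.\<close>

lemma special_without_samples_above:
  assumes "x \<in> S" "samples_above x = {}"
  obtains z where "z \<sqsubset> x" "\<And>y. y \<in> Sp \<Longrightarrow> z \<sqsubseteq> y \<Longrightarrow> y \<sqsubseteq> x"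
  using assms(1)
proof (cases rule: special_cases)
  case atom
  then obtain i where "X i = x" by (rule atom_hit_other)
  then have "i \<in> samples_above x" by (simp add: samples_above_def)
  then show thesis using assms(2) by simp
next
  case (branch u v)
  then obtain i j where "x \<sqsubset> X i" by (rule branch_hit)
  then show thesis using assms(2) by (auto simp: samples_above_def)
next
  case (leaf z)
  then show thesis using that by blast
qed

text \<open>If samples lie above x, then x and x' lie below a common sample, hence are comparable,
  and a strict inequality would be seen by \<open>samples_strictly_above\<close>. Otherwise both are
  isolated leaves: a sample close to one of them lies below the other, which puts each of them below
  the other.\<close>

lemma special_eqI:
  assumes x: "x \<in> S" "x' \<in> S" and above: "samples_above x = samples_above x'"
    and below: "samples_below x = samples_below x'"
  shows "x = x'"
proof (cases "samples_above x = {}")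
  case True
  have *: "x' \<sqsubseteq> x" if x: "x \<in> S" "x' \<in> S" and e: "samples_above x = {}"
    and b: "samples_below x = samples_below x'" for x x'
  proof -
    obtain z where z: "z \<sqsubset> x" "\<And>y. y \<in> Sp \<Longrightarrow> z \<sqsubseteq> y \<Longrightarrow> y \<sqsubseteq> x"
      using special_without_samples_above[OF x(1) e] by blast
    obtain k where k: "z \<sqsubset> meet x (X k)"
      using hit_above[OF special_in_Span[OF x(1)] z(1)] by metis
    then have "z \<sqsubseteq> X k" by simp
    then have "X k \<sqsubseteq> x" by (rule z(2)[OF X_Span])
    then have "X k \<sqsubseteq> x'" using b by (auto simp: samples_below_def)
    then show ?thesis using z(2)[OF special_in_Span[OF x(2)]] \<open>z \<sqsubseteq> X k\<close> le_trans by blast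
  qed
  show ?thesis using *[of x x'] *[of x' x] x above below True le_antisym by simp
next
  case False
  then obtain i where "x \<sqsubseteq> X i" "x' \<sqsubseteq> X i" using above by (auto simp: samples_above_def)
  then have "x \<sqsubseteq> x' \<or> x' \<sqsubseteq> x" by (rule le_linear)
  moreover have False if "x \<in> S" "x' \<in> S" "x \<sqsubset> x'" "samples_above x = samples_above x'" for x x'
    using samples_strictly_above[OF that(1) special_in_Span[OF that(2)] that(3)] that(4)
    unfolding samples_above_def by blast
  ultimately show ?thesis using x above by metis
qed

text \<open>Apart from equality, which \<open>special_eqI\<close> covers, the right-hand side speaks
  of index sets only and can be carried to another tree. If no sample lies above y, then y is an
  isolated leaf, and a sample close to it lies between x and y.\<close>

lemma special_le_iff:
  assumes x: "x \<in> S" "y \<in> S"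
  shows "x \<sqsubseteq> y \<longleftrightarrow> x = y \<or> samples_above x \<inter> samples_below y \<noteq> {} \<or>
    (samples_above y \<noteq> {} \<and> samples_above y \<subset> samples_above x)"
proof
  assume le: "x \<sqsubseteq> y"
  show "x = y \<or> samples_above x \<inter> samples_below y \<noteq> {} \<or>
    (samples_above y \<noteq> {} \<and> samples_above y \<subset> samples_above x)"
  proof (cases "x = y \<or> samples_above y \<noteq> {}")
    case True
    moreover have "samples_above y \<subseteq> samples_above x"
      unfolding samples_above_def using le le_trans by blast
    moreover have "x \<noteq> y \<Longrightarrow> samples_above y \<noteq> samples_above x"
      using samples_strictly_above[OF x(1) special_in_Span[OF x(2)]] le
      unfolding samples_above_def by blast
    ultimately show ?thesis by blast
  next
    case False
    then obtain z where z: "z \<sqsubset> y" "\<And>w. w \<in> Sp \<Longrightarrow> z \<sqsubseteq> w \<Longrightarrow> w \<sqsubseteq> y"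
      using special_without_samples_above[OF x(2)] by blast
    have xy: "x \<sqsubset> y" using le False by blast
    have "z \<sqsubseteq> x \<or> x \<sqsubseteq> z" using z(1) le by (intro le_linear) auto
    \<comment> \<open>w is the higher of x and z.\<close>
    then obtain w where w: "w \<sqsubset> y" "z \<sqsubseteq> w" "x \<sqsubseteq> w" using xy z(1) le_refl by metis
    obtain k where k: "w \<sqsubset> meet y (X k)" using hit_above[OF special_in_Span[OF x(2)] w(1)] by metis
    then have "w \<sqsubseteq> X k" by simp
    then have "X k \<sqsubseteq> y" "x \<sqsubseteq> X k" using z(2)[OF X_Span] w le_trans by blast+
    then show ?thesis by (auto simp: samples_above_def samples_below_def)
  qed
next
  assume "x = y \<or> samples_above x \<inter> samples_below y \<noteq> {} \<or>
    (samples_above y \<noteq> {} \<and> samples_above y \<subset> samples_above x)"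
  then consider "x = y" | i where "x \<sqsubseteq> X i" "X i \<sqsubseteq> y"
    | i where "y \<sqsubseteq> X i" "x \<sqsubseteq> X i" "samples_above y \<subset> samples_above x"
    by (auto simp: samples_above_def samples_below_def)
  then show "x \<sqsubseteq> y"
  proof cases
    case 2
    then show ?thesis by (rule le_trans)
  next
    case (3 i)
    then have "x \<sqsubseteq> y \<or> y \<sqsubseteq> x" by (intro le_linear[of x "X i" y])
    moreover have "y \<sqsubseteq> x \<Longrightarrow> samples_above x \<subseteq> samples_above y"
      unfolding samples_above_def using le_trans by blast
    ultimately show ?thesis using 3(3) by blast
  qed simp
qed

end

section \<open>Matching the special points of two trees\<close>

locale matched_samples = two_weighted_trees r1 p1 r2 p2 +
  T1: generic_sample r1 p1 X + T2: generic_sample r2 p2 Y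
  for r1 :: "'a::polish_space" and p1 :: "'a measure"
  and r2 :: "'b::polish_space" and p2 :: "'b measure"
  and X :: "nat \<Rightarrow> 'a" and Y :: "nat \<Rightarrow> 'b" +
  assumes same: "i \<noteq> j \<Longrightarrow>
    T1.meet (X i) (X j) \<in> segment r1 (X k) \<longleftrightarrow> T2.meet (Y i) (Y j) \<in> segment r2 (Y k)"
begin

lemma le_transfer: "X i \<in> segment r1 (X j) \<longleftrightarrow> Y i \<in> segment r2 (Y j)"
proof (cases "i = j")
  case False
  then show ?thesis using same by (simp add: T1.sample_le_iff T2.sample_le_iff)
qed simp

lemma lt_transfer: "X i \<in> segment r1 (X j) \<and> X i \<noteq> X j \<longleftrightarrow> Y i \<in> segment r2 (Y j) \<and> Y i \<noteq> Y j"
proof -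
  have "X i = X j \<longleftrightarrow> Y i = Y j"
    using le_transfer[of i j] le_transfer[of j i] T1.le_antisym[of "X i" "X j"] T2.le_antisym[of "Y i" "Y j"]
    by (metis T1.le_refl T2.le_refl)
  then show ?thesis using le_transfer by blast
qed

text \<open>For the samples above, this is the assumption \<open>same\<close>; for those below, a
  sample lies under a meet iff it lies under both arguments.\<close>

lemma meet_codes:
  assumes "i \<noteq> j"
  shows "T2.samples_above (T2.meet (Y i) (Y j)) = T1.samples_above (T1.meet (X i) (X j))"
    and "T2.samples_below (T2.meet (Y i) (Y j)) = T1.samples_below (T1.meet (X i) (X j))"
  using same[OF assms] le_transfer
  by (simp_all add: T1.samples_above_def T2.samples_above_def T1.samples_below_def T2.samples_below_def)

text \<open>Equal samples have equal partners by antisymmetry, and incomparable ones have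
  incomparable partners, which settles atoms and branch points. At a leaf it has to be shown that
  the supremum y of the partners is special: it is an isolated leaf, with one of the partners as its
  witness.\<close>

lemma special_code_exists:
  assumes "x \<in> T1.S"
  shows "\<exists>y\<in>T2.S. T2.samples_above y = T1.samples_above x \<and> T2.samples_below y = T1.samples_below x"
  using assms
proof (cases rule: T1.special_cases)
  case atom
  then obtain i where i: "X i = x" by (rule T1.atom_hit_other)
  obtain j where j: "j \<noteq> i" "X j = x" by (rule T1.atom_hit_other[OF atom])
  have eq: "Y i = Y j" using le_transfer[of i j] le_transfer[of j i] i j T2.le_antisym by simp
  then have "Y i \<in> T2.S" using T2.coincidence_atom[of i j] j(1) T2.atom_special by blast
  moreover have "T1.meet (X i) (X j) = x" "T2.meet (Y i) (Y j) = Y i"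
    using i j eq by (simp_all add: T1.meet_absorb1 T2.meet_absorb1)
  ultimately show ?thesis using meet_codes[of i j] j(1) by metis
next
  case (branch u v)
  then obtain i j where ij: "i \<noteq> j" "T1.meet (X i) (X j) = x" "T1.lt x (X i)" "T1.lt x (X j)"
    by (rule T1.branch_hit)
  have "\<not> T1.le (X i) (X j)" "\<not> T1.le (X j) (X i)"
    using ij T1.meet_absorb1 T1.meet_absorb2 by metis+
  then have "T2.meet (Y i) (Y j) \<in> T2.S"
    using T2.meet_special[OF T2.X_Span T2.X_Span] le_transfer by blast
  then show ?thesis using meet_codes[OF ij(1)] ij(2) by metis
next
  case (leaf z)
  define C where "C = {k. T1.lt z (X k)}"
  have x_not_hit: "X k \<noteq> x" for k using T1.special_null_not_hit[OF assms leaf(2)] .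
  have Cx: "T1.lt (X k) x" if "k \<in> C" for k
    using leaf(4)[OF T1.X_Span] that x_not_hit by (auto simp: C_def)
  \<comment> \<open>w is first raised to a point w' that is also above z, so that the sample found
    above w' belongs to C.\<close>
  have cofinal: "\<exists>k\<in>C. T1.lt w (X k)" if w: "T1.lt w x" for w
  proof -
    have "T1.le z w \<or> T1.le w z" using w leaf(3) by (intro T1.le_linear) auto
    then obtain w' where w': "T1.lt w' x" "T1.le z w'" "T1.le w w'" using w leaf(3) T1.le_refl by metis
    obtain k where "T1.lt w' (T1.meet x (X k))" using T1.hit_above[OF leaf(1) w'(1)] by metis
    then have "T1.lt w' (X k)" using T1.le_antisym by (metis T1.le_meet_iff T1.meet_le2)
    then have "T1.lt z (X k)" "T1.lt w (X k)" using w' T1.le_trans T1.le_antisym by blast+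
    then show ?thesis by (auto simp: C_def)
  qed
  have chainX: "T1.le (X k) (X l) \<or> T1.le (X l) (X k)" if "k \<in> C" "l \<in> C" for k l
    using Cx[OF that(1)] Cx[OF that(2)] by (intro T1.le_linear) auto
  have "C \<noteq> {}" using cofinal[OF leaf(3)] by blast
  then have "Y ` C \<noteq> {}" by blast
  then obtain y where y: "\<And>k. k \<in> C \<Longrightarrow> T2.le (Y k) y" "y \<in> closure (Y ` C)"
    "\<And>w. T2.lt w y \<Longrightarrow> \<exists>k\<in>C. T2.lt w (Y k)"
    by (rule T2.chain_sup) (use chainX le_transfer in \<open>auto simp: image_iff\<close>)
  have up: "l \<in> C" if "k \<in> C" "T2.le (Y k) (Y l)" for k l
    using that le_transfer T1.le_trans T1.le_antisym unfolding C_def by blast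
  have "closure (Y ` C) \<subseteq> T2.supp"
    using T2.X_supp by (intro closure_minimal T2.closed_supp) auto
  then have ySp: "y \<in> T2.Sp" using y(2) T2.supp_subset_Span by blast
  have yl: "T2.lt (Y k) y" if "k \<in> C" for k
  proof -
    from cofinal[OF Cx[OF that]] obtain l where "l \<in> C" "T1.lt (X k) (X l)" by blast
    then have "T2.le (Y l) y" "T2.lt (Y k) (Y l)" using y(1) lt_transfer by blast+
    then show ?thesis using T2.le_trans T2.le_antisym by blast
  qed
  obtain k0 where k0: "k0 \<in> C" using \<open>C \<noteq> {}\<close> by blast
  \<comment> \<open>If w left the path to y, some sample \<open>Y l\<close> would follow the path to
    w beyond \<open>meet w y\<close>. It lies above \<open>Y k0\<close>, so l is in C by
    \<open>up\<close> and \<open>Y l\<close> is below y, a contradiction.\<close>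
  have top: "T2.le w y" if w: "w \<in> T2.Sp" "T2.le (Y k0) w" for w
  proof (rule ccontr)
    assume n: "\<not> T2.le w y"
    let ?m = "T2.meet w y"
    have "T2.lt ?m w" using n T2.meet_le1 T2.meet_le2 by metis
    then obtain l where l: "T2.lt ?m (T2.meet w (Y l))" using T2.hit_above[OF w(1)] by metis
    have "T2.le (Y k0) ?m" using w(2) y(1)[OF k0] by simp
    then have "T2.le (Y k0) (T2.meet w (Y l))" using l T2.le_trans by blast
    then have "T2.le (Y k0) (Y l)" by simp
    then have "T2.le (Y l) y" using up[OF k0] y(1) by blast
    then have "T2.le (T2.meet w (Y l)) ?m" using T2.le_trans T2.meet_le2 by (metis T2.le_meet_iff T2.meet_le1)
    then show False using l T2.le_antisym by blast
  qed
  have yS: "y \<in> T2.S"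
    unfolding T2.special_iff using ySp yl[OF k0] top by blast
  have Y_not_above: "\<not> T2.le y (Y l)" for l
  proof
    assume "T2.le y (Y l)"
    then have "T2.le (Y k0) (Y l)" using y(1)[OF k0] T2.le_trans by blast
    then have "T2.lt (Y l) y" using up[OF k0] yl by blast
    then show False using \<open>T2.le y (Y l)\<close> T2.le_antisym by blast
  qed
  have X_not_above: "\<not> T1.le x (X l)" for l
    using leaf(3) leaf(4)[OF T1.X_Span, of l] x_not_hit T1.le_trans T1.le_antisym by blast
  have "T2.le (Y l) y \<longleftrightarrow> T1.le (X l) x" for l
  proof
    assume "T1.le (X l) x"
    then obtain k where "k \<in> C" "T1.lt (X l) (X k)" using cofinal[of "X l"] x_not_hit by blast
    then have "T2.le (Y k) y" "T2.le (Y l) (Y k)" using y(1) le_transfer by blast+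
    then show "T2.le (Y l) y" using T2.le_trans by blast
  next
    assume "T2.le (Y l) y"
    then have "T2.lt (Y l) y" using Y_not_above[of l] by auto
    then obtain k where "k \<in> C" "T2.lt (Y l) (Y k)" using y(3) by blast
    then have "T1.le (X k) x" "T1.le (X l) (X k)" using Cx le_transfer by blast+
    then show "T1.le (X l) x" using T1.le_trans by blast
  qed
  then show ?thesis
    using yS X_not_above Y_not_above
    by (intro bexI[of _ y]) (simp_all add: T1.samples_above_def T2.samples_above_def
        T1.samples_below_def T2.samples_below_def)
qed

lemma matched_samples_swap: "matched_samples r2 p2 r1 p1 Y X"
  using same by unfold_locales blast

lemma equivalent: "mass_structurally_equivalent r1 p1 r2 p2"
proof -
  interpret swap: matched_samples r2 p2 r1 p1 Y X by (rule matched_samples_swap)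
  obtain \<phi> where \<phi>: "\<And>x. x \<in> T1.S \<Longrightarrow> \<phi> x \<in> T2.S \<and> T2.samples_above (\<phi> x) = T1.samples_above x \<and>
      T2.samples_below (\<phi> x) = T1.samples_below x"
    using special_code_exists by metis
  have inj: "inj_on \<phi> T1.S"
    using \<phi> T1.special_eqI by (intro inj_onI) metis
  have "bij_betw \<phi> T1.S T2.S"
    unfolding bij_betw_def
  proof (intro conjI inj equalityI subsetI)
    fix y assume y: "y \<in> T2.S"
    then obtain x where x: "x \<in> T1.S" "T1.samples_above x = T2.samples_above y"
      "T1.samples_below x = T2.samples_below y"
      using swap.special_code_exists by blast
    then have "\<phi> x = y" using \<phi>[OF x(1)] y by (intro T2.special_eqI) auto
    then show "y \<in> \<phi> ` T1.S" using x(1) by blast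
  qed (use \<phi> in auto)
  moreover have "measure p1 (segment r1 x) = measure p2 (segment r2 (\<phi> x))"
    "measure p1 {x} = measure p2 {\<phi> x}" "measure p1 (fringe r1 x) = measure p2 (fringe r2 (\<phi> x))"
    if "x \<in> T1.S" for x
    using T1.frequency[OF that] T2.frequency[of "\<phi> x"] \<phi>[OF that] LIMSEQ_unique by simp_all
  moreover have "x \<in> segment r1 y \<longleftrightarrow> \<phi> x \<in> segment r2 (\<phi> y)" if "x \<in> T1.S" "y \<in> T1.S" for x y
    using \<phi>[OF that(1)] \<phi>[OF that(2)] inj_on_eq_iff[OF inj that]
    by (simp add: T1.special_le_iff[OF that] T2.special_le_iff)
  ultimately show ?thesis
    unfolding mass_structurally_equivalent_def mass_structural_isomorphism_def by blast
qed

end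

context two_weighted_trees
begin

lemma equivalent_if_same_triples:
  assumes "same_triples"
  shows "mass_structurally_equivalent r1 p1 r2 p2"
proof -
  have sets_PiM_borel: "sets (\<Pi>\<^sub>M i\<in>(UNIV :: nat set). p) = sets borel"
    if "sets p = sets borel" for p :: "'c::polish_space measure"
    using sets_PiM_cong[of UNIV UNIV "\<lambda>_. p" "\<lambda>_. borel"] that sets_PiM_equal_borel by auto
  have fin: "finite (range (T1.triples n))" "finite (range (T2.triples n))" for n
    using T1.triples_subset[of n] T2.triples_subset[of n]
    by (simp_all add: finite_subset[of _ "Pow ({1..n} \<times> {1..n} \<times> {1..n})"] image_subset_iff)
  obtain X Y where XY: "T1.generic (\<lambda>k. X (Suc k))" "T2.generic (\<lambda>k. Y (Suc k))"
    "\<And>n. T1.triples n X = T2.triples n Y"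
  proof (rule realise_same_observations[OF
        T1.prob_P sets_PiM_borel[OF T1.sets_p] T1.measurable_triples fin(1) T1.AE_generic
        T2.prob_P sets_PiM_borel[OF T2.sets_p] T2.measurable_triples fin(2) T2.AE_generic])
    show "distr T1.P (count_space UNIV) (T1.triples n) = distr T2.P (count_space UNIV) (T2.triples n)" for n
      using assms by (simp add: same_triples_def)
    show "T1.triples m X = T2.triples m Y" if "m \<le> n" "T1.triples n X = T2.triples n Y" for m n X Y
      using that T1.triples_restrict[OF that(1), of X] T2.triples_restrict[OF that(1), of Y] by simp
  qed blast
  have "T1.meet (X (Suc i)) (X (Suc j)) \<in> segment r1 (X (Suc k)) \<longleftrightarrow>
      T2.meet (Y (Suc i)) (Y (Suc j)) \<in> segment r2 (Y (Suc k))" if "i \<noteq> j" for i j k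
  proof -
    \<comment> \<open>A level at which all three shifted indices are available.\<close>
    have "(Suc i, Suc j, Suc k) \<in> T1.triples (Suc (i + j + k)) X \<longleftrightarrow>
        (Suc i, Suc j, Suc k) \<in> T2.triples (Suc (i + j + k)) Y" by (simp add: XY(3))
    then show ?thesis using that by (simp add: T1.triples_def T2.triples_def)
  qed
  then interpret matched_samples r1 p1 r2 p2 "\<lambda>k. X (Suc k)" "\<lambda>k. Y (Suc k)"
    using XY by unfold_locales auto
  show ?thesis by (rule equivalent)
qed

end

section \<open>Codes of points\<close>

context weighted_tree
begin

text \<open>The coordinate along segments used in place of the height: its values at special points
  are preserved by a mass-structural isomorphism.\<close>

definition mass_below :: "'a \<Rightarrow> real" where
  "mass_below x = measure p (segment r x)"

lemma mass_below_mono: "x \<sqsubseteq> y \<Longrightarrow> mass_below x \<le> mass_below y"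
  unfolding mass_below_def using le_trans by (intro finite_measure_mono) auto

lemma mass_below_le_1: "mass_below x \<le> 1"
  by (simp add: mass_below_def)

lemma mass_below_nonneg: "0 \<le> mass_below x"
  by (simp add: mass_below_def)

lemma mass_strictly_below: "measure p (segment r x - {x}) = mass_below x - measure p {x}"
  unfolding mass_below_def by (intro finite_measure_Diff) auto

definition lower_part :: "'a \<Rightarrow> real \<Rightarrow> 'a set" where
  "lower_part t a = {x. x \<sqsubseteq> t \<and> mass_below x \<le> a}"

text \<open>The set is a downward closed chain, hence described by its supremum b; b belongs to it
  or not according to whether the mass up to b exceeds a.\<close>

lemma lower_part_cases:
  obtains (empty) "lower_part t a = {}"
    | (closed) b where "b \<sqsubseteq> t" "lower_part t a = segment r b" "mass_below b \<le> a"
    | (half_open) b where "b \<sqsubseteq> t" "b \<noteq> r" "lower_part t a = segment r b - {b}" "a < mass_below b"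
proof (cases "lower_part t a = {}")
  case True
  then show thesis by (rule that(1))
next
  case False
  have chain: "x \<sqsubseteq> y \<or> y \<sqsubseteq> x" if "x \<in> lower_part t a" "y \<in> lower_part t a" for x y
    using that by (intro le_linear[of x t y]) (auto simp: lower_part_def)
  obtain b where b: "\<And>x. x \<in> lower_part t a \<Longrightarrow> x \<sqsubseteq> b" "b \<in> closure (lower_part t a)"
    "\<And>z. z \<sqsubset> b \<Longrightarrow> \<exists>x\<in>lower_part t a. z \<sqsubset> x"
    by (rule chain_sup[OF False chain]) blast+
  have "closure (lower_part t a) \<subseteq> segment r t"
    by (intro closure_minimal closed_segment_tree) (auto simp: lower_part_def)
  then have bt: "b \<sqsubseteq> t" using b(2) by blast
  have down: "x \<in> lower_part t a" if "x \<sqsubset> b" for x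
  proof -
    obtain y where "y \<in> lower_part t a" "x \<sqsubset> y" using b(3)[OF \<open>x \<sqsubset> b\<close>] by blast
    then show ?thesis
      using mass_below_mono[of x y] le_trans[of x y t] by (simp add: lower_part_def)
  qed
  show thesis
  proof (cases "mass_below b \<le> a")
    case True
    then have "b \<in> lower_part t a" using bt by (simp add: lower_part_def)
    then have "lower_part t a = segment r b" using b(1) down by blast
    then show thesis using that(2) bt True by blast
  next
    case n: False
    then have "b \<notin> lower_part t a" by (simp add: lower_part_def)
    then have eq: "lower_part t a = segment r b - {b}" using b(1) down by blast
    have "b \<noteq> r"
    proof
      assume "b = r"
      then have "x \<notin> lower_part t a" for x unfolding eq by simp
      then show False using False by blast
    qed
    moreover have "a < mass_below b" using n by simp
    ultimately show thesis using that(3) bt eq by blast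
  qed
qed

lemma lower_part_in_sets [measurable, simp]: "lower_part t a \<in> sets p"
proof (cases rule: lower_part_cases[of t a])
  case (closed b)
  show ?thesis unfolding closed(2) by simp
next
  case (half_open b)
  show ?thesis unfolding half_open(3) by (intro sets.Diff) simp_all
qed simp

text \<open>The threshold a falls into the jump of the mass at u, so the lower part consists of the
  points strictly below u.\<close>

lemma mass_lower_part_atom:
  assumes u: "u \<sqsubseteq> t" "mass_below u - measure p {u} \<le> a" "a < mass_below u"
  shows "measure p (lower_part t a) = mass_below u - measure p {u}"
proof -
  have "x \<in> lower_part t a" if "x \<sqsubset> u" for x
  proof -
    have "segment r x \<subseteq> segment r u - {u}"
      using that le_trans le_antisym by blast
    then have "measure p (segment r x) \<le> measure p (segment r u - {u})"
      by (intro finite_measure_mono) auto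
    then have "mass_below x \<le> mass_below u - measure p {u}"
      by (simp add: mass_strictly_below mass_below_def[of x])
    then show ?thesis using u le_trans[of x u t] that by (simp add: lower_part_def)
  qed
  moreover have "x \<sqsubset> u" if "x \<in> lower_part t a" for x
  proof -
    have x: "x \<sqsubseteq> t" "mass_below x \<le> a" using that by (auto simp: lower_part_def)
    then have "\<not> u \<sqsubseteq> x" using mass_below_mono[of u x] u(3) by linarith
    then show ?thesis using le_linear[OF x(1) u(1)] by auto
  qed
  ultimately have "lower_part t a = segment r u - {u}" by blast
  then show ?thesis by (simp add: mass_strictly_below)
qed

lemma mass_lower_part_full: "mass_below t \<le> a \<Longrightarrow> measure p (lower_part t a) = mass_below t"
proof -
  assume "mass_below t \<le> a"
  then have "lower_part t a = segment r t"
    using mass_below_mono by (fastforce simp: lower_part_def)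
  then show ?thesis by (simp add: mass_below_def)
qed

text \<open>A cofinal sequence exhibits the points strictly below b as a countable increasing union
  of segments, so that continuity of the measure applies.\<close>

lemma approx_from_below:
  assumes "b \<noteq> r"
  obtains x where "\<And>n::nat. x n \<sqsubset> b" "\<And>m n. m \<le> n \<Longrightarrow> x m \<sqsubseteq> x n" "\<And>w. w \<sqsubset> b \<Longrightarrow> \<exists>n. w \<sqsubseteq> x n"
proof -
  have h: "dist r b > 0" using assms by simp
  let ?t = "\<lambda>n. dist r b - dist r b * inverse (real (Suc n))"
  have inv: "0 < inverse (real (Suc n))" "inverse (real (Suc n)) \<le> 1" for n
    by (auto intro: inverse_le_1_iff[THEN iffD2])
  have "\<exists>z. z \<sqsubseteq> b \<and> dist r z = ?t n" for n
  proof -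
    have "0 \<le> ?t n" "?t n \<le> dist r b" using h inv[of n] mult_left_le[of "inverse (real (Suc n))" "dist r b"] by auto
    then show ?thesis using point_at_height by metis
  qed
  then obtain x where x: "\<And>n. x n \<sqsubseteq> b" "\<And>n. dist r (x n) = ?t n" by metis
  have "dist r (x n) < dist r b" for n using x(2)[of n] h inv[of n] by simp
  then have 1: "x n \<sqsubset> b" for n using x(1)[of n] by (metis less_irrefl)
  have 2: "x m \<sqsubseteq> x n" if "m \<le> n" for m n
  proof (rule le_of_height[OF x(1) x(1)])
    have "inverse (real (Suc n)) \<le> inverse (real (Suc m))" using that by (intro le_imp_inverse_le) auto
    then show "dist r (x m) \<le> dist r (x n)" unfolding x(2) using h by simp
  qed
  have 3: "\<exists>n. w \<sqsubseteq> x n" if w: "w \<sqsubset> b" for w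
  proof -
    have "0 < (dist r b - dist r w) / dist r b" using lt_height[OF w] h by simp
    then obtain n where "inverse (real (Suc n)) < (dist r b - dist r w) / dist r b"
      using reals_Archimedean by blast
    then have "dist r b * inverse (real (Suc n)) < dist r b - dist r w"
      using h by (simp add: pos_less_divide_eq mult.commute)
    then have "dist r w \<le> dist r (x n)" using x(2)[of n] by linarith
    then show ?thesis using le_of_height[OF _ x(1)] w by blast
  qed
  show thesis using that 1 2 3 by blast
qed

text \<open>The heights decrease to that of b, so the segments [[r, x n]] decrease to
  [[r, b]].\<close>

lemma approx_from_above:
  assumes "b \<sqsubset> t"
  obtains x where "\<And>n::nat. b \<sqsubset> x n" "\<And>n. x n \<sqsubseteq> t" "\<And>m n. m \<le> n \<Longrightarrow> x n \<sqsubseteq> x m"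
    "\<And>w. (\<And>n. w \<sqsubseteq> x n) \<Longrightarrow> w \<sqsubseteq> b"
proof -
  let ?d = "dist r t - dist r b"
  have h: "?d > 0" using lt_height[OF assms] by simp
  let ?t = "\<lambda>n. dist r b + ?d * inverse (real (Suc n))"
  have inv: "0 < inverse (real (Suc n))" "inverse (real (Suc n)) \<le> 1" for n
    by (auto intro: inverse_le_1_iff[THEN iffD2])
  have "\<exists>z. z \<sqsubseteq> t \<and> dist r z = ?t n" for n
  proof -
    have "?d * inverse (real (Suc n)) \<le> ?d" "0 \<le> ?d * inverse (real (Suc n))"
      using mult_left_le[of "inverse (real (Suc n))" ?d] inv[of n] h by (auto simp del: of_nat_Suc)
    then have "0 \<le> ?t n" "?t n \<le> dist r t" using zero_le_dist[of r b] by linarith+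
    then show ?thesis using point_at_height by metis
  qed
  then obtain x where x: "\<And>n. x n \<sqsubseteq> t" "\<And>n. dist r (x n) = ?t n" by metis
  have pos: "0 < ?d * inverse (real (Suc n))" for n using h inv(1)[of n] by (rule mult_pos_pos)
  have 1: "b \<sqsubset> x n" for n
    using le_of_height_less[of b t "x n"] assms x(1)[of n] x(2)[of n] pos[of n] by linarith
  have 2: "x n \<sqsubseteq> x m" if "m \<le> n" for m n
  proof (rule le_of_height[OF x(1) x(1)])
    have "inverse (real (Suc n)) \<le> inverse (real (Suc m))" using that by (intro le_imp_inverse_le) auto
    then have "?d * inverse (real (Suc n)) \<le> ?d * inverse (real (Suc m))" using h by (intro mult_left_mono) auto
    then show "dist r (x n) \<le> dist r (x m)" unfolding x(2) by simp
  qed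
  have 3: "w \<sqsubseteq> b" if w: "\<And>n. w \<sqsubseteq> x n" for w
  proof (rule ccontr)
    assume n: "\<not> w \<sqsubseteq> b"
    have wt: "w \<sqsubseteq> t" using le_trans[OF w x(1)] by blast
    then have "dist r b < dist r w" using le_of_height[OF wt, of b] assms n by (meson not_le)
    then have "0 < (dist r w - dist r b) / ?d" using h by simp
    then obtain n where "inverse (real (Suc n)) < (dist r w - dist r b) / ?d"
      using reals_Archimedean by blast
    then have "?d * inverse (real (Suc n)) < dist r w - dist r b"
      using h by (simp add: pos_less_divide_eq mult.commute)
    then show False using x(2)[of n] le_height[OF w[of n]] by linarith
  qed
  show thesis using that 1 2 3 x(1) by blast
qed

text \<open>No jump of the mass crosses a: an empty lower part would make the root, and a half-open
  one its end b, an atom whose jump does. So the lower part is some [[r, b]], and points with mass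
  beyond a approach b from above. The hypothesis quantifies over special points so that an
  isomorphism carries it over.\<close>

lemma mass_lower_part_continuous:
  assumes a: "0 \<le> a" "a < mass_below t"
    and no_atom: "\<And>u. u \<in> S \<Longrightarrow> u \<sqsubseteq> t \<Longrightarrow> mass_below u - measure p {u} \<le> a \<Longrightarrow> mass_below u \<le> a"
  shows "measure p (lower_part t a) = a"
proof (cases rule: lower_part_cases[of t a])
  case empty
  then have "r \<notin> lower_part t a" by blast
  then have r: "a < mass_below r" by (simp add: lower_part_def)
  have "segment r r = {r}" using le_root_iff by blast
  then have "mass_below r = measure p {r}" by (simp add: mass_below_def)
  then have "mass_below r \<le> a" using no_atom[of r] a(1) r by (simp add: atom_special)
  then show ?thesis using r by simp
next
  case (closed b)
  then have "b \<noteq> t" using a(2) by auto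
  then have "b \<sqsubset> t" using closed(1) by blast
  then obtain x where x: "\<And>n::nat. b \<sqsubset> x n" "\<And>n. x n \<sqsubseteq> t" "\<And>m n. m \<le> n \<Longrightarrow> x n \<sqsubseteq> x m"
    "\<And>w. (\<And>n. w \<sqsubseteq> x n) \<Longrightarrow> w \<sqsubseteq> b" by (rule approx_from_above) blast
  have "a < mass_below (x n)" for n
  proof (rule ccontr)
    assume "\<not> a < mass_below (x n)"
    then have "x n \<in> lower_part t a" using x(2)[of n] by (simp add: lower_part_def)
    then show False using closed(2) x(1)[of n] le_antisym by blast
  qed
  moreover have "(\<lambda>n. measure p (segment r (x n))) \<longlonglongrightarrow> measure p (\<Inter>n. segment r (x n))"
  proof (rule finite_Lim_measure_decseq)
    show "decseq (\<lambda>n. segment r (x n))" unfolding decseq_def using x(3) le_trans by blast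
  qed auto
  moreover have "(\<Inter>n. segment r (x n)) = segment r b"
  proof (intro equalityI subsetI)
    fix w assume "w \<in> (\<Inter>n. segment r (x n))"
    then show "w \<sqsubseteq> b" by (intro x(4)) blast
  next
    fix w assume "w \<sqsubseteq> b"
    then have "w \<sqsubseteq> x n" for n using le_trans[of w b "x n"] x(1)[of n] by simp
    then show "w \<in> (\<Inter>n. segment r (x n))" by blast
  qed
  ultimately have "a \<le> mass_below b"
    unfolding mass_below_def by (intro LIMSEQ_le_const) (auto intro: less_imp_le)
  then show ?thesis using closed by (simp add: mass_below_def)
next
  case (half_open b)
  obtain x where x: "\<And>n::nat. x n \<sqsubset> b" "\<And>m n. m \<le> n \<Longrightarrow> x m \<sqsubseteq> x n" "\<And>w. w \<sqsubset> b \<Longrightarrow> \<exists>n. w \<sqsubseteq> x n"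
    using approx_from_below[OF half_open(2)] by blast
  have "x n \<in> lower_part t a" for n using half_open(3) x(1)[of n] by blast
  then have "measure p (segment r (x n)) \<le> a" for n by (simp add: lower_part_def mass_below_def)
  moreover have "(\<lambda>n. measure p (segment r (x n))) \<longlonglongrightarrow> measure p (\<Union>n. segment r (x n))"
  proof (rule finite_Lim_measure_incseq)
    show "incseq (\<lambda>n. segment r (x n))" unfolding incseq_def using x(2) le_trans by blast
  qed auto
  moreover have "(\<Union>n. segment r (x n)) = segment r b - {b}"
  proof (intro equalityI subsetI)
    fix w assume "w \<in> (\<Union>n. segment r (x n))"
    then obtain n where "w \<sqsubseteq> x n" by blast
    then show "w \<in> segment r b - {b}"
      using le_trans[of w "x n" b] x(1)[of n] le_antisym[of b "x n"] by auto
  next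
    fix w assume "w \<in> segment r b - {b}"
    then have "w \<sqsubset> b" by simp
    then show "w \<in> (\<Union>n. segment r (x n))" using x(3)[of w] by blast
  qed
  ultimately have le: "mass_below b - measure p {b} \<le> a"
    unfolding mass_strictly_below[symmetric] by (intro LIMSEQ_le_const2) auto
  then have "measure p {b} > 0" using half_open(4) by linarith
  then have "mass_below b \<le> a" using no_atom[OF atom_special half_open(1) le] by blast
  then show ?thesis using half_open(4) by simp
qed

text \<open>On the chain below t, a point that is not above s is strictly below s. The lower part of
  s contains s itself only if \<open>mass_below s\<close> \<le> a, whence the correction
  term.\<close>

lemma mass_fringe_lower_part:
  assumes "s \<sqsubseteq> t"
  shows "measure p (fringe r s \<inter> lower_part t a) = measure p (lower_part t a) -
    (measure p (lower_part s a) - (if mass_below s \<le> a then measure p {s} else 0))"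
proof -
  have "lower_part t a - (lower_part s a - {s}) = fringe r s \<inter> lower_part t a"
  proof (intro equalityI subsetI)
    fix x assume x: "x \<in> lower_part t a - (lower_part s a - {s})"
    then have "s \<sqsubseteq> x" using le_linear[of x t s] assms by (auto simp: lower_part_def)
    then show "x \<in> fringe r s \<inter> lower_part t a" using x by (simp add: fringe_def)
  next
    fix x assume x: "x \<in> fringe r s \<inter> lower_part t a"
    then have "x \<sqsubseteq> s \<Longrightarrow> x = s" using le_antisym[of x s] by (simp add: fringe_def)
    then show "x \<in> lower_part t a - (lower_part s a - {s})" using x by (auto simp: lower_part_def)
  qed
  moreover have "lower_part s a - {s} \<subseteq> lower_part t a"
    using assms le_trans by (auto simp: lower_part_def)
  ultimately have "measure p (fringe r s \<inter> lower_part t a) =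
      measure p (lower_part t a) - measure p (lower_part s a - {s})"
    using finite_measure_Diff[of "lower_part t a" "lower_part s a - {s}"] by simp
  moreover have "measure p (lower_part s a - {s}) =
      measure p (lower_part s a) - (if mass_below s \<le> a then measure p {s} else 0)"
  proof (cases "mass_below s \<le> a")
    case True
    then have "{s} \<subseteq> lower_part s a" by (simp add: lower_part_def)
    then show ?thesis using True finite_measure_Diff[of "lower_part s a" "{s}"] by simp
  next
    case False
    then have "lower_part s a - {s} = lower_part s a" by (auto simp: lower_part_def)
    then show ?thesis using False by simp
  qed
  ultimately show ?thesis by simp
qed

section \<open>Almost every point is visible to the masses\<close>

definition ancestor_at :: "'a \<Rightarrow> real \<Rightarrow> 'a" where
  "ancestor_at x q = (SOME z. z \<sqsubseteq> x \<and> dist r z = q)"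

lemma ancestor_at:
  assumes "0 \<le> q" "q \<le> dist r x"
  shows "ancestor_at x q \<sqsubseteq> x \<and> dist r (ancestor_at x q) = q"
proof -
  obtain z where "z \<sqsubseteq> x \<and> dist r z = q" using point_at_height[OF assms] by blast
  then show ?thesis unfolding ancestor_at_def by (rule someI)
qed

text \<open>The points below c with the same mass as c form a piece of segment ending at c.
  Ancestors of c at rational heights in this piece cut off null sets that cover it up to at most one
  point, and that point is null or an atom, hence special.\<close>

lemma AE_mass_level_special: "AE x in p. x \<sqsubseteq> c \<and> mass_below x = mass_below c \<longrightarrow> x \<in> S"
proof -
  define Q where "Q = {q \<in> \<rat>. 0 \<le> q \<and> q \<le> dist r c \<and> mass_below (ancestor_at c q) = mass_below c}"
  have "countable Q" unfolding Q_def by (rule countable_subset[OF _ countable_rat]) auto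
  have "AE x in p. \<forall>q\<in>Q. x \<notin> segment r c - segment r (ancestor_at c q)"
  proof (subst AE_ball_countable[OF \<open>countable Q\<close>], intro ballI AE_not_in null_setsI)
    fix q assume q: "q \<in> Q"
    then have "segment r (ancestor_at c q) \<subseteq> segment r c" using ancestor_at[of q c] le_trans by (auto simp: Q_def)
    then have "measure p (segment r c - segment r (ancestor_at c q)) = mass_below c - mass_below (ancestor_at c q)"
      unfolding mass_below_def by (intro finite_measure_Diff) auto
    then show "emeasure p (segment r c - segment r (ancestor_at c q)) = 0"
      using q by (simp add: emeasure_eq_measure Q_def)
  qed auto
  moreover define B where "B = {x. x \<sqsubseteq> c \<and> mass_below x = mass_below c \<and> (\<forall>q\<in>Q. x \<notin> segment r c - segment r (ancestor_at c q))}"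
  \<comment> \<open>A rational height between two points of B gives an element of Q whose null set
    would contain the higher point.\<close>
  have no: False if x: "x \<in> B" "x' \<in> B" "dist r x < dist r x'" for x x'
  proof -
    obtain q where q: "q \<in> \<rat>" "dist r x < q" "q < dist r x'" using Rats_dense_in_real[OF x(3)] by blast
    have xc: "x \<sqsubseteq> c" "x' \<sqsubseteq> c" using x by (auto simp: B_def)
    have q': "0 \<le> q" "q \<le> dist r c" using q le_height[OF xc(2)] zero_le_dist[of r x] by linarith+
    note ptq = ancestor_at[OF q']
    have "x \<sqsubseteq> ancestor_at c q" "ancestor_at c q \<sqsubseteq> x'" using le_of_height[of _ c] xc ptq q by simp_all
    then have "mass_below (ancestor_at c q) = mass_below c"
      using mass_below_mono[of x "ancestor_at c q"] mass_below_mono[of "ancestor_at c q" x'] x by (simp add: B_def)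
    then have "q \<in> Q" using q q' by (simp add: Q_def)
    then have "x' \<sqsubseteq> ancestor_at c q" using x(2) xc by (auto simp: B_def)
    then show False using le_height[of x' "ancestor_at c q"] ptq q(3) by simp
  qed
  have "x = x'" if "x \<in> B" "x' \<in> B" for x x'
  proof -
    have "dist r x = dist r x'" using no[of x x'] no[of x' x] that by (meson linorder_neqE)
    then show ?thesis
      using le_of_height[of x c x'] le_of_height[of x' c x] le_antisym that by (simp add: B_def)
  qed
  then obtain b where b: "B \<subseteq> {b}" by blast
  have "AE x in p. x = b \<longrightarrow> x \<in> S"
  proof (cases "measure p {b} = 0")
    case True
    then have "{b} \<in> null_sets p" by (intro null_setsI) (simp_all add: emeasure_eq_measure)
    then have "AE x in p. x \<notin> {b}" by (rule AE_not_in)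
    then show ?thesis by eventually_elim simp
  next
    case False
    then have "b \<in> S" by (intro atom_special) (simp add: zero_less_measure_iff)
    then show ?thesis by (intro AE_I2) simp
  qed
  ultimately show ?thesis
  proof eventually_elim
    case (elim x)
    then show ?case using b by (auto simp: B_def)
  qed
qed

text \<open>The second condition rules out a plateau of the mass directly above x on the way to a
  special point. For good points below a common special point the masses then decide the order,
  unless the lower one is special and decides it itself.\<close>

definition good :: "'a \<Rightarrow> bool" where
  "good x \<longleftrightarrow> x \<in> supp \<and>
     (x \<in> S \<or> (\<forall>s\<in>S. \<forall>y. x \<sqsubset> y \<and> y \<sqsubseteq> s \<longrightarrow> mass_below x < mass_below y))"

text \<open>If the mass were constant between x and y, an ancestor of s at a rational height between
  them would have the mass of x, and \<open>AE_mass_level_special\<close> would make x special,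
  outside countably many null sets.\<close>

lemma AE_good: "AE x in p. good x"
proof -
  have "AE x in p. \<forall>s\<in>S. \<forall>q\<in>\<rat>. x \<sqsubseteq> ancestor_at s q \<and> mass_below x = mass_below (ancestor_at s q) \<longrightarrow> x \<in> S"
    by (subst AE_ball_countable[OF countable_special], intro ballI,
        subst AE_ball_countable[OF countable_rat], intro ballI AE_mass_level_special)
  with AE_supp show ?thesis
  proof eventually_elim
    case (elim x)
    have "mass_below x < mass_below y" if "x \<notin> S" and s: "s \<in> S" and y: "x \<sqsubset> y" "y \<sqsubseteq> s" for s y
    proof (rule ccontr)
      assume n: "\<not> ?thesis"
      obtain q where q: "q \<in> \<rat>" "dist r x < q" "q < dist r y"
        using Rats_dense_in_real[OF lt_height[OF y(1)]] by blast
      have q': "0 \<le> q" "q \<le> dist r s" using q le_height[OF y(2)] zero_le_dist[of r x] by linarith+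
      note ptq = ancestor_at[OF q']
      have "x \<sqsubseteq> s" using y le_trans by blast
      then have "x \<sqsubseteq> ancestor_at s q" "ancestor_at s q \<sqsubseteq> y" using le_of_height[of _ s] y ptq q by simp_all
      then have "mass_below x = mass_below (ancestor_at s q)"
        using n mass_below_mono[of x "ancestor_at s q"] mass_below_mono[of "ancestor_at s q" y] by linarith
      then show False using elim(2) s q(1) \<open>x \<sqsubseteq> ancestor_at s q\<close> \<open>x \<notin> S\<close> by blast
    qed
    then show ?case using elim(1) by (auto simp: good_def)
  qed
qed

text \<open>\<open>None\<close> asks for the fringe and \<open>Some q\<close> for the lower part
  with threshold q; rational thresholds keep the family countable. No mass exceeds 1, so
  \<open>Some 1\<close> asks for the whole segment.\<close>

definition code :: "'a \<Rightarrow> 'a \<times> rat option \<Rightarrow> bool" where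
  "code x k = (case snd k of None \<Rightarrow> fst k \<sqsubseteq> x | Some q \<Rightarrow> x \<in> lower_part (fst k) (of_rat q))"

lemma code_simps: "code x (s, None) \<longleftrightarrow> s \<sqsubseteq> x" "code x (s, Some q) \<longleftrightarrow> x \<sqsubseteq> s \<and> mass_below x \<le> of_rat q"
  "code x (s, Some 1) \<longleftrightarrow> x \<sqsubseteq> s" for x s
  using mass_below_le_1 by (simp_all add: code_def lower_part_def)

text \<open>With nothing special above it, y is a maximal point of the span but no isolated leaf, so
  the span branches off between x and y, however close x is.\<close>

lemma special_between:
  assumes "y \<in> Sp" "\<And>s. s \<in> S \<Longrightarrow> \<not> y \<sqsubseteq> s" "x \<sqsubset> y"
  obtains s where "s \<in> S" "x \<sqsubseteq> s" "s \<sqsubset> y"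
proof -
  have "y \<notin> S" using assms(2)[of y] by auto
  then obtain w where w: "w \<in> Sp" "x \<sqsubseteq> w" "\<not> w \<sqsubseteq> y"
    unfolding special_iff using assms by blast
  have leaf: "\<And>w. w \<in> Sp \<Longrightarrow> y \<sqsubseteq> w \<Longrightarrow> w = y"
    using special_above[OF assms(1)] assms(2) by metis
  have "\<not> y \<sqsubseteq> w" using leaf[OF w(1)] w(3) by auto
  then have m: "meet w y \<in> S" using meet_special w assms(1) by blast
  moreover have "x \<sqsubseteq> meet w y" using w assms by simp
  moreover have "meet w y \<noteq> y" using \<open>\<not> y \<sqsubseteq> w\<close> meet_le1 by metis
  ultimately show thesis using that meet_le2 by blast
qed

end

text \<open>
  The code of a point records its position relative to the special points, together with the
  mass below it if it lies below a special point. The mass serves to order those sampled points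
  that no special point separates.
\<close>

definition code_le :: "'s set \<Rightarrow> ('s \<times> rat option \<Rightarrow> bool) \<Rightarrow> ('s \<times> rat option \<Rightarrow> bool) \<Rightarrow> bool" where
  "code_le I c d \<longleftrightarrow>
     (\<exists>s\<in>I. c (s, Some 1) \<and> d (s, None)) \<or>
     (\<not> (\<exists>s\<in>I. d (s, Some 1) \<and> c (s, None)) \<and>
      (\<exists>s\<in>I. c (s, Some 1) \<and> d (s, Some 1) \<and> (\<forall>q. d (s, Some q) \<longrightarrow> c (s, Some q))))"

text \<open>The cases are those of the lower of the first two points; otherwise the meet is tested
  through special points below both. The last case includes equal points with no special point above
  them, for which \<open>code_le\<close> fails even reflexively.\<close>

definition code_meet_le ::
  "'s set \<Rightarrow> ('s \<times> rat option \<Rightarrow> bool) \<Rightarrow> ('s \<times> rat option \<Rightarrow> bool) \<Rightarrow> ('s \<times> rat option \<Rightarrow> bool) \<Rightarrow> bool" where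
  "code_meet_le I c d e \<longleftrightarrow>
     (code_le I c d \<and> code_le I c e) \<or>
     (\<not> code_le I c d \<and> code_le I d c \<and> code_le I d e) \<or>
     (\<not> code_le I c d \<and> \<not> code_le I d c \<and> (\<forall>s\<in>I. c (s, None) \<and> d (s, None) \<longrightarrow> e (s, None)))"

text \<open>Lets the codes of two trees be indexed by the special points of one of them.\<close>

lemma code_meet_le_reindex:
  assumes "bij_betw \<phi> I J"
  shows "code_meet_le I (\<lambda>(s, q). c (\<phi> s, q)) (\<lambda>(s, q). d (\<phi> s, q)) (\<lambda>(s, q). e (\<phi> s, q)) \<longleftrightarrow>
    code_meet_le J c d e"
  unfolding bij_betw_imp_surj_on[OF assms, symmetric] code_meet_le_def code_le_def by simp

section \<open>Recovering the triples from the codes\<close>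

context weighted_tree
begin

text \<open>A special point between x and y decides their order. If there is none, a special point
  above both is used and the masses decide by goodness. If no special point lies above y, then y is
  a limit of special points below it, and one of these separates x from y.\<close>

lemma code_le_iff:
  assumes "good x" "good y"
  shows "code_le S (code x) (code y) \<longleftrightarrow> x \<sqsubseteq> y \<and> (\<exists>s\<in>S. x \<sqsubseteq> s)"
proof -
  have xy: "x \<in> Sp" "y \<in> Sp" using assms supp_subset_Span by (auto simp: good_def)
  have mass: "(\<forall>q. y \<sqsubseteq> s \<and> mass_below y \<le> of_rat q \<longrightarrow> x \<sqsubseteq> s \<and> mass_below x \<le> of_rat q) \<longleftrightarrow>
      mass_below x \<le> mass_below y" if "x \<sqsubseteq> s" "y \<sqsubseteq> s" for s
  proof
    assume *: "\<forall>q. y \<sqsubseteq> s \<and> mass_below y \<le> of_rat q \<longrightarrow> x \<sqsubseteq> s \<and> mass_below x \<le> of_rat q"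
    show "mass_below x \<le> mass_below y"
    proof (rule ccontr)
      assume "\<not> ?thesis"
      then obtain q where "mass_below y < of_rat q" "of_rat q < mass_below x"
        using of_rat_dense[of "mass_below y" "mass_below x"] by auto
      then show False using *[rule_format, of q] that by simp
    qed
  qed (use that in auto)
  have eq: "code_le S (code x) (code y) \<longleftrightarrow> (\<exists>s\<in>S. x \<sqsubseteq> s \<and> s \<sqsubseteq> y) \<or>
      (\<not> (\<exists>s\<in>S. y \<sqsubseteq> s \<and> s \<sqsubseteq> x) \<and> (\<exists>s\<in>S. x \<sqsubseteq> s \<and> y \<sqsubseteq> s \<and> mass_below x \<le> mass_below y))"
  proof -
    have "code x (s, Some 1) \<and> code y (s, Some 1) \<and> (\<forall>q. code y (s, Some q) \<longrightarrow> code x (s, Some q)) \<longleftrightarrow>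
        x \<sqsubseteq> s \<and> y \<sqsubseteq> s \<and> mass_below x \<le> mass_below y" for s
      using mass[of s] unfolding code_simps(3) unfolding code_simps(2) by blast
    then show ?thesis unfolding code_le_def by (simp only: code_simps(1) code_simps(3))
  qed
  show ?thesis
  proof
    assume "code_le S (code x) (code y)"
    then consider s where "s \<in> S" "x \<sqsubseteq> s" "s \<sqsubseteq> y"
      | s where "s \<in> S" "\<not> (\<exists>s\<in>S. y \<sqsubseteq> s \<and> s \<sqsubseteq> x)" "x \<sqsubseteq> s" "y \<sqsubseteq> s" "mass_below x \<le> mass_below y"
      unfolding eq by blast
    then show "x \<sqsubseteq> y \<and> (\<exists>s\<in>S. x \<sqsubseteq> s)"
    proof cases
      case 1
      then show ?thesis using le_trans by blast
    next
      case 2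
      have "x \<sqsubseteq> y"
      proof (rule ccontr)
        assume n: "\<not> x \<sqsubseteq> y"
        then have "y \<sqsubset> x" using le_linear[OF 2(3,4)] by auto
        \<comment> \<open>Were y not special, goodness would make the mass increase strictly from y
          to x.\<close>
        then have "y \<in> S" using assms(2) 2 unfolding good_def by (meson not_le)
        then show False using 2(2) \<open>y \<sqsubset> x\<close> le_refl by blast
      qed
      then show ?thesis using 2 by blast
    qed
  next
    assume le: "x \<sqsubseteq> y \<and> (\<exists>s\<in>S. x \<sqsubseteq> s)"
    then obtain s0 where s0: "s0 \<in> S" "x \<sqsubseteq> s0" by blast
    show "code_le S (code x) (code y)"
    proof (cases "\<exists>s\<in>S. y \<sqsubseteq> s \<and> s \<sqsubseteq> x")
      case True
      then obtain s where s: "s \<in> S" "y \<sqsubseteq> s" "s \<sqsubseteq> x" by blast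
      have "x \<sqsubseteq> s" using le_trans[OF conjunct1[OF le] s(2)] .
      moreover have "s \<sqsubseteq> y" using le_trans[OF s(3) conjunct1[OF le]] .
      ultimately show ?thesis unfolding eq using s(1) by blast
    next
      case no: False
      show ?thesis
      proof (cases "\<exists>t\<in>S. y \<sqsubseteq> t")
        case True
        then obtain t where t: "t \<in> S" "y \<sqsubseteq> t" by blast
        have "x \<sqsubseteq> t" using le_trans[OF conjunct1[OF le] t(2)] .
        moreover have "mass_below x \<le> mass_below y" using le by (intro mass_below_mono) simp
        ultimately show ?thesis unfolding eq using no t by blast
      next
        case False
        then have "x \<sqsubset> y" using s0 le by auto
        then obtain s where "s \<in> S" "x \<sqsubseteq> s" "s \<sqsubset> y"
          using special_between[OF xy(2)] False by metis
        then show ?thesis unfolding eq by blast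
      qed
    qed
  qed
qed

text \<open>\<open>code_le\<close> misses x \<sqsubseteq> y only if no special point lies above x,
  and then x is maximal in the span and y = x. Special points below both arguments decide this case
  and the incomparable one: the meet of incomparable points is special, and a maximal point with
  nothing special above it is a limit of special points below it.\<close>

lemma code_meet_le_iff:
  assumes good: "good x" "good y" "good z"
  shows "code_meet_le S (code x) (code y) (code z) \<longleftrightarrow> meet x y \<sqsubseteq> z"
proof -
  have xyz: "x \<in> Sp" "y \<in> Sp" "z \<in> Sp" using good supp_subset_Span by (auto simp: good_def)
  have incomparable: "(\<forall>s\<in>S. s \<sqsubseteq> x \<and> s \<sqsubseteq> y \<longrightarrow> s \<sqsubseteq> z) \<longleftrightarrow> meet x y \<sqsubseteq> z"
    if "\<not> x \<sqsubseteq> y" "\<not> y \<sqsubseteq> x"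
  proof
    assume "\<forall>s\<in>S. s \<sqsubseteq> x \<and> s \<sqsubseteq> y \<longrightarrow> s \<sqsubseteq> z"
    then show "meet x y \<sqsubseteq> z" using meet_special[OF xyz(1,2) that] by simp
  next
    assume "meet x y \<sqsubseteq> z"
    then show "\<forall>s\<in>S. s \<sqsubseteq> x \<and> s \<sqsubseteq> y \<longrightarrow> s \<sqsubseteq> z" using le_trans[of _ "meet x y" z] by simp
  qed
  have free: "(\<forall>s\<in>S. s \<sqsubseteq> x \<and> s \<sqsubseteq> y \<longrightarrow> s \<sqsubseteq> z) \<longleftrightarrow> x \<sqsubseteq> z"
    if le: "x \<sqsubseteq> y" and no: "\<And>s. s \<in> S \<Longrightarrow> \<not> x \<sqsubseteq> s" and x: "x \<in> Sp" and y: "y \<in> Sp" for x y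
  proof
    assume *: "\<forall>s\<in>S. s \<sqsubseteq> x \<and> s \<sqsubseteq> y \<longrightarrow> s \<sqsubseteq> z"
    show "x \<sqsubseteq> z"
    proof (rule ccontr)
      assume n: "\<not> x \<sqsubseteq> z"
      have leaf: "\<And>w. w \<in> Sp \<Longrightarrow> x \<sqsubseteq> w \<Longrightarrow> w = x"
        using special_above[OF x] no by metis
      have "meet x z \<sqsubset> x" using n meet_le1 meet_le2 by metis
      then obtain s where s: "s \<in> S" "meet x z \<sqsubseteq> s" "s \<sqsubset> x"
        using special_between[OF x no] by blast
      have "s \<sqsubseteq> z" using * s le le_trans by blast
      then have sm: "s = meet x z" using s le_antisym[of s "meet x z"] by simp
      \<comment> \<open>Since s is squeezed onto \<open>meet x z\<close>, a second special point
        strictly above s is taken, from a point w at a height between s and x. It too lies below z,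
        against the choice of the meet.\<close>
      obtain s' where s': "s' \<in> S" "s \<sqsubseteq> s'" "s' \<sqsubset> x" "s' \<noteq> s"
      proof -
        obtain h where h: "dist r s < h" "h < dist r x" using dense lt_height[OF s(3)] by blast
        then obtain w where w: "w \<sqsubseteq> x" "dist r w = h"
          using point_at_height[of h x] zero_le_dist[of r s] by (metis less_imp_le order_trans)
        have "w \<noteq> x" using w h by auto
        then obtain s' where s': "s' \<in> S" "w \<sqsubseteq> s'" "s' \<sqsubset> x"
          using special_between[OF x no] w(1) by blast
        have "s \<sqsubset> w" using le_of_height_less[of s x w] s(3) w h by simp
        then have "s \<sqsubseteq> s'" "s' \<noteq> s" using s'(2) le_trans le_antisym by blast+
        then show thesis using that s' by blast
      qed
      have "s' \<sqsubseteq> z" using * s' le le_trans by blast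
      then have "s' \<sqsubseteq> s" using s'(3) sm by simp
      then show False using s' le_antisym by blast
    qed
  next
    assume "x \<sqsubseteq> z"
    then show "\<forall>s\<in>S. s \<sqsubseteq> x \<and> s \<sqsubseteq> y \<longrightarrow> s \<sqsubseteq> z" using le_trans by blast
  qed
  have free2: "y = x" if "x \<sqsubseteq> y" "\<And>s. s \<in> S \<Longrightarrow> \<not> x \<sqsubseteq> s" "x \<in> Sp" "y \<in> Sp" for x y
    using special_above[OF that(3)] that by metis
  consider "x \<sqsubseteq> y" "\<exists>s\<in>S. x \<sqsubseteq> s" | "x \<sqsubseteq> y" "\<not> (\<exists>s\<in>S. x \<sqsubseteq> s)"
    | "\<not> x \<sqsubseteq> y" "y \<sqsubseteq> x" "\<exists>s\<in>S. y \<sqsubseteq> s" | "\<not> x \<sqsubseteq> y" "y \<sqsubseteq> x" "\<not> (\<exists>s\<in>S. y \<sqsubseteq> s)"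
    | "\<not> x \<sqsubseteq> y" "\<not> y \<sqsubseteq> x" by blast
  then show ?thesis
  proof cases
    case 1
    then show ?thesis unfolding code_meet_le_def by (simp add: code_le_iff good meet_absorb1)
  next
    case 2
    then have [simp]: "y = x" using free2 xyz by blast
    show ?thesis unfolding code_meet_le_def code_simps
      using 2 free[of x x] xyz by (simp add: code_le_iff good meet_absorb1)
  next
    case 3
    then show ?thesis unfolding code_meet_le_def by (simp add: code_le_iff good meet_absorb2)
  next
    case 4
    then show ?thesis using free2[of y x] xyz by auto
  next
    case 5
    then show ?thesis unfolding code_meet_le_def code_simps
      by (simp add: code_le_iff good incomparable)
  qed
qed

end

section \<open>Mass-structural equivalence implies equal laws\<close>

text \<open>Only masses of intersections are at hand, so the product is generated by events that
  demand membership and never exclude it; a single complement restores the coordinate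
  events.\<close>

lemma sets_PiM_bool:
  "sets (\<Pi>\<^sub>M k\<in>K. count_space (UNIV :: bool set)) =
     sigma_sets (PiE K (\<lambda>_. UNIV)) {{\<omega> \<in> PiE K (\<lambda>_. UNIV). \<forall>k\<in>F. \<omega> k} | F. finite F \<and> F \<subseteq> K}"
  (is "sets ?M = sigma_sets ?\<Omega> ?E")
proof
  have gen: "A \<in> sigma_sets ?\<Omega> ?E" if A: "A \<in> {{f \<in> ?\<Omega>. f i \<in> B} | i B. i \<in> K \<and> B \<in> UNIV}" for A
  proof -
    obtain i B where iB: "i \<in> K" "A = {f \<in> ?\<Omega>. f i \<in> B}" using A by blast
    have "{\<omega> \<in> ?\<Omega>. \<forall>k\<in>{i}. \<omega> k} \<in> ?E" using iB(1) by blast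
    then have T: "{\<omega> \<in> ?\<Omega>. \<omega> i} \<in> sigma_sets ?\<Omega> ?E" by (auto intro: sigma_sets.Basic)
    have C: "?\<Omega> - {\<omega> \<in> ?\<Omega>. \<omega> i} \<in> sigma_sets ?\<Omega> ?E" using T by (rule sigma_sets.Compl)
    have "A = (if True \<in> B then {\<omega> \<in> ?\<Omega>. \<omega> i} else {}) \<union>
        (if False \<in> B then ?\<Omega> - {\<omega> \<in> ?\<Omega>. \<omega> i} else {})"
    proof (rule set_eqI)
      fix f
      show "f \<in> A \<longleftrightarrow> f \<in> (if True \<in> B then {\<omega> \<in> ?\<Omega>. \<omega> i} else {}) \<union>
          (if False \<in> B then ?\<Omega> - {\<omega> \<in> ?\<Omega>. \<omega> i} else {})"
        unfolding iB(2) by (cases "f i") auto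
    qed
    also have "\<dots> \<in> sigma_sets ?\<Omega> ?E"
      using T C by (intro sigma_sets_Un) (simp_all add: sigma_sets.Empty)
    finally show ?thesis .
  qed
  show "sets ?M \<subseteq> sigma_sets ?\<Omega> ?E"
    unfolding sets_PiM_single space_count_space sets_count_space Pow_UNIV
    by (rule sigma_sets_mono) (rule subsetI, erule gen)
  have "A \<in> sets ?M" if A: "A \<in> ?E" for A
  proof -
    obtain F where F: "finite F" "F \<subseteq> K" "A = {\<omega> \<in> ?\<Omega>. \<forall>k\<in>F. \<omega> k}" using A by blast
    have "Measurable.pred ?M (\<lambda>\<omega>. \<forall>k\<in>F. \<omega> k)"
      using F(1,2) by (intro pred_intros_finite(3) measurable_component_singleton) auto
    then show ?thesis unfolding F(3) by (simp add: pred_def space_PiM)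
  qed
  then have "sigma_sets (space ?M) ?E \<subseteq> sets ?M"
    by (intro sets.sigma_sets_subset) blast
  then show "sigma_sets ?\<Omega> ?E \<subseteq> sets ?M" by (simp add: space_PiM)
qed

text \<open>The events \<open>\<forall>k\<in>F. \<omega> k\<close> with F finite are closed under
  intersection and generate, so a measure is determined by them; F = {} yields the whole
  space.\<close>

lemma distr_memberships_eq:
  assumes M: "prob_space M" "\<And>k. k \<in> K \<Longrightarrow> Measurable.pred M (A k)"
    and N: "prob_space N" "\<And>k. k \<in> K \<Longrightarrow> Measurable.pred N (B k)"
    and eq: "\<And>F. finite F \<Longrightarrow> F \<subseteq> K \<Longrightarrow>
      emeasure M {x \<in> space M. \<forall>k\<in>F. A k x} = emeasure N {x \<in> space N. \<forall>k\<in>F. B k x}"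
  shows "distr M (\<Pi>\<^sub>M k\<in>K. count_space (UNIV :: bool set)) (\<lambda>x. \<lambda>k\<in>K. A k x) =
         distr N (\<Pi>\<^sub>M k\<in>K. count_space (UNIV :: bool set)) (\<lambda>x. \<lambda>k\<in>K. B k x)"
proof -
  let ?L = "\<Pi>\<^sub>M k\<in>K. count_space (UNIV :: bool set)"
  let ?\<Omega> = "PiE K (\<lambda>_. UNIV :: bool set)"
  let ?E = "{{\<omega> \<in> ?\<Omega>. \<forall>k\<in>F. \<omega> k} | F. finite F \<and> F \<subseteq> K}"
  have mM: "(\<lambda>x. \<lambda>k\<in>K. A k x) \<in> measurable M ?L" using M(2) by (intro measurable_restrict) auto
  have mN: "(\<lambda>x. \<lambda>k\<in>K. B k x) \<in> measurable N ?L" using N(2) by (intro measurable_restrict) auto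
  show ?thesis
  proof (rule measure_eqI_generator_eq[where E = ?E and \<Omega> = ?\<Omega> and A = "\<lambda>_. ?\<Omega>"])
    show "Int_stable ?E"
    proof (rule Int_stableI)
      fix a b assume "a \<in> ?E" "b \<in> ?E"
      then obtain F G where FG: "finite F" "F \<subseteq> K" "finite G" "G \<subseteq> K"
        "a = {\<omega> \<in> ?\<Omega>. \<forall>k\<in>F. \<omega> k}" "b = {\<omega> \<in> ?\<Omega>. \<forall>k\<in>G. \<omega> k}" by blast
      then have "a \<inter> b = {\<omega> \<in> ?\<Omega>. \<forall>k\<in>F \<union> G. \<omega> k}" by blast
      then show "a \<inter> b \<in> ?E" using FG(1-4) by (intro CollectI exI[of _ "F \<union> G"]) simp
    qed
    fix a assume a: "a \<in> ?E"
    then obtain F where F: "finite F" "F \<subseteq> K" "a = {\<omega> \<in> ?\<Omega>. \<forall>k\<in>F. \<omega> k}" by blast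
    have "a \<in> sets ?L" unfolding sets_PiM_bool using a by (rule sigma_sets.Basic)
    moreover have "(\<lambda>x. \<lambda>k\<in>K. A k x) -` a \<inter> space M = {x \<in> space M. \<forall>k\<in>F. A k x}"
      "(\<lambda>x. \<lambda>k\<in>K. B k x) -` a \<inter> space N = {x \<in> space N. \<forall>k\<in>F. B k x}"
      using F(2) unfolding F(3) by (auto simp: subset_iff)
    ultimately show "emeasure (distr M ?L (\<lambda>x. \<lambda>k\<in>K. A k x)) a = emeasure (distr N ?L (\<lambda>x. \<lambda>k\<in>K. B k x)) a"
      using eq[OF F(1,2)] by (simp add: emeasure_distr mM mN)
  next
    have "{\<omega> \<in> ?\<Omega>. \<forall>k\<in>{}. \<omega> k} \<in> ?E" by blast
    then show "range (\<lambda>_. ?\<Omega>) \<subseteq> ?E" by simp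
    show "emeasure (distr M ?L (\<lambda>x. \<lambda>k\<in>K. A k x)) ?\<Omega> \<noteq> \<infinity>"
      using finite_measure.emeasure_finite[OF prob_space.finite_measure[OF prob_space.prob_space_distr[OF M(1) mM]]]
      by simp
  qed (auto simp: sets_PiM_bool)
qed

lemma pred_countable_bex:
  "countable I \<Longrightarrow> (\<And>i. i \<in> I \<Longrightarrow> Measurable.pred M (\<lambda>x. Q x i)) \<Longrightarrow> Measurable.pred M (\<lambda>x. \<exists>i\<in>I. Q x i)"
  unfolding pred_def by (rule sets.sets_Collect_countable_Ex')

lemma pred_countable_ball:
  "countable I \<Longrightarrow> (\<And>i. i \<in> I \<Longrightarrow> Measurable.pred M (\<lambda>x. Q x i)) \<Longrightarrow> Measurable.pred M (\<lambda>x. \<forall>i\<in>I. Q x i)"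
  unfolding pred_def by (rule sets.sets_Collect_countable_All')

lemma pred_code_le:
  assumes "countable I" "\<And>s q. s \<in> I \<Longrightarrow> Measurable.pred M (\<lambda>x. c x (s, q))"
    "\<And>s q. s \<in> I \<Longrightarrow> Measurable.pred M (\<lambda>x. d x (s, q))"
  shows "Measurable.pred M (\<lambda>x. code_le I (c x) (d x))"
  unfolding code_le_def
  by (intro pred_intros_logic(2,3,4,5) pred_countable_bex pred_intros_countable(1) assms)

lemma pred_code_meet_le:
  assumes "countable I" "\<And>s q. s \<in> I \<Longrightarrow> Measurable.pred M (\<lambda>x. c x (s, q))"
    "\<And>s q. s \<in> I \<Longrightarrow> Measurable.pred M (\<lambda>x. d x (s, q))"
    "\<And>s q. s \<in> I \<Longrightarrow> Measurable.pred M (\<lambda>x. e x (s, q))"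
  shows "Measurable.pred M (\<lambda>x. code_meet_le I (c x) (d x) (e x))"
  unfolding code_meet_le_def
  by (intro pred_intros_logic(2,3,4,5) pred_countable_ball pred_code_le assms)

definition code_triples ::
  "'s set \<Rightarrow> nat \<Rightarrow> (nat \<times> 's \<times> rat option \<Rightarrow> bool) \<Rightarrow> (nat \<times> nat \<times> nat) set" where
  "code_triples I n \<omega> = {(i, j, k) \<in> {1..n} \<times> {1..n} \<times> {1..n}. i \<noteq> j \<and>
     code_meet_le I (\<lambda>z. \<omega> (i, z)) (\<lambda>z. \<omega> (j, z)) (\<lambda>z. \<omega> (k, z))}"

lemma measurable_code_triples:
  assumes "countable I"
  shows "code_triples I n \<in> measurable (\<Pi>\<^sub>M k\<in>UNIV \<times> I \<times> UNIV. count_space UNIV) (count_space UNIV)"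
    (is "_ \<in> measurable ?L _")
proof -
  have eq: "code_triples I n \<omega> = A \<longleftrightarrow> A \<subseteq> {1..n} \<times> {1..n} \<times> {1..n} \<and>
    (\<forall>i\<in>{1..n}. \<forall>j\<in>{1..n}. \<forall>k\<in>{1..n}. ((i, j, k) \<in> A) = (i \<noteq> j \<and>
      code_meet_le I (\<lambda>z. \<omega> (i, z)) (\<lambda>z. \<omega> (j, z)) (\<lambda>z. \<omega> (k, z))))" for \<omega> A
    unfolding code_triples_def by auto
  have c: "Measurable.pred ?L (\<lambda>\<omega>. \<omega> (i, s, q))" if "s \<in> I" for i s q
    using that by (intro measurable_component_singleton) auto
  have m: "Measurable.pred ?L (\<lambda>\<omega>. code_meet_le I (\<lambda>z. \<omega> (i, z)) (\<lambda>z. \<omega> (j, z)) (\<lambda>z. \<omega> (k, z)))" for i j k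
    by (intro pred_code_meet_le assms c)
  have "Measurable.pred ?L (\<lambda>\<omega>. ((i, j, k) \<in> A) = (i \<noteq> j \<and>
      code_meet_le I (\<lambda>z. \<omega> (i, z)) (\<lambda>z. \<omega> (j, z)) (\<lambda>z. \<omega> (k, z))))" for i j k A
    using m[of i j k] by (cases "(i, j, k) \<in> A"; cases "i = j") simp_all
  then have all: "Measurable.pred ?L (\<lambda>\<omega>. \<forall>i\<in>{1..n}. \<forall>j\<in>{1..n}. \<forall>k\<in>{1..n}. ((i, j, k) \<in> A) = (i \<noteq> j \<and>
      code_meet_le I (\<lambda>z. \<omega> (i, z)) (\<lambda>z. \<omega> (j, z)) (\<lambda>z. \<omega> (k, z))))" for A
    by (intro pred_intros_finite(3) finite_atLeastAtMost)
  have sub: "code_triples I n \<omega> \<subseteq> {1..n} \<times> {1..n} \<times> {1..n}" for \<omega> by (auto simp: code_triples_def)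
  have "Measurable.pred ?L (\<lambda>\<omega>. code_triples I n \<omega> = A)" for A
  proof (cases "A \<subseteq> {1..n} \<times> {1..n} \<times> {1..n}")
    case True
    then show ?thesis unfolding eq using all[of A] by (simp only: simp_thms)
  next
    case False
    then have "(\<lambda>\<omega>. code_triples I n \<omega> = A) = (\<lambda>\<omega>. False)" using sub by blast
    then show ?thesis by simp
  qed
  then have "code_triples I n \<in> measurable ?L (count_space (Pow ({1..n} \<times> {1..n} \<times> {1..n})))"
    using sub by (subst measurable_count_space_eq2) (auto simp: pred_def vimage_def Int_def conj_commute)
  from measurable_compose[OF this, of "\<lambda>A. A" "count_space UNIV"] show ?thesis by simp
qed

lemma (in weighted_tree) lower_part_negative: "a < 0 \<Longrightarrow> lower_part t a = {}"
proof -
  assume "a < 0"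
  then have "x \<notin> lower_part t a" for x using mass_below_nonneg[of x] by (simp add: lower_part_def)
  then show ?thesis by blast
qed

section \<open>Masses transported by an isomorphism\<close>

locale isomorphic_trees = two_weighted_trees r1 p1 r2 p2
  for r1 :: "'a::polish_space" and p1 :: "'a measure"
  and r2 :: "'b::polish_space" and p2 :: "'b measure" +
  fixes \<phi> :: "'a \<Rightarrow> 'b"
  assumes iso: "mass_structural_isomorphism r1 p1 r2 p2 \<phi>"
begin

lemma bij: "bij_betw \<phi> T1.S T2.S"
  using iso by (simp add: mass_structural_isomorphism_def)

lemma special_image: "s \<in> T1.S \<Longrightarrow> \<phi> s \<in> T2.S"
  using bij_betwE[OF bij] by blast

lemma special_preimage: assumes "s' \<in> T2.S" obtains s where "s \<in> T1.S" "s' = \<phi> s"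
  using bij assms unfolding bij_betw_def by blast

lemma iso_le: "s \<in> T1.S \<Longrightarrow> t \<in> T1.S \<Longrightarrow> T2.le (\<phi> s) (\<phi> t) \<longleftrightarrow> T1.le s t"
  using iso by (simp add: mass_structural_isomorphism_def)

lemma iso_mass:
  assumes "s \<in> T1.S"
  shows "T2.mass_below (\<phi> s) = T1.mass_below s" "measure p2 {\<phi> s} = measure p1 {s}"
    "measure p2 (fringe r2 (\<phi> s)) = measure p1 (fringe r1 s)"
  using iso assms by (simp_all add: mass_structural_isomorphism_def T1.mass_below_def T2.mass_below_def)

text \<open>The threshold is negative, or exceeds all the mass below t, or falls into the jump at a
  special u, or is attained continuously; in each case preserved data determine the mass, and
  \<open>special_preimage\<close> carries the absence of jumps over.\<close>

lemma iso_lower_part: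
  assumes t: "t \<in> T1.S"
  shows "measure p2 (T2.lower_part (\<phi> t) a) = measure p1 (T1.lower_part t a)"
proof -
  consider "a < 0" | "T1.mass_below t \<le> a"
    | u where "u \<in> T1.S" "T1.le u t" "T1.mass_below u - measure p1 {u} \<le> a" "a < T1.mass_below u"
    | "0 \<le> a" "a < T1.mass_below t"
      "\<And>u. u \<in> T1.S \<Longrightarrow> T1.le u t \<Longrightarrow> T1.mass_below u - measure p1 {u} \<le> a \<Longrightarrow> T1.mass_below u \<le> a"
    by (meson not_le)
  then show ?thesis
  proof cases
    case 1
    then have "T1.lower_part t a = {}" "T2.lower_part (\<phi> t) a = {}"
      by (simp_all only: T1.lower_part_negative T2.lower_part_negative)
    then show ?thesis by simp
  next
    case 2
    then show ?thesis
      using t by (simp add: T1.mass_lower_part_full T2.mass_lower_part_full iso_mass)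
  next
    case (3 u)
    then show ?thesis
      using t T1.mass_lower_part_atom[of u t a] T2.mass_lower_part_atom[of "\<phi> u" "\<phi> t" a]
      by (simp add: iso_mass iso_le)
  next
    case 4
    have "T2.mass_below u' \<le> a" if u': "u' \<in> T2.S" "T2.le u' (\<phi> t)"
      "T2.mass_below u' - measure p2 {u'} \<le> a" for u'
    proof -
      obtain u where "u \<in> T1.S" "u' = \<phi> u" using u'(1) by (rule special_preimage)
      then show ?thesis using 4(3)[of u] u' t by (simp add: iso_mass iso_le)
    qed
    then show ?thesis
      using 4 t T1.mass_lower_part_continuous[of a t] T2.mass_lower_part_continuous[of a "\<phi> t"]
      by (simp add: iso_mass)
  qed
qed

text \<open>If s and t are incomparable, both meets are special, hence each is the greatest special
  point below the two arguments, a property that \<phi> preserves.\<close>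

lemma iso_meet:
  assumes s: "s \<in> T1.S" and t: "t \<in> T1.S"
  shows "T1.meet s t \<in> T1.S" "\<phi> (T1.meet s t) = T2.meet (\<phi> s) (\<phi> t)"
proof -
  have in_S: "T1.meet s t \<in> T1.S \<and> \<phi> (T1.meet s t) = T2.meet (\<phi> s) (\<phi> t)"
  proof (cases "T1.le s t \<or> T1.le t s")
    case True
    then show ?thesis
      using s t iso_le[OF s t] iso_le[OF t s]
      by (auto simp: T1.meet_absorb1 T1.meet_absorb2 T2.meet_absorb1 T2.meet_absorb2)
  next
    case False
    have m: "T1.meet s t \<in> T1.S"
      using False T1.meet_special T1.special_in_Span s t by blast
    have m': "T2.meet (\<phi> s) (\<phi> t) \<in> T2.S"
      using False T2.meet_special[OF T2.special_in_Span T2.special_in_Span] special_image s t iso_le by metis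
    then obtain n where n: "n \<in> T1.S" "T2.meet (\<phi> s) (\<phi> t) = \<phi> n" by (rule special_preimage)
    have "T2.le (\<phi> n) (\<phi> s)" "T2.le (\<phi> n) (\<phi> t)" unfolding n(2)[symmetric] by simp_all
    then have "T1.le n (T1.meet s t)" using iso_le n(1) s t by simp
    then have "T2.le (\<phi> n) (\<phi> (T1.meet s t))" using iso_le n(1) m by simp
    moreover have "T2.le (\<phi> (T1.meet s t)) (\<phi> s)" "T2.le (\<phi> (T1.meet s t)) (\<phi> t)"
      using iso_le[OF m s] iso_le[OF m t] by simp_all
    then have "T2.le (\<phi> (T1.meet s t)) (\<phi> n)" unfolding n(2)[symmetric] by simp
    ultimately show ?thesis using m n T2.le_antisym by metis
  qed
  then show "T1.meet s t \<in> T1.S" "\<phi> (T1.meet s t) = T2.meet (\<phi> s) (\<phi> t)" by blast+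
qed

text \<open>The possible finite intersections of fringes: two fringes are nested or disjoint, hence
  the empty case.\<close>

definition corresponding_fringes :: "'a set \<Rightarrow> 'b set \<Rightarrow> bool" where
  "corresponding_fringes A A' \<longleftrightarrow> (A = UNIV \<and> A' = UNIV) \<or> (A = {} \<and> A' = {}) \<or>
     (\<exists>s\<in>T1.S. A = fringe r1 s \<and> A' = fringe r2 (\<phi> s))"

text \<open>The lower parts of s and t intersect in the lower part of \<open>meet s t\<close> at the
  smaller threshold, so a single one is enough.\<close>

definition corresponding_lower_parts :: "'a set \<Rightarrow> 'b set \<Rightarrow> bool" where
  "corresponding_lower_parts A A' \<longleftrightarrow> (A = UNIV \<and> A' = UNIV) \<or>
     (\<exists>t\<in>T1.S. \<exists>a. A = T1.lower_part t a \<and> A' = T2.lower_part (\<phi> t) a)"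

lemma corresponding_fringes_Int:
  assumes A: "corresponding_fringes A A'" and s: "s \<in> T1.S"
  shows "corresponding_fringes (fringe r1 s \<inter> A) (fringe r2 (\<phi> s) \<inter> A')"
proof -
  from A consider "A = UNIV" "A' = UNIV" | "A = {}" "A' = {}"
    | t where "t \<in> T1.S" "A = fringe r1 t" "A' = fringe r2 (\<phi> t)"
    unfolding corresponding_fringes_def by blast
  then show ?thesis
  proof cases
    case 3
    consider "T1.le s t" | "T1.le t s" | "\<not> T1.le s t" "\<not> T1.le t s" by blast
    then show ?thesis
    proof cases
      case 1
      then have "fringe r1 s \<inter> A = A" "fringe r2 (\<phi> s) \<inter> A' = A'"
        using 3 iso_le[OF s 3(1)] T1.le_trans T2.le_trans unfolding fringe_def by blast+
      then show ?thesis using A by simp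
    next
      case 2
      then have "fringe r1 s \<inter> A = fringe r1 s" "fringe r2 (\<phi> s) \<inter> A' = fringe r2 (\<phi> s)"
        using 3 iso_le[OF 3(1) s] T1.le_trans T2.le_trans unfolding fringe_def by blast+
      then show ?thesis using s unfolding corresponding_fringes_def by blast
    next
      case 4: 3
      then have "fringe r1 s \<inter> A = {}" "fringe r2 (\<phi> s) \<inter> A' = {}"
        using 3 iso_le[OF 3(1) s] iso_le[OF s 3(1)] T1.le_linear[of s _ t] T2.le_linear[of "\<phi> s" _ "\<phi> t"]
        unfolding fringe_def by blast+
      then show ?thesis unfolding corresponding_fringes_def by blast
    qed
  qed (use s in \<open>auto simp: corresponding_fringes_def\<close>)
qed

lemma corresponding_lower_parts_Int:
  assumes A: "corresponding_lower_parts A A'" and s: "s \<in> T1.S"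
  shows "corresponding_lower_parts (T1.lower_part s a \<inter> A) (T2.lower_part (\<phi> s) a \<inter> A')"
proof -
  from A consider "A = UNIV" "A' = UNIV"
    | t b where "t \<in> T1.S" "A = T1.lower_part t b" "A' = T2.lower_part (\<phi> t) b"
    unfolding corresponding_lower_parts_def by blast
  then show ?thesis
  proof cases
    case 1
    then show ?thesis using s unfolding corresponding_lower_parts_def by auto
  next
    case (2 t b)
    have "T1.lower_part s a \<inter> A = T1.lower_part (T1.meet s t) (min a b)"
      unfolding 2 T1.lower_part_def by auto
    moreover have "T2.lower_part (\<phi> s) a \<inter> A' = T2.lower_part (\<phi> (T1.meet s t)) (min a b)"
      unfolding 2 T2.lower_part_def iso_meet(2)[OF s 2(1)] by auto
    ultimately show ?thesis
      unfolding corresponding_lower_parts_def using iso_meet(1)[OF s 2(1)] by blast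
  qed
qed

text \<open>A fringe of s meets a lower part of t only if s \<sqsubseteq> t, and then
  \<open>mass_fringe_lower_part\<close> expresses the mass by preserved quantities.\<close>

lemma corresponding_measure:
  assumes A: "corresponding_fringes A A'" and B: "corresponding_lower_parts B B'"
  shows "measure p1 (A \<inter> B) = measure p2 (A' \<inter> B')"
proof -
  have UNIV: "measure p1 UNIV = 1" "measure p2 UNIV = 1"
    using T1.prob_space T2.prob_space by simp_all
  have "measure p1 (fringe r1 s \<inter> T1.lower_part t a) = measure p2 (fringe r2 (\<phi> s) \<inter> T2.lower_part (\<phi> t) a)"
    if st: "s \<in> T1.S" "t \<in> T1.S" for s t a
  proof (cases "T1.le s t")
    case True
    then show ?thesis
      using st iso_le[OF st] by (simp add: T1.mass_fringe_lower_part T2.mass_fringe_lower_part iso_lower_part iso_mass)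
  next
    case False
    then have "fringe r1 s \<inter> T1.lower_part t a = {}" "fringe r2 (\<phi> s) \<inter> T2.lower_part (\<phi> t) a = {}"
      using iso_le[OF st] T1.le_trans[of s _ t] T2.le_trans[of "\<phi> s" _ "\<phi> t"]
      unfolding fringe_def T1.lower_part_def T2.lower_part_def by blast+
    then show ?thesis by simp
  qed
  then show ?thesis
    using A B unfolding corresponding_fringes_def corresponding_lower_parts_def
    by (auto simp: UNIV iso_mass iso_lower_part)
qed

text \<open>Finitely many conditions on a code collapse to one fringe and one lower part, in both
  trees in parallel.\<close>

lemma corresponding_codes:
  assumes "finite F" "F \<subseteq> T1.S \<times> UNIV"
  shows "measure p1 {x. \<forall>(s, q)\<in>F. T1.code x (s, q)} = measure p2 {y. \<forall>(s, q)\<in>F. T2.code y (\<phi> s, q)}"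
proof -
  have "\<exists>A A' B B'. corresponding_fringes A A' \<and> corresponding_lower_parts B B' \<and>
      {x. \<forall>(s, q)\<in>F. T1.code x (s, q)} = A \<inter> B \<and> {y. \<forall>(s, q)\<in>F. T2.code y (\<phi> s, q)} = A' \<inter> B'"
    using assms
  proof (induction F rule: finite_induct)
    case empty
    have "corresponding_fringes UNIV UNIV" "corresponding_lower_parts UNIV UNIV"
      by (simp_all add: corresponding_fringes_def corresponding_lower_parts_def)
    then show ?case by (intro exI[of _ UNIV]) simp
  next
    case (insert k F)
    obtain s q where k: "k = (s, q)" by (cases k)
    have s: "s \<in> T1.S" using insert.prems k by auto
    obtain A A' B B' where IH: "corresponding_fringes A A'" "corresponding_lower_parts B B'"
      "{x. \<forall>(s, q)\<in>F. T1.code x (s, q)} = A \<inter> B" "{y. \<forall>(s, q)\<in>F. T2.code y (\<phi> s, q)} = A' \<inter> B'"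
      using insert.IH insert.prems by blast
    show ?case
    proof (cases q)
      case None
      have "{x. \<forall>(s, q)\<in>insert k F. T1.code x (s, q)} = fringe r1 s \<inter> {x. \<forall>(s, q)\<in>F. T1.code x (s, q)}"
        "{y. \<forall>(s, q)\<in>insert k F. T2.code y (\<phi> s, q)} = fringe r2 (\<phi> s) \<inter> {y. \<forall>(s, q)\<in>F. T2.code y (\<phi> s, q)}"
        by (auto simp: k None T1.code_def T2.code_def fringe_def)
      then have "{x. \<forall>(s, q)\<in>insert k F. T1.code x (s, q)} = (fringe r1 s \<inter> A) \<inter> B"
        "{y. \<forall>(s, q)\<in>insert k F. T2.code y (\<phi> s, q)} = (fringe r2 (\<phi> s) \<inter> A') \<inter> B'"
        unfolding IH(3,4) by (simp_all only: Int_assoc)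
      then show ?thesis using corresponding_fringes_Int[OF IH(1) s] IH(2) by blast
    next
      case (Some a)
      have "{x. \<forall>(s, q)\<in>insert k F. T1.code x (s, q)} =
          T1.lower_part s (of_rat a) \<inter> {x. \<forall>(s, q)\<in>F. T1.code x (s, q)}"
        "{y. \<forall>(s, q)\<in>insert k F. T2.code y (\<phi> s, q)} =
          T2.lower_part (\<phi> s) (of_rat a) \<inter> {y. \<forall>(s, q)\<in>F. T2.code y (\<phi> s, q)}"
        by (auto simp: k Some T1.code_def T2.code_def)
      then have "{x. \<forall>(s, q)\<in>insert k F. T1.code x (s, q)} = A \<inter> (T1.lower_part s (of_rat a) \<inter> B)"
        "{y. \<forall>(s, q)\<in>insert k F. T2.code y (\<phi> s, q)} = A' \<inter> (T2.lower_part (\<phi> s) (of_rat a) \<inter> B')"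
        unfolding IH(3,4) by (simp_all only: Int_left_commute)
      then show ?thesis using corresponding_lower_parts_Int[OF IH(2) s] IH(1) by blast
    qed
  qed
  then show ?thesis using corresponding_measure by auto
qed

end

section \<open>Comparison of the laws through the codes\<close>

context weighted_tree
begin

lemma code_in_sets: "{x. code x k} \<in> sets p"
proof (cases "snd k")
  case None
  then have "{x. code x k} = fringe r (fst k)" by (simp add: code_def fringe_def)
  then show ?thesis by simp
next
  case (Some q)
  then have "{x. code x k} = lower_part (fst k) (of_rat q)" by (simp add: code_def)
  then show ?thesis by simp
qed

lemma pred_code: "Measurable.pred P (\<lambda>X. code (X i) k)"
proof -
  have "Measurable.pred p (\<lambda>x. code x k)" using code_in_sets by (simp add: pred_def)
  then show ?thesis by (rule measurable_compose[OF measurable_component_singleton, rotated]) simp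
qed

text \<open>Almost surely all samples are good, and then the triples are a function of the codes.
  Indexing by I through \<phi> places the codes of different trees in one product space.\<close>

lemma distr_triples_codes:
  assumes \<phi>: "bij_betw \<phi> I S" "countable I"
  shows "distr P (count_space UNIV) (triples n) =
    distr (distr P (\<Pi>\<^sub>M k\<in>UNIV \<times> I \<times> UNIV. count_space UNIV)
      (\<lambda>X. \<lambda>k\<in>UNIV \<times> I \<times> UNIV. code (X (fst k)) (\<phi> (fst (snd k)), snd (snd k))))
      (count_space UNIV) (code_triples I n)"
proof -
  let ?c = "\<lambda>X. \<lambda>k\<in>UNIV \<times> I \<times> UNIV. code (X (fst k)) (\<phi> (fst (snd k)), snd (snd k))"
  let ?L = "\<Pi>\<^sub>M k\<in>UNIV \<times> I \<times> (UNIV :: rat option set). count_space (UNIV :: bool set)"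
  have c: "?c \<in> measurable P ?L" by (intro measurable_restrict pred_code)
  have restr: "code_meet_le I (\<lambda>z. ?c X (i, z)) (\<lambda>z. ?c X (j, z)) (\<lambda>z. ?c X (k, z)) \<longleftrightarrow>
      code_meet_le S (code (X i)) (code (X j)) (code (X k))" for X i j k
  proof -
    have "code_meet_le I (\<lambda>z. ?c X (i, z)) (\<lambda>z. ?c X (j, z)) (\<lambda>z. ?c X (k, z)) \<longleftrightarrow>
      code_meet_le I (\<lambda>(s, q). code (X i) (\<phi> s, q)) (\<lambda>(s, q). code (X j) (\<phi> s, q)) (\<lambda>(s, q). code (X k) (\<phi> s, q))"
      unfolding code_meet_le_def code_le_def by simp
    then show ?thesis using code_meet_le_reindex[OF \<phi>(1)] by simp
  qed
  have "AE X in P. \<forall>i. good (X i)"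
    by (intro AE_all_countable[THEN iffD2] allI AE_PiM_component[OF prob UNIV_I AE_good])
  then have "AE X in P. triples n X = code_triples I n (?c X)"
  proof eventually_elim
    case (elim X)
    then have "code_meet_le S (code (X i)) (code (X j)) (code (X k)) \<longleftrightarrow> meet (X i) (X j) \<sqsubseteq> X k" for i j k
      by (simp add: code_meet_le_iff)
    then show ?case unfolding triples_def code_triples_def restr by (simp only:)
  qed
  then have "distr P (count_space UNIV) (triples n) = distr P (count_space UNIV) (\<lambda>X. code_triples I n (?c X))"
    by (intro distr_cong_AE refl measurable_triples measurable_compose[OF c measurable_code_triples[OF \<phi>(2)]])
  also have "\<dots> = distr (distr P ?L ?c) (count_space UNIV) (code_triples I n)"
    by (subst distr_distr[OF measurable_code_triples[OF \<phi>(2)] c]) (simp add: comp_def)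
  finally show ?thesis .
qed

end

context isomorphic_trees
begin

lemma same_triples: "same_triples"
proof -
  let ?K = "(UNIV :: nat set) \<times> T1.S \<times> (UNIV :: rat option set)"
  let ?L = "\<Pi>\<^sub>M k\<in>?K. count_space (UNIV :: bool set)"
  interpret P1: product_prob_space "\<lambda>_. p1" "UNIV :: nat set" ..
  interpret P2: product_prob_space "\<lambda>_. p2" "UNIV :: nat set" ..
  have "distr T1.P ?L (\<lambda>X. \<lambda>k\<in>?K. T1.code (X (fst k)) (id (fst (snd k)), snd (snd k))) =
    distr T2.P ?L (\<lambda>Y. \<lambda>k\<in>?K. T2.code (Y (fst k)) (\<phi> (fst (snd k)), snd (snd k)))"
  proof (rule distr_memberships_eq[OF T1.prob_P T1.pred_code T2.prob_P T2.pred_code])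
    fix F assume F: "finite F" "F \<subseteq> ?K"
    \<comment> \<open>The conditions in F are grouped by sample index, since the probability
      factorises over the samples by independence.\<close>
    define G where "G i = {z. (i, z) \<in> F}" for i
    have fin: "finite (G i)" and sub: "G i \<subseteq> T1.S \<times> UNIV" for i
    proof -
      have "G i \<subseteq> snd ` F" by (force simp: G_def)
      then show "finite (G i)" using F(1) finite_surj by blast
      show "G i \<subseteq> T1.S \<times> UNIV" using F(2) by (auto simp: G_def)
    qed
    note eq = corresponding_codes[OF fin sub]
    have sets1: "{x. \<forall>(s, q)\<in>G i. T1.code x (s, q)} \<in> sets p1" for i
    proof -
      have "Measurable.pred p1 (\<lambda>x. \<forall>z\<in>G i. T1.code x z)"
        using T1.code_in_sets by (intro pred_intros_finite(3) fin) (simp add: pred_def)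
      then show ?thesis by (simp add: pred_def split_def)
    qed
    have sets2: "{y. \<forall>(s, q)\<in>G i. T2.code y (\<phi> s, q)} \<in> sets p2" for i
    proof -
      have "Measurable.pred p2 (\<lambda>y. \<forall>z\<in>G i. T2.code y (\<phi> (fst z), snd z))"
        using T2.code_in_sets by (intro pred_intros_finite(3) fin) (simp add: pred_def)
      then show ?thesis by (simp add: pred_def split_def)
    qed
    have "{X \<in> space T1.P. \<forall>k\<in>F. T1.code (X (fst k)) (id (fst (snd k)), snd (snd k))} =
        {X \<in> space T1.P. \<forall>i\<in>fst ` F. X i \<in> {x. \<forall>(s, q)\<in>G i. T1.code x (s, q)}}"
      by (force simp: G_def)
    then have "emeasure T1.P {X \<in> space T1.P. \<forall>k\<in>F. T1.code (X (fst k)) (id (fst (snd k)), snd (snd k))} =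
        (\<Prod>i\<in>fst ` F. emeasure p1 {x. \<forall>(s, q)\<in>G i. T1.code x (s, q)})"
      using P1.emeasure_PiM_Collect[of "fst ` F" "\<lambda>i. {x. \<forall>(s, q)\<in>G i. T1.code x (s, q)}"] F(1) sets1 by simp
    also have "\<dots> = (\<Prod>i\<in>fst ` F. emeasure p2 {y. \<forall>(s, q)\<in>G i. T2.code y (\<phi> s, q)})"
      unfolding T1.emeasure_eq_measure T2.emeasure_eq_measure eq by (rule refl)
    also have "\<dots> = emeasure T2.P {Y \<in> space T2.P. \<forall>i\<in>fst ` F. Y i \<in> {y. \<forall>(s, q)\<in>G i. T2.code y (\<phi> s, q)}}"
      using P2.emeasure_PiM_Collect[of "fst ` F" "\<lambda>i. {y. \<forall>(s, q)\<in>G i. T2.code y (\<phi> s, q)}"] F(1) sets2 by simp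
    also have "{Y \<in> space T2.P. \<forall>i\<in>fst ` F. Y i \<in> {y. \<forall>(s, q)\<in>G i. T2.code y (\<phi> s, q)}} =
        {Y \<in> space T2.P. \<forall>k\<in>F. T2.code (Y (fst k)) (\<phi> (fst (snd k)), snd (snd k))}"
      by (force simp: G_def)
    finally show "emeasure T1.P {X \<in> space T1.P. \<forall>k\<in>F. T1.code (X (fst k)) (id (fst (snd k)), snd (snd k))} =
        emeasure T2.P {Y \<in> space T2.P. \<forall>k\<in>F. T2.code (Y (fst k)) (\<phi> (fst (snd k)), snd (snd k))}" .
  qed
  then show ?thesis
    unfolding same_triples_def
    using T1.distr_triples_codes[OF bij_betw_id T1.countable_special]
      T2.distr_triples_codes[OF bij T1.countable_special] by simp
qed

end

theorem theorem2:
  fixes r1 :: "'a::polish_space" and p1 :: "'a measure"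
    and r2 :: "'b::polish_space" and p2 :: "'b measure"
  assumes "rooted_weighted_real_tree r1 p1"
    and "rooted_weighted_real_tree r2 p2"
  shows "mass_structurally_equivalent r1 p1 r2 p2 \<longleftrightarrow> Theta r1 p1 = Theta r2 p2"
proof -
  interpret two_weighted_trees r1 p1 r2 p2
    using assms unfolding rooted_weighted_real_tree_def
    by (intro two_weighted_trees.intro weighted_tree.intro rooted_tree.intro weighted_tree_axioms.intro)
       (elim conjE; assumption)+
  show ?thesis
    unfolding Theta_eq_iff
  proof
    assume "mass_structurally_equivalent r1 p1 r2 p2"
    then obtain \<phi> where "mass_structural_isomorphism r1 p1 r2 p2 \<phi>"
      unfolding mass_structurally_equivalent_def by blast
    then interpret isomorphic_trees r1 p1 r2 p2 \<phi> by unfold_locales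
    show same_triples by (rule same_triples)
  qed (rule equivalent_if_same_triples)
qed

end
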